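(* Let $\alpha$ be an irrational real number whose continued fraction expansion $\alpha=[a_0;a_1,a_2,\dots]$ has unbounded partial quotients, i.e. $\sup_{k\ge 1} a_k=\infty$. Then the limit $\lim_{x\to\alpha,\ x\in\mathbb{Q}\setminus\{0\}} h(x)$ exists and is finite.
   Context: For a real number $x$ define $\mathbf{J}_{4_1}(x)=\sum_{n=0}^{\infty}\prod_{k=1}^{n}\left|1-e^{2\pi i k x}\right|^2$ (the colored Jones polynomial $J_{4_1,0}$ of the figure-eight knot evaluated at $q=e^{2\pi i x}$); for rational $x$ all terms with $n$ at least the denominator of $x$ vanish, so the sum is finite, and it is at least $1$ (the $n=0$ term, an empty product, equals $1$). Define $h(x)=\log\frac{\mathbf{J}_{4_1}(x)}{\mathbf{J}_{4_1}(1/x)}$ for $x\in\mathbb{Q}\setminus\{0\}$. The limit is taken as $x$ tends to $\alpha$ in the real topology through nonzero rationals. *)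

theory Defs
  imports Complex_Main
begin

text \<open>Only meaningful for rational \<open>x\<close>: there all but finitely many terms of the series vanish.\<close>

definition J41 :: "real \<Rightarrow> real" where
  "J41 x = (\<Sum>n. \<Prod>k=1..n. (cmod (1 - exp (2 * of_real pi * \<i> * of_nat k * of_real x)))\<^sup>2)"

definition h :: "real \<Rightarrow> real" where
  "h x = ln (J41 x / J41 (1 / x))"

text \<open>Complete quotients and partial quotients of the regular continued fraction expansion
  \<open>x = [a\<^sub>0; a\<^sub>1, a\<^sub>2, \<dots>]\<close>. They are intended for irrational \<open>x\<close>, where
  no fractional part vanishes and the expansion is infinite.\<close>

fun cf_complete :: "real \<Rightarrow> nat \<Rightarrow> real" where
  "cf_complete x 0 = x"
| "cf_complete x (Suc n) = 1 / frac (cf_complete x n)"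

definition cf_partial :: "real \<Rightarrow> nat \<Rightarrow> int" where
  "cf_partial x n = \<lfloor>cf_complete x n\<rfloor>"

end

theory Submission
  imports Defs "HOL-Analysis.Analysis" "HOL-Real_Asymp.Real_Asymp"
begin

text \<open>
  Write \<open>P\<^sub>n(x)\<close> for the product \<open>\<Prod>k=1..n. |1 - e(kx)|\<close> with \<open>e(t) = exp (2\<pi>it)\<close>. Consider the Gibbs measure
  on the unit circle which gives the point \<open>e(ny)\<close> a mass proportional to \<open>P\<^sub>n(y)\<^sup>2\<close>.

  For rational \<open>0 < x < 1\<close> the quotient \<open>P\<^sub>n(x) / P\<^sub>m(1/x)\<close>, where \<open>m = \<lfloor>nx\<rfloor>\<close>, is a value of the double sine
  function with periods \<open>1\<close> and \<open>x\<close> at a point depending on \<open>nx - m\<close> only. Summing over \<open>n\<close> with \<open>m\<close> fixed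
  exhibits \<open>J(x) / J(1/x)\<close>, up to \<open>1 / J(1/x)\<close>, as the expectation, under the Gibbs measure at \<open>y = 1/x\<close>, of a function on the circle
  that is continuous in \<open>x\<close> and in the point, except for a jump at \<open>1\<close>. It remains to show that the Gibbs
  measures converge weakly as \<open>y\<close> tends to \<open>\<beta> = 1/\<alpha>\<close>.

  From \<open>|1 - z|\<^sup>2 = 2 - z - 1/z\<close> the twisted Fourier coefficients \<open>c\<^sub>m\<close> of the Gibbs measure satisfy
  \<open>c\<^sub>m\<^sub>+\<^sub>1 + c\<^sub>m\<^sub>-\<^sub>1 = (2 - e(-my)) c\<^sub>m + 1/J(y)\<close>, and \<open>1/J(y)\<close> tends to \<open>0\<close>. Two different weak limits would thus
  give two independent bounded solutions of the limiting recurrence, so that all its solutions would be bounded.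
  But if \<open>|\<beta> - p/q|\<close> is far smaller than \<open>1/q\<^sup>2\<close>, the recurrence stays close to a \<open>q\<close>-periodic one over many
  periods, and the periodic one has a Floquet solution whose multiplier is bounded away from the unit circle.
\<close>

subsection \<open>The character \<open>t \<mapsto> exp (2\<pi>it)\<close>\<close>

text \<open>The multipliers lam and 1/lam of the periodic recurrence satisfy lam + 1/lam = 2 -
  \<open>\<phi> ^ q\<close>, where \<open>\<phi>\<close> is a free phase. For
  \<open>\<phi> ^ q\<close> = 1 both lie on the unit circle, so a comparison that starts at index 0
  would yield nothing. The phase is therefore tuned: starting the window at index m0 makes
  \<open>\<phi> ^ q\<close> equal to e(-m0 (q \<beta> - p)), and since q \<beta> - p is small but
  nonzero, some m0 brings it into the left half plane, where one multiplier has modulus at least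
  3/2, whatever q is. This uniformity fixes the order of the choices. The bound and the Wronskian of
  a hypothetical pair of bounded solutions determine the number n of periods, n determines the
  required quality of approximation, and only then is p/q taken. Over n periods the accumulated
  perturbation has order n^2 q^2 |\<beta> - p/q|; this is where unbounded partial quotients enter.
  On the double sine side, the shifts by 1 and by x must be normalised by one and the same linear
  term. This compatibility is derived for rational x, from finite sine products.\<close>

definition ee :: "real \<Rightarrow> complex" where
  "ee t = cis (2 * pi * t)"

lemma norm_ee [simp]: "cmod (ee t) = 1"
  by (simp add: ee_def)

lemma ee_nonzero [simp]: "ee t \<noteq> 0"
  by (simp add: ee_def)

lemma ee_0 [simp]: "ee 0 = 1"
  by (simp add: ee_def)

lemma ee_add: "ee (s + t) = ee s * ee t"
  by (simp add: ee_def cis_mult distrib_left)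

lemma ee_minus: "ee (- t) = inverse (ee t)"
  by (simp add: ee_def)

lemma ee_diff: "ee (s - t) = ee s / ee t"
  using ee_add[of s "-t"] by (simp add: ee_minus divide_inverse)

lemma cnj_ee: "cnj (ee t) = ee (- t)"
  by (simp add: ee_def cis_cnj)

lemma ee_power: "ee t ^ n = ee (n * t)"
  by (simp add: ee_def Complex.DeMoivre mult.assoc mult.left_commute)

lemma ee_of_int [simp]: "ee (of_int n) = 1"
  by (simp add: ee_def complex_eq_iff)

lemma ee_eq_1_iff: "ee t = 1 \<longleftrightarrow> t \<in> \<int>"
proof
  assume "ee t = 1"
  then have "cos (2 * pi * t) = 1"
    by (simp add: ee_def complex_eq_iff)
  then obtain n :: int where "2 * pi * t = of_int n * (2 * pi)"
    by (auto simp: cos_one_2pi_int)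
  then show "t \<in> \<int>" by auto
next
  assume "t \<in> \<int>"
  then show "ee t = 1" by (auto elim: Ints_cases)
qed

lemma ee_frac: "ee (frac t) = ee t"
  by (simp add: frac_def ee_diff)

lemma tendsto_ee [tendsto_intros]: "(f \<longlongrightarrow> l) F \<Longrightarrow> ((\<lambda>x. ee (f x)) \<longlongrightarrow> ee l) F"
  unfolding ee_def cis_conv_exp by (intro tendsto_intros)

lemma norm_ee_diff_le: "cmod (ee s - ee t) \<le> 2 * pi * \<bar>s - t\<bar>"
proof -
  have "ee s - ee t = ee t * (ee (s - t) - 1)"
    by (simp add: ee_diff algebra_simps)
  then have "cmod (ee s - ee t) = cmod (exp (\<i> * of_real (2 * pi * (s - t))) - 1)"
    by (simp add: norm_mult ee_def cis_conv_exp)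
  also have "\<dots> = 2 * \<bar>sin (2 * pi * (s - t) / 2)\<bar>"
    by (rule dist_exp_i_1)
  also have "\<dots> \<le> 2 * \<bar>2 * pi * (s - t) / 2\<bar>"
    using abs_sin_x_le_abs_x by (intro mult_left_mono) auto
  finally show ?thesis by (simp add: abs_mult)
qed

lemma cmod_1_minus_ee: "cmod (1 - ee t) = 2 * \<bar>sin (pi * t)\<bar>"
proof -
  have "cmod (1 - ee t) = cmod (exp (\<i> * of_real (2 * pi * t)) - 1)"
    by (simp add: ee_def cis_conv_exp norm_minus_commute)
  also have "\<dots> = 2 * \<bar>sin (2 * pi * t / 2)\<bar>"
    by (rule dist_exp_i_1)
  finally show ?thesis by simp
qed

lemma cmod_1_minus_ee_squared: 
  "complex_of_real ((cmod (1 - ee t))\<^sup>2) = 2 - ee t - ee (- t)"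
proof -
  have "complex_of_real ((cmod (1 - ee t))\<^sup>2) = (1 - ee t) * cnj (1 - ee t)"
    by (simp only: complex_norm_square)
  also have "\<dots> = 2 - ee t - ee (- t)"
    by (simp add: cnj_ee algebra_simps flip: ee_add)
  finally show ?thesis .
qed

subsection \<open>Roots of unity\<close>

lemma ee_rational_inj:
  fixes p :: int and q :: nat
  assumes "q > 0" "coprime p (int q)" "i < q" "j < q" "ee (real i * (p / q)) = ee (real j * (p / q))"
  shows "i = j"
proof -
  have "ee (real i * (p / q) - real j * (p / q)) = 1"
    using assms(5) by (simp add: ee_diff)
  then obtain n where n: "real i * (p / q) - real j * (p / q) = of_int n"
    by (auto simp: ee_eq_1_iff elim: Ints_cases)
  then have "(real i - real j) * p = of_int n * q"
    using assms(1) by (simp add: field_simps)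
  then have "real_of_int ((int i - int j) * p) = real_of_int (n * int q)"
    by simp
  then have "(int i - int j) * p = n * int q"
    by (simp only: of_int_eq_iff)
  then have "int q dvd (int i - int j) * p" by simp
  then have "int q dvd int i - int j"
    using assms(2) by (metis coprime_commute coprime_dvd_mult_left_iff)
  moreover have "\<bar>int i - int j\<bar> < int q" using assms(3,4) by auto
  ultimately show ?thesis
    by (metis dvd_imp_le_int abs_of_nat eq_iff_diff_eq_0 not_le of_nat_eq_iff)
qed

text \<open>The factorisation of X^q - 1 read at 1/z: \<open>P\<close> and \<open>Q\<close> are
  monic of degree q and agree at the q distinct points e(n p/q). The free \<open>z\<close> later
  takes up the Floquet exponent.\<close>

lemma prod_1_minus_roots_of_unity:
  fixes p :: int and q :: nat and z :: complex
  assumes "q > 0" "coprime p (int q)"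
  shows "(\<Prod>n<q. 1 - z * ee (real n * (p / q))) = 1 - z ^ q"
proof -
  define r where "r n = ee (real n * (p / q))" for n
  have inj: "inj_on r {..<q}"
    unfolding r_def inj_on_def using ee_rational_inj[OF assms] by auto
  define P where "P = (\<Prod>n<q. [:- r n, 1:])"
  define Q where "Q = monom 1 q + [:- 1 :: complex:]"
  have degP: "degree P = q"
    unfolding P_def by (subst degree_prod_eq_sum_degree) auto
  have lcP: "lead_coeff P = 1"
    unfolding P_def by (subst lead_coeff_prod) auto
  have degQ: "degree Q = q"
    unfolding Q_def using assms(1) by (subst degree_add_eq_left) (auto simp: degree_monom_eq)
  have lcQ: "coeff Q q = 1"
    unfolding Q_def using assms(1) by (cases q) auto
  have rq: "r n ^ q = 1" for n
  proof -
    have "real q * (real n * (p / q)) = of_int (int n * p)"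
      using assms(1) by simp
    then show ?thesis unfolding r_def ee_power by (metis ee_of_int)
  qed
  have PQ: "P = Q"
  proof (rule poly_eqI_degree_lead_coeff[where n = q and A = "r ` {..<q}"])
    show "card (r ` {..<q}) \<ge> q" using inj by (simp add: card_image)
  next
    fix x assume "x \<in> r ` {..<q}"
    then obtain n where n: "n < q" "x = r n" by auto
    have "poly P x = 0" unfolding P_def poly_prod using n by (auto intro!: prod_zero)
    moreover have "poly Q x = 0" unfolding Q_def using n rq by (simp add: poly_monom)
    ultimately show "poly P x = poly Q x" by simp
  qed (use degP degQ lcP lcQ in auto)
  show ?thesis
  proof (cases "z = 0")
    case True
    then show ?thesis using assms(1) by simp
  next
    case False
    have "(\<Prod>n<q. 1 - z * r n) = (\<Prod>n<q. (1 / z - r n) * z)"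
      using False by (intro prod.cong) (auto simp: field_simps)
    also have "\<dots> = poly P (1 / z) * z ^ q"
      unfolding P_def poly_prod by (simp add: prod.distrib)
    also have "\<dots> = 1 - z ^ q"
      unfolding PQ Q_def using False by (simp add: poly_monom power_divide field_simps)
    finally show ?thesis unfolding r_def .
  qed
qed

subsection \<open>Bounded solutions of the limiting recurrence\<close>

lemma sum_ee_rational:
  fixes p :: int and q :: nat
  assumes "q > 0" "coprime p (int q)" "n < q" "n > 0"
  shows "(\<Sum>j<q. ee (real n * real j * (p / q))) = 0"
proof -
  define r where "r = ee (real n * (p / q))"
  have "r \<noteq> 1"
    using ee_rational_inj[OF assms(1,2,3,1)] assms(4) by (auto simp: r_def)
  have "real q * (real n * (p / q)) = of_int (int n * p)"
    using assms(1) by simp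
  then have rq: "r ^ q = 1" unfolding r_def ee_power by (metis ee_of_int)
  have "(\<Sum>j<q. ee (real n * real j * (p / q))) = (\<Sum>j<q. r ^ j)"
    unfolding r_def ee_power by (intro sum.cong) (auto simp: mult_ac)
  also have "\<dots> = 0" using \<open>r \<noteq> 1\<close> rq by (simp add: geometric_sum)
  finally show ?thesis .
qed

text \<open>Floquet solutions: the ansatz \<open>u\<^sub>j = \<kappa>\<^sup>j (\<Sum>n<q. w\<^sub>n \<zeta>\<^sup>n\<^sup>j)\<close> turns the recurrence into a first-order one for
  \<open>w\<close>, whose \<open>q\<close>-periodicity is the equation for the multiplier \<open>lam = \<kappa>\<^sup>q\<close>.\<close>

lemma floquet_solution:
  fixes p :: int and q :: nat and \<phi> lam :: complex
  assumes q: "q > 0" and cop: "coprime p (int q)" and \<phi>: "\<phi> \<noteq> 0" and lam: "lam \<noteq> 0"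
    and eq: "(1 - lam) * (1 - 1 / lam) = \<phi> ^ q"
  obtains u :: "nat \<Rightarrow> complex" where
    "\<And>j. u (j + 2) + u j = (2 - \<phi> * ee (- (real (j + 1) * (p / q)))) * u (j + 1)"
    "\<And>j. u (j + q) = lam * u j" "u 0 \<noteq> 0 \<or> u 1 \<noteq> 0"
proof -
  define z where "z n = ee (real n * (p / q))" for n
  have z_add: "z (m + n) = z m * z n" for m n
    by (simp add: z_def distrib_right add_divide_distrib flip: ee_add)
  have z0: "z n \<noteq> 0" for n by (simp add: z_def)
  have z_neg: "ee (- (real n * (p / q))) = 1 / z n" for n
    by (simp add: z_def ee_minus divide_inverse)
  have zq: "z (n * q) = 1" for n
  proof -
    have "real (n * q) * (p / q) = of_int (int n * p)"
      using q by simp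
    then show ?thesis unfolding z_def by (metis ee_of_int)
  qed
  obtain \<kappa> where \<kappa>: "\<kappa> ^ q = lam"
  proof
    show "exp (Ln lam / of_nat q) ^ q = lam"
      using q lam by (simp flip: exp_of_nat_mult)
  qed
  have \<kappa>0: "\<kappa> \<noteq> 0" using \<kappa> lam q by auto
  \<comment> \<open>Comparing Fourier coefficients asks for \<phi> w(n+1) = (2 - c - 1/c) w(n) with
    c = \<kappa> z(n), and 2 - c - 1/c = (1 - c)(1 - 1/c).\<close>
  define w where "w n = (\<Prod>i<n. (1 - \<kappa> * z i) * (1 - (1 / \<kappa>) * (1 / z i)) / \<phi>)" for n
  have w0: "w 0 = 1" by (simp add: w_def)
  have wSuc: "\<phi> * w (Suc n) = (2 - \<kappa> * z n - 1 / (\<kappa> * z n)) * w n" for n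
    using \<kappa>0 z0[of n] \<phi> by (simp add: w_def field_simps)
  \<comment> \<open>Once round the cycle the factors multiply to (1 - lam)(1 - 1/lam) /
    \<open>\<phi> ^ q\<close>, which is 1 by \<open>eq\<close>.\<close>
  have wq: "w q = 1"
  proof -
    have "(\<Prod>i<q. 1 - \<kappa> * z i) = 1 - \<kappa> ^ q"
      unfolding z_def by (rule prod_1_minus_roots_of_unity[OF q cop])
    moreover have "(\<Prod>i<q. 1 - (1 / \<kappa>) * (1 / z i)) = 1 - (1 / \<kappa>) ^ q"
    proof -
      have "coprime (- p) (int q)" using cop by simp
      from prod_1_minus_roots_of_unity[OF q this, of "1 / \<kappa>"]
      show ?thesis by (simp flip: z_neg)
    qed
    ultimately have "w q = (1 - \<kappa> ^ q) * (1 - (1 / \<kappa>) ^ q) / \<phi> ^ q"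
      unfolding w_def prod_dividef prod.distrib by simp
    also have "\<dots> = 1" using eq \<phi> by (simp add: power_divide \<kappa>)
    finally show ?thesis .
  qed
  define u where "u j = \<kappa> ^ j * (\<Sum>n<q. w n * z (n * j))" for j
  have rec: "u (j + 2) + u j = (2 - \<phi> * ee (- (real (j + 1) * (p / q)))) * u (j + 1)" for j
  proof -
    have "2 * u (j + 1) - u (j + 2) - u j
        = \<kappa> ^ (j + 1) * (\<Sum>n<q. z (n * (j + 1)) * ((2 - \<kappa> * z n - 1 / (\<kappa> * z n)) * w n))"
    proof -
      have "2 * (w n * z (n * (j + 1))) * \<kappa> ^ (j+1) - \<kappa> ^ (j + 2) * (w n * z (n * (j + 2))) - \<kappa> ^ j * (w n * z (n * j)) 
         = \<kappa> ^ (j + 1) * (z (n * (j + 1)) * ((2 - \<kappa> * z n - 1 / (\<kappa> * z n)) * w n))" for n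
      proof -
        have "z (n * (j + 2)) = z (n * (j + 1)) * z n" "z (n * (j + 1)) = z (n * j) * z n"
          by (simp_all add: algebra_simps flip: z_add)
        then show ?thesis using \<kappa>0 z0[of n] by (simp add: field_simps)
      qed
      then have "(\<Sum>n<q. 2 * (w n * z (n * (j + 1))) * \<kappa> ^ (j+1) - \<kappa> ^ (j + 2) * (w n * z (n * (j + 2))) - \<kappa> ^ j * (w n * z (n * j)))
         = (\<Sum>n<q. \<kappa> ^ (j + 1) * (z (n * (j + 1)) * ((2 - \<kappa> * z n - 1 / (\<kappa> * z n)) * w n)))"
        by (intro sum.cong) auto
      then show ?thesis unfolding u_def
        by (simp add: sum_subtractf sum_distrib_left mult_ac)
    qed
    also have "\<dots> = \<kappa> ^ (j + 1) * (\<Sum>n<q. \<phi> * (1 / z (j + 1)) * (w (Suc n) * z (Suc n * (j + 1))))"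
    proof -
      have "z (n * (j + 1)) = 1 / z (j + 1) * z (Suc n * (j + 1))" for n
      proof -
        have "z (Suc n * (j + 1)) = z (j + 1) * z (n * (j + 1))" for n
          by (simp only: mult_Suc z_add)
        then show ?thesis using z0[of "j + 1"] by (simp del: mult_Suc)
      qed
      then show ?thesis by (subst wSuc[symmetric]) (simp only: mult_ac)
    qed
    also have "\<dots> = \<phi> * (1 / z (j + 1)) * (\<kappa> ^ (j + 1) * (\<Sum>n<q. w (Suc n) * z (Suc n * (j + 1))))"
      by (simp only: sum_distrib_left mult_ac)
    \<comment> \<open>The index shift is cyclic: the new term n = q equals the lost term n = 0
      because \<open>w q = w 0\<close>.\<close>
    also have "(\<Sum>n<q. w (Suc n) * z (Suc n * (j + 1))) = (\<Sum>n<q. w n * z (n * (j + 1)))"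
    proof -
      have "(\<Sum>n<q. w (Suc n) * z (Suc n * (j + 1))) + w 0 * z 0 = (\<Sum>n<Suc q. w n * z (n * (j + 1)))"
        by (subst sum.lessThan_Suc_shift) simp
      also have "\<dots> = (\<Sum>n<q. w n * z (n * (j + 1))) + w q * z ((j + 1) * q)"
        by (simp add: mult.commute)
      finally show ?thesis using wq w0 zq[of "j + 1"] zq[of 0] by simp
    qed
    finally have "2 * u (j + 1) - u (j + 2) - u j = \<phi> * (1 / z (j + 1)) * u (j + 1)"
      unfolding u_def .
    then show ?thesis unfolding z_neg by (simp add: algebra_simps)
  qed
  have per: "u (j + q) = lam * u j" for j
  proof -
    have "z (n * (j + q)) = z (n * j)" for n
      using zq[of n] by (simp add: distrib_left z_add)
    then show ?thesis unfolding u_def by (simp add: power_add \<kappa> mult_ac)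
  qed
  \<comment> \<open>If both vanished, so would every u(j); but summing the Fourier sums over j
    isolates q times \<open>w 0\<close>, which is q.\<close>
  have "u 0 \<noteq> 0 \<or> u 1 \<noteq> 0"
  proof (rule ccontr)
    assume "\<not> ?thesis"
    then have u01: "u 0 = 0 \<and> u 1 = 0" by simp
    have "u j = 0 \<and> u (j + 1) = 0" for j
    proof (induction j)
      case (Suc j)
      then show ?case using rec[of j] by simp
    qed (use u01 in simp)
    then have "(\<Sum>n<q. w n * z (n * j)) = 0" for j
      using \<kappa>0 by (auto simp: u_def)
    then have "0 = (\<Sum>j<q. \<Sum>n<q. w n * z (n * j))" by simp
    also have "\<dots> = (\<Sum>n<q. w n * (\<Sum>j<q. z (n * j)))"
      by (subst sum.swap) (simp add: sum_distrib_left)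
    also have "\<dots> = (\<Sum>n<q. if n = 0 then of_nat q else 0)"
    proof (intro sum.cong refl)
      fix n assume "n \<in> {..<q}"
      then show "w n * (\<Sum>j<q. z (n * j)) = (if n = 0 then of_nat q else 0)"
        using sum_ee_rational[OF q cop, of n] w0 by (auto simp: z_def)
    qed
    also have "\<dots> = of_nat q" using q by simp
    finally show False using q by simp
  qed
  with rec per show ?thesis using that by blast
qed

text \<open>lam and 1/lam are the roots of X^2 - t X + 1 with t = 2 - s, and |t|^2 = 5 - 4 Re s is
  at least 5. The threshold 3/2 works since 3/2 + 2/3 = 13/6 is less than the square root of
  5.\<close>

lemma multiplier_exists:
  fixes s :: complex
  assumes "Re s \<le> 0" "cmod s = 1"
  obtains lam where "(1 - lam) * (1 - 1 / lam) = s" "cmod lam \<ge> 3 / 2"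
proof -
  note concl = that
  define t where "t = 2 - s"
  define r where "r = csqrt (t\<^sup>2 - 4)"
  have r2: "r\<^sup>2 = t\<^sup>2 - 4" by (simp add: r_def)
  define a where "a = (t + r) / 2"
  define b where "b = (t - r) / 2"
  have "4 * (a * b) = (t + r) * (t - r)" by (simp add: a_def b_def)
  also have "\<dots> = t\<^sup>2 - r\<^sup>2" by (simp add: power2_eq_square algebra_simps)
  finally have "4 * (a * b) = t\<^sup>2 - r\<^sup>2" .
  then have ab: "a * b = 1" by (simp add: r2)
  have apb: "a + b = t" by (simp add: a_def b_def field_simps)
  have "(cmod t)\<^sup>2 \<ge> 5"
  proof -
    have "(Re s)\<^sup>2 + (Im s)\<^sup>2 = 1" using assms(2) by (simp add: cmod_def)
    moreover have "(cmod t)\<^sup>2 = (2 - Re s)\<^sup>2 + (Im s)\<^sup>2" by (simp add: cmod_power2 t_def)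
    ultimately have "(cmod t)\<^sup>2 = 5 - 4 * Re s"
      by (simp add: power2_eq_square algebra_simps)
    then show ?thesis using assms(1) by simp
  qed
  then have ct: "cmod t > 13 / 6"
    using power_mono[of "cmod t" "13 / 6" 2] by (fastforce simp: power2_eq_square)
  have key: ?thesis if xy: "x * y = 1" "x + y = t" "cmod x \<ge> 1" for x y
  proof -
    have x0: "x \<noteq> 0" using xy by auto
    then have y: "y = 1 / x" using xy(1) by (simp add: field_simps)
    have "cmod x \<ge> 3 / 2"
    proof (rule ccontr)
      assume "\<not> ?thesis"
      then have lt: "cmod x < 3 / 2" by simp
      have "(cmod x - 1) * (cmod x - 3 / 2) \<le> 0" using lt xy(3) by (simp add: mult_le_0_iff)
      then have "cmod x * cmod x + 1 \<le> 13 / 6 * cmod x"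
        using lt unfolding left_diff_distrib right_diff_distrib by linarith
      then have "(cmod x * cmod x + 1) / cmod x \<le> 13 / 6"
        using xy(3) by (subst pos_divide_le_eq) auto
      then have "cmod x + 1 / cmod x \<le> 13 / 6"
        using x0 by (simp add: add_divide_distrib)
      moreover have "cmod t \<le> cmod x + 1 / cmod x"
        using norm_triangle_ineq[of x y] xy(2) by (simp add: y norm_divide)
      ultimately show False using ct by simp
    qed
    moreover have "(1 - x) * (1 - 1 / x) = s"
      using xy x0 by (simp add: y t_def field_simps)
    ultimately show ?thesis by (rule concl[rotated])
  qed
  have "cmod a * cmod b = 1" using ab by (metis norm_mult norm_one)
  then have "\<not> (cmod a < 1 \<and> cmod b < 1)"
    using mult_strict_mono[of "cmod a" 1 "cmod b" 1] by auto
  then consider "cmod a \<ge> 1" | "cmod b \<ge> 1" by linarith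
  then show ?thesis
  proof cases
    case 1
    from key[OF ab apb this] show ?thesis .
  next
    case 2
    have "b * a = 1" "b + a = t" using ab apb by (simp_all add: mult.commute add.commute)
    from key[OF this 2] show ?thesis .
  qed
qed

definition well_approx :: "real \<Rightarrow> bool" where
  "well_approx \<beta> \<longleftrightarrow> (\<forall>a>0. \<exists>(p::int) (q::nat). q > 0 \<and> \<bar>\<beta> - p / q\<bar> \<le> 1 / (a * (real q)\<^sup>2))"

text \<open>Cancelling the gcd keeps p/q and shrinks q, so the bound to be met only becomes
  weaker.\<close>

lemma well_approx_coprime:
  assumes "well_approx \<beta>" "a > 0"
  obtains p :: int and q :: nat
  where "q > 0" "coprime p (int q)" "\<bar>\<beta> - p / q\<bar> \<le> 1 / (a * (real q)\<^sup>2)"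
proof -
  obtain p :: int and q :: nat where pq: "q > 0" "\<bar>\<beta> - p / q\<bar> \<le> 1 / (a * (real q)\<^sup>2)"
    using assms unfolding well_approx_def by blast
  define g where "g = gcd p (int q)"
  have g: "g > 0" using pq(1) by (simp add: g_def)
  obtain p' q' where *: "p = p' * g" "int q = q' * g" "coprime p' q'"
  proof -
    have "gcd p (int q) \<noteq> 0" using g by (simp add: g_def)
    from gcd_coprime_exists[OF this] show ?thesis using that unfolding g_def by blast
  qed
  have "q' * g > 0" using *(2) pq(1) by linarith
  then have q': "q' > 0" using g by (simp add: zero_less_mult_iff)
  have rq: "real q = of_int q' * of_int g"
    using arg_cong[OF *(2), of real_of_int] by simp
  show ?thesis
  proof (rule that[of "nat q'" p'])
    show "nat q' > 0" "coprime p' (int (nat q'))" using q' *(3) by auto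
    have "p / q = p' / nat q'"
      using g q' by (simp add: *(1) rq)
    moreover have "1 / (a * (real q)\<^sup>2) \<le> 1 / (a * (real (nat q'))\<^sup>2)"
    proof -
      have "q' * 1 \<le> q' * g" using g q' by (intro mult_left_mono) auto
      then have "q' \<le> int q" using *(2) by simp
      then have "real (nat q') \<le> real q" by linarith
      then have "a * (real (nat q'))\<^sup>2 \<le> a * (real q)\<^sup>2"
        using assms(2) by (intro mult_left_mono power_mono) auto
      then show ?thesis using assms(2) q' pq(1) by (intro divide_left_mono) (auto intro!: mult_pos_pos)
    qed
    ultimately show "\<bar>\<beta> - p' / nat q'\<bar> \<le> 1 / (a * (real (nat q'))\<^sup>2)"
      using pq(2) by simp
  qed
qed

text \<open>The coefficient of \<open>f m\<close> in the recurrence is 1, so the transfer matrices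
  have determinant 1.\<close>

lemma wronskian_constant:
  fixes f g v :: "nat \<Rightarrow> complex"
  assumes f: "\<And>m. f (m + 2) + f m = (2 - v m) * f (m + 1)"
    and g: "\<And>m. g (m + 2) + g m = (2 - v m) * g (m + 1)"
  shows "f m * g (m + 1) - f (m + 1) * g m = f 0 * g 1 - f 1 * g 0"
proof (induction m)
  case (Suc m)
  have f2: "f (m + 2) = (2 - v m) * f (m + 1) - f m" and g2: "g (m + 2) = (2 - v m) * g (m + 1) - g m"
    using f[of m] g[of m] by (simp_all only: eq_diff_eq)
  have "f (m + 1) * g (m + 2) - f (m + 2) * g (m + 1) = f m * g (m + 1) - f (m + 1) * g m"
    unfolding f2 g2 by (simp add: algebra_simps)
  with Suc show ?case by simp
qed simp

text \<open>Variation of constants: a solution \<open>u\<close> of a perturbed recurrence, expressed in a bounded basis \<open>f, g\<close>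
  of solutions of the unperturbed one, grows slowly.\<close>

lemma perturbed_solution_bound:
  fixes f g u v v' :: "nat \<Rightarrow> complex"
  assumes f: "\<And>m. f (m + 2) + f m = (2 - v m) * f (m + 1)"
    and g: "\<And>m. g (m + 2) + g m = (2 - v m) * g (m + 1)"
    and u: "\<And>m. u (m + 2) + u m = (2 - v' m) * u (m + 1)"
    and W: "f 0 * g 1 - f 1 * g 0 = W" "W \<noteq> 0"
    and bd: "\<And>m. cmod (f m) \<le> B" "\<And>m. cmod (g m) \<le> B" 
    and eta: "\<And>m. m < N \<Longrightarrow> cmod (v' m - v m) \<le> \<eta>"
  shows "cmod (u N) + cmod (u (N + 1))
      \<le> 4 * B\<^sup>2 / cmod W * exp (2 * B\<^sup>2 / cmod W * (real N * \<eta>)) * (cmod (u 0) + cmod (u 1))"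
proof -
  have Wm: "f m * g (m + 1) - f (m + 1) * g m = W" for m
    using wronskian_constant[of f v g m] f g W(1) by simp
  have B0: "B \<ge> 0" using bd(1)[of 0] norm_ge_zero order_trans by blast
  \<comment> \<open>Coordinates of (u(m), u(m+1)) in the basis f, g by Cramer's rule; they would be
    constant if \<open>v'\<close> were \<open>v\<close>.\<close>
  define a where "a m = (u m * g (m + 1) - u (m + 1) * g m) / W" for m
  define b where "b m = (f m * u (m + 1) - f (m + 1) * u m) / W" for m
  define S where "S m = cmod (a m) + cmod (b m)" for m
  have u0: "u m = a m * f m + b m * g m" for m
  proof -
    have *: "W * u m = (u m * g (m + 1) - u (m + 1) * g m) * f m + (f m * u (m + 1) - f (m + 1) * u m) * g m"
      unfolding Wm[of m, symmetric] by (simp add: algebra_simps)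
    have "u m = W * u m / W" using W(2) by simp
    then show ?thesis unfolding a_def b_def * by (simp add: add_divide_distrib)
  qed
  have u1: "u (m + 1) = a m * f (m + 1) + b m * g (m + 1)" for m
  proof -
    have *: "W * u (m + 1) = (u m * g (m + 1) - u (m + 1) * g m) * f (m + 1) + (f m * u (m + 1) - f (m + 1) * u m) * g (m + 1)"
      unfolding Wm[of m, symmetric] by (simp add: algebra_simps)
    have "u (m + 1) = W * u (m + 1) / W" using W(2) by simp
    then show ?thesis unfolding a_def b_def * by (simp add: add_divide_distrib)
  qed
  have comb: "cmod (x * y + z * w) \<le> B * (cmod x + cmod z)" if "cmod y \<le> B" "cmod w \<le> B" for x y z w
  proof -
    have "cmod (x * y + z * w) \<le> cmod x * cmod y + cmod z * cmod w"
      by (metis norm_mult norm_triangle_ineq)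
    also have "\<dots> \<le> cmod x * B + cmod z * B"
      using that by (intro add_mono mult_left_mono) auto
    finally show ?thesis by (simp add: algebra_simps)
  qed
  have ub: "cmod (u m) \<le> B * S m" for m
    unfolding S_def u0[of m] by (intro comb bd)
  have ub1: "cmod (u (m + 1)) \<le> B * S m" for m
    unfolding S_def u1[of m] by (intro comb bd)
  have step: "S (Suc m) \<le> S m * (1 + 2 * B\<^sup>2 / cmod W * \<eta>)" if "m < N" for m
  proof -
    have f2: "f (m + 2) = (2 - v m) * f (m + 1) - f m" and g2: "g (m + 2) = (2 - v m) * g (m + 1) - g m"
      and u2: "u (m + 2) = (2 - v' m) * u (m + 1) - u m"
      using f[of m] g[of m] u[of m] by (simp_all add: algebra_simps)
    have "a (Suc m) = (u (m + 1) * g (m + 2) - u (m + 2) * g (m + 1)) / W" by (simp add: a_def)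
    also have "u (m + 1) * g (m + 2) - u (m + 2) * g (m + 1)
        = (u m * g (m + 1) - u (m + 1) * g m) + (v' m - v m) * u (m + 1) * g (m + 1)"
      unfolding g2 u2 by (simp add: algebra_simps)
    finally have a': "a (Suc m) = a m + (v' m - v m) * u (m + 1) * g (m + 1) / W"
      by (simp add: a_def add_divide_distrib)
    have "b (Suc m) = (f (m + 1) * u (m + 2) - f (m + 2) * u (m + 1)) / W" by (simp add: b_def)
    also have "f (m + 1) * u (m + 2) - f (m + 2) * u (m + 1)
        = (f m * u (m + 1) - f (m + 1) * u m) - (v' m - v m) * u (m + 1) * f (m + 1)"
      unfolding f2 u2 by (simp add: algebra_simps)
    finally have b': "b (Suc m) = b m - (v' m - v m) * u (m + 1) * f (m + 1) / W"
      by (simp add: b_def diff_divide_distrib)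
    have est: "cmod ((v' m - v m) * u (m + 1) * x / W) \<le> \<eta> * (B * S m) * B / cmod W" if "cmod x \<le> B" for x
    proof -
      have "cmod ((v' m - v m) * u (m + 1) * x / W) = cmod (v' m - v m) * cmod (u (m + 1)) * cmod x / cmod W"
        by (simp add: norm_mult norm_divide)
      also have "\<dots> \<le> \<eta> * (B * S m) * B / cmod W"
      proof -
        have "\<eta> \<ge> 0" using eta[OF \<open>m < N\<close>] norm_ge_zero order_trans by blast
        then show ?thesis using eta[OF \<open>m < N\<close>] ub1[of m] that B0
          by (intro divide_right_mono mult_mono mult_nonneg_nonneg) (auto simp: S_def)
      qed
      finally show ?thesis .
    qed
    define R where "R = \<eta> * (B * S m) * B / cmod W"
    have "cmod (a (Suc m)) \<le> cmod (a m) + R"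
      unfolding a' R_def by (rule norm_triangle_le) (intro add_left_mono est bd)
    moreover have "cmod (b (Suc m)) \<le> cmod (b m) + R"
      unfolding b' R_def by (rule order_trans[OF norm_triangle_ineq4]) (intro add_left_mono est bd)
    ultimately have "S (Suc m) \<le> S m + 2 * R" unfolding S_def by linarith
    then have "S (Suc m) \<le> S m + 2 * (\<eta> * (B * S m) * B / cmod W)" unfolding R_def .
    then show ?thesis by (simp add: algebra_simps power2_eq_square)
  qed
  \<comment> \<open>Discrete Gronwall: each factor 1 + t is bounded by exp t.\<close>
  have SN: "S m \<le> S 0 * exp (2 * B\<^sup>2 / cmod W * (real m * \<eta>))" if "m \<le> N" for m
    using that
  proof (induction m)
    case (Suc m)
    have "\<eta> \<ge> 0" using eta[of m] Suc(2) norm_ge_zero order_trans by (metis Suc_le_lessD)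
    have "S (Suc m) \<le> S m * (1 + 2 * B\<^sup>2 / cmod W * \<eta>)" using step Suc(2) by simp
    also have "\<dots> \<le> (S 0 * exp (2 * B\<^sup>2 / cmod W * (real m * \<eta>))) * exp (2 * B\<^sup>2 / cmod W * \<eta>)"
      using Suc \<open>\<eta> \<ge> 0\<close> exp_ge_add_one_self[of "2 * B\<^sup>2 / cmod W * \<eta>"] 
      by (intro mult_mono) (auto simp: S_def intro!: add_nonneg_nonneg mult_nonneg_nonneg divide_nonneg_nonneg)
    also have "\<dots> = S 0 * exp (2 * B\<^sup>2 / cmod W * (real (Suc m) * \<eta>))"
      by (simp add: algebra_simps add_divide_distrib flip: exp_add)
    finally show ?case .
  qed simp
  have S0: "S 0 \<le> 2 * B / cmod W * (cmod (u 0) + cmod (u 1))"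
  proof -
    have "cmod (u 0 * g 1 - u 1 * g 0) \<le> B * (cmod (u 0) + cmod (u 1))"
      using comb[of "g 1" "- g 0" "u 0" "u 1"] bd by simp
    moreover have "cmod (f 0 * u 1 - f 1 * u 0) \<le> B * (cmod (u 0) + cmod (u 1))"
      using comb[of "f 0" "- f 1" "u 1" "u 0"] bd by (simp add: mult.commute add.commute)
    ultimately have "cmod (u 0 * g 1 - u 1 * g 0) + cmod (f 0 * u 1 - f 1 * u 0) \<le> 2 * B * (cmod (u 0) + cmod (u 1))"
      by simp
    then have "(cmod (u 0 * g 1 - u 1 * g 0) + cmod (f 0 * u 1 - f 1 * u 0)) / cmod W \<le> 2 * B * (cmod (u 0) + cmod (u 1)) / cmod W"
      by (rule divide_right_mono) simp
    then show ?thesis unfolding S_def a_def b_def by (simp add: norm_divide add_divide_distrib)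
  qed
  have "cmod (u N) + cmod (u (N + 1)) \<le> 2 * B * S N"
    using ub[of N] ub1[of N] by simp
  also have "\<dots> \<le> 2 * B * (2 * B / cmod W * (cmod (u 0) + cmod (u 1)) * exp (2 * B\<^sup>2 / cmod W * (real N * \<eta>)))"
    using B0 by (intro mult_left_mono order_trans[OF SN[OF order_refl]] mult_right_mono S0) auto
  also have "2 * B * (2 * B / cmod W * t * x) = 4 * B\<^sup>2 / cmod W * x * t" for t x
    by (simp add: power2_eq_square)
  finally show ?thesis .
qed

text \<open>Suppose the Wronskian W is nonzero. Over a window of n periods a Floquet solution for
  p/q in place of \<beta> grows by at least (3/2)^n, while variation of constants in the basis f, g
  permits only the factor \<open>C\<close>, which depends on B and W alone.\<close>

lemma bounded_solutions_dependent:
  fixes f g :: "nat \<Rightarrow> complex"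
  assumes irr: "\<beta> \<notin> \<rat>" and wa: "well_approx \<beta>"
    and f: "\<And>m. f (m + 2) + f m = (2 - ee (- (real (m + 1) * \<beta>))) * f (m + 1)"
    and g: "\<And>m. g (m + 2) + g m = (2 - ee (- (real (m + 1) * \<beta>))) * g (m + 1)"
    and bd: "\<And>m. cmod (f m) \<le> B" "\<And>m. cmod (g m) \<le> B"
  shows "f 0 * g 1 = f 1 * g 0"
proof (rule ccontr)
  assume neq: "f 0 * g 1 \<noteq> f 1 * g 0"
  define W where "W = f 0 * g 1 - f 1 * g 0"
  have W0: "W \<noteq> 0" using neq by (simp add: W_def)
  have Wm: "f m * g (m + 1) - f (m + 1) * g m = W" for m
    using wronskian_constant[OF f g] by (simp add: W_def)
  define C where "C = 4 * B\<^sup>2 / cmod W * exp (2 * B\<^sup>2 / cmod W)"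
  obtain n :: nat where n: "(3 / 2) ^ n > C" "n > 0"
  proof -
    obtain n :: nat where "(3 / 2) ^ n > max C 1"
      using real_arch_pow[of "3/2" "max C 1"] by auto
    then show ?thesis using that[of n] by (cases n) auto
  qed
  \<comment> \<open>The 4 makes |\<theta>| at most 1/4, so that the multiples of |\<theta>| cannot
    jump over [1/4, 1/2]; the other summand makes the accumulated perturbation
    \<open>real N * \<eta>\<close> at most 1.\<close>
  define a where "a = 4 + 2 * pi * n * n"
  have a: "a > 0" "a \<ge> 4" by (auto simp: a_def intro!: add_pos_nonneg)
  obtain p :: int and q :: nat where q: "q > 0" and cop: "coprime p (int q)"
    and app: "\<bar>\<beta> - p / q\<bar> \<le> 1 / (a * (real q)\<^sup>2)"
    using well_approx_coprime[OF wa a(1)] by blast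
  define \<theta> where "\<theta> = q * \<beta> - p"
  have \<theta>0: "\<theta> \<noteq> 0"
  proof
    assume "\<theta> = 0"
    then have "\<beta> = of_int p / of_nat q" using q by (simp add: \<theta>_def field_simps)
    then show False using irr by simp
  qed
  have "\<bar>\<theta>\<bar> = q * \<bar>\<beta> - p / q\<bar>" using q by (simp add: \<theta>_def abs_mult_pos' field_simps flip: abs_mult)
  also have "\<dots> \<le> q * (1 / (a * (real q)\<^sup>2))" using app by (intro mult_left_mono) auto
  also have "\<dots> = 1 / (a * q)" using q by (simp add: power2_eq_square)
  also have "\<dots> \<le> 1 / 4" using a q mult_mono[of 4 a 1 "real q"] by (simp add: field_simps)
  finally have \<theta>4: "\<bar>\<theta>\<bar> \<le> 1 / 4" .
  \<comment> \<open>The start of the window: 2 pi m0 |\<theta>| lies in [pi/2, pi], which puts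
    \<open>\<phi> ^ q\<close> into the left half plane.\<close>
  define m0 where "m0 = nat \<lceil>1 / (4 * \<bar>\<theta>\<bar>)\<rceil>"
  have "real m0 = of_int \<lceil>1 / (4 * \<bar>\<theta>\<bar>)\<rceil>"
  proof -
    have "0 \<le> 1 / (4 * \<bar>\<theta>\<bar>)" by simp
    then have "0 \<le> \<lceil>1 / (4 * \<bar>\<theta>\<bar>)\<rceil>" by linarith
    then show ?thesis unfolding m0_def by (rule of_nat_nat)
  qed
  then have "real m0 \<ge> 1 / (4 * \<bar>\<theta>\<bar>)" "real m0 < 1 / (4 * \<bar>\<theta>\<bar>) + 1"
    by linarith+
  then have m0: "m0 * \<bar>\<theta>\<bar> \<ge> 1 / 4" "m0 * \<bar>\<theta>\<bar> \<le> 1 / 2"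
    using \<theta>0 \<theta>4 by (auto simp: field_simps)
  define \<phi> where "\<phi> = ee (- (real m0 * \<beta>))"
  have \<phi>q: "\<phi> ^ q = ee (- (real m0 * \<theta>))"
  proof -
    have "\<phi> ^ q = ee (- (real m0 * \<theta>) - of_int (int m0 * p))"
      unfolding \<phi>_def ee_power \<theta>_def by (simp add: algebra_simps)
    then show ?thesis by (simp only: ee_diff ee_of_int) simp
  qed
  have "Re (\<phi> ^ q) = cos (2 * pi * (m0 * \<bar>\<theta>\<bar>))"
    unfolding \<phi>q by (simp add: ee_def abs_if)
  also have "\<dots> \<le> cos (pi / 2)"
    using m0 pi_gt_zero by (intro cos_monotone_0_pi_le) (auto simp: field_simps)
  finally have "Re (\<phi> ^ q) \<le> 0" by simp
  then obtain lam where lam: "(1 - lam) * (1 - 1 / lam) = \<phi> ^ q" "cmod lam \<ge> 3 / 2"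
    using multiplier_exists[of "\<phi> ^ q"] by (auto simp: \<phi>q)
  have nz: "\<phi> \<noteq> 0" "lam \<noteq> 0" using lam(2) by (auto simp: \<phi>_def)
  obtain u where u: "\<And>j. u (j + 2) + u j = (2 - \<phi> * ee (- (real (j + 1) * (p / q)))) * u (j + 1)"
    and per: "\<And>j. u (j + q) = lam * u j" and u01: "u 0 \<noteq> 0 \<or> u 1 \<noteq> 0"
    by (rule floquet_solution[OF q cop nz lam(1)]) blast
  define N where "N = n * q"
  have uN: "u (j + k * q) = lam ^ k * u j" for j k
  proof (induction k)
    case (Suc k)
    then show ?case using per[of "j + k * q"] by (simp add: algebra_simps)
  qed simp
  define \<eta> where "\<eta> = 2 * pi * (real N * \<bar>\<beta> - p / q\<bar>)"
  have "cmod (u N) + cmod (u (N + 1))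
      \<le> 4 * B\<^sup>2 / cmod W * exp (2 * B\<^sup>2 / cmod W * (real N * \<eta>)) * (cmod (u 0) + cmod (u 1))"
  proof (rule perturbed_solution_bound[where f = "\<lambda>m. f (m0 + m)" and g = "\<lambda>m. g (m0 + m)" and
          v = "\<lambda>m. ee (- (real (m0 + m + 1) * \<beta>))" and v' = "\<lambda>j. \<phi> * ee (- (real (j + 1) * (p / q)))"])
    fix m
    show "f (m0 + (m + 2)) + f (m0 + m) = (2 - ee (- (real (m0 + m + 1) * \<beta>))) * f (m0 + (m + 1))"
      using f[of "m0 + m"] by (simp add: add.assoc)
    show "g (m0 + (m + 2)) + g (m0 + m) = (2 - ee (- (real (m0 + m + 1) * \<beta>))) * g (m0 + (m + 1))"
      using g[of "m0 + m"] by (simp add: add.assoc)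
    show "u (m + 2) + u m = (2 - \<phi> * ee (- (real (m + 1) * (p / q)))) * u (m + 1)" by (rule u)
    show "cmod (f (m0 + m)) \<le> B" "cmod (g (m0 + m)) \<le> B" using bd by auto
    assume m: "m < N"
    have "ee (- (real (m0 + m + 1) * \<beta>)) = \<phi> * ee (- (real (m + 1) * \<beta>))"
      unfolding \<phi>_def ee_add[symmetric] by (simp add: algebra_simps)
    then have "cmod (\<phi> * ee (- (real (m + 1) * (p / q))) - ee (- (real (m0 + m + 1) * \<beta>)))
        = cmod (\<phi> * (ee (- (real (m + 1) * (p / q))) - ee (- (real (m + 1) * \<beta>))))"
      by (simp add: algebra_simps)
    also have "\<dots> = cmod (ee (- (real (m + 1) * (p / q))) - ee (- (real (m + 1) * \<beta>)))"
      by (simp add: norm_mult \<phi>_def)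
    also have "\<dots> \<le> 2 * pi * \<bar>- (real (m + 1) * (p / q)) - (- (real (m + 1) * \<beta>))\<bar>"
      by (rule norm_ee_diff_le)
    also have "\<bar>- (real (m + 1) * (p / q)) - (- (real (m + 1) * \<beta>))\<bar> = real (m + 1) * \<bar>\<beta> - p / q\<bar>"
    proof -
      have "- (real (m + 1) * (p / q)) - (- (real (m + 1) * \<beta>)) = real (m + 1) * (\<beta> - p / q)"
        by (simp add: algebra_simps)
      then show ?thesis by (simp only: abs_mult abs_of_nat)
    qed
    also have "2 * pi * (real (m + 1) * \<bar>\<beta> - p / q\<bar>) \<le> \<eta>"
      unfolding \<eta>_def using m by (intro mult_left_mono mult_right_mono) auto
    finally show "cmod (\<phi> * ee (- (real (m + 1) * (p / q))) - ee (- (real (m0 + m + 1) * \<beta>))) \<le> \<eta>" by simp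
  qed (use Wm[of m0] W0 in auto)
  also have "\<dots> \<le> C * (cmod (u 0) + cmod (u 1))"
  proof -
    have "real N * \<eta> = 2 * pi * (real n)\<^sup>2 * ((real q)\<^sup>2 * \<bar>\<beta> - p / q\<bar>)"
      by (simp add: N_def \<eta>_def power2_eq_square)
    also have "\<dots> \<le> 2 * pi * (real n)\<^sup>2 * ((real q)\<^sup>2 * (1 / (a * (real q)\<^sup>2)))"
      using app by (intro mult_left_mono) auto
    also have "\<dots> = 2 * pi * (real n)\<^sup>2 / a" using q by simp
    also have "\<dots> \<le> 1" using a by (simp add: a_def power2_eq_square)
    finally have "2 * B\<^sup>2 / cmod W * (real N * \<eta>) \<le> 2 * B\<^sup>2 / cmod W * 1"
      by (intro mult_left_mono) auto
    then have "2 * B\<^sup>2 / cmod W * (real N * \<eta>) \<le> 2 * B\<^sup>2 / cmod W" by simp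
    then show ?thesis unfolding C_def by (intro mult_right_mono mult_left_mono) auto
  qed
  also have "\<dots> < (3 / 2) ^ n * (cmod (u 0) + cmod (u 1))"
  proof -
    have "cmod (u 0) + cmod (u 1) > 0"
      using u01 by (auto intro: add_pos_nonneg add_nonneg_pos)
    then show ?thesis using n(1) by simp
  qed
  also have "\<dots> \<le> cmod lam ^ n * (cmod (u 0) + cmod (u 1))"
    using lam(2) by (intro mult_right_mono power_mono) auto
  also have "\<dots> = cmod (u N) + cmod (u (N + 1))"
    using uN[of 0 n] uN[of 1 n] by (simp add: N_def norm_mult norm_power distrib_left)
  finally show False by simp
qed

subsection \<open>The weights and their sum\<close>

definition wt :: "real \<Rightarrow> nat \<Rightarrow> real" where
  "wt y n = (\<Prod>k=1..n. (cmod (1 - ee (real k * y)))\<^sup>2)"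

lemma J41_wt: "J41 y = (\<Sum>n. wt y n)"
proof -
  have "exp (2 * of_real pi * \<i> * of_nat k * of_real y) = ee (real k * y)" for k
    by (simp add: ee_def cis_conv_exp mult_ac)
  then show ?thesis unfolding J41_def wt_def by simp
qed

lemma wt_0 [simp]: "wt y 0 = 1"
  by (simp add: wt_def)

lemma wt_Suc: "wt y (Suc n) = (cmod (1 - ee (real (Suc n) * y)))\<^sup>2 * wt y n"
  by (simp add: wt_def mult.commute)

lemma wt_nonneg [simp]: "wt y n \<ge> 0"
  by (auto simp: wt_def intro: prod_nonneg)

lemma wt_eq_0:
  assumes "d > 0" "real d * y \<in> \<int>" "n \<ge> d"
  shows "wt y n = 0"
proof -
  have "ee (real d * y) = 1" using assms(2) by (simp add: ee_eq_1_iff)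
  then show ?thesis unfolding wt_def using assms by (auto intro!: bexI[of _ d])
qed

lemma suminf_wt:
  fixes g :: "nat \<Rightarrow> 'a :: {real_normed_algebra_1, comm_monoid_add}"
  assumes "d > 0" "real d * y \<in> \<int>"
  shows "(\<Sum>n. of_real (wt y n) * g n) = (\<Sum>n<d. of_real (wt y n) * g n)"
  using wt_eq_0[OF assms] by (intro suminf_finite) (auto simp: not_less)

lemma J41_eq_sum:
  assumes "d > 0" "real d * y \<in> \<int>"
  shows "J41 y = (\<Sum>n<d. wt y n)"
  using suminf_wt[OF assms, of "\<lambda>_. 1 :: real"] by (simp add: J41_wt)

lemma J41_minus: "J41 (- x) = J41 x"
proof -
  have "cmod (1 - ee (real k * - x)) = cmod (1 - ee (real k * x))" for k
    by (simp add: cmod_1_minus_ee)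
  then show ?thesis unfolding J41_wt wt_def by simp
qed

lemma rational_denominator:
  assumes "(y :: real) \<in> \<rat>"
  obtains d a where "d > 0" "coprime a (int d)" "y = of_int a / real d" "real d * y \<in> \<int>"
proof -
  obtain a b :: int where ab: "b > 0" "coprime a b" "y = of_int a / of_int b"
    using Rats_cases'[OF assms] by blast
  then show ?thesis by (intro that[of "nat b" a]) auto
qed

lemma J41_ge_1:
  assumes "y \<in> \<rat>"
  shows "J41 y \<ge> 1"
proof -
  obtain d where d: "d > 0" "real d * y \<in> \<int>" using rational_denominator[OF assms] by metis
  have "wt y 0 \<le> (\<Sum>n<d. wt y n)" using d(1) by (intro member_le_sum) auto
  then show ?thesis using J41_eq_sum[OF d] by simp
qed

text \<open>Divide the full product by its factor n = 0 and let z tend to 1, where (1 - z^q)/(1 - z)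
  tends to q.\<close>

lemma prod_1_minus_primitive_roots:
  fixes p :: int and q :: nat
  assumes "q > 0" "coprime p (int q)"
  shows "(\<Prod>n=1..q-1. 1 - ee (real n * (p / q))) = of_nat q"
proof -
  define R where "R z = (\<Prod>n=1..q-1. 1 - z * ee (real n * (p / q)))" for z
  have eq: "R z = (\<Sum>i<q. z ^ i)" if "z \<noteq> 1" for z
  proof -
    have "{..<q} = insert 0 {1..q-1}" using assms(1) by auto
    then have "1 - z ^ q = (1 - z) * R z"
      using prod_1_minus_roots_of_unity[OF assms, of z] by (simp add: R_def)
    then show ?thesis using that by (simp add: sum_gp_strict field_simps)
  qed
  have "(R \<longlongrightarrow> R 1) (at 1)" unfolding R_def by (intro tendsto_intros)
  moreover have "(R \<longlongrightarrow> (\<Sum>i<q. 1 ^ i)) (at 1)"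
  proof (rule Lim_transform_eventually)
    show "((\<lambda>z::complex. (\<Sum>i<q. z ^ i)) \<longlongrightarrow> (\<Sum>i<q. 1 ^ i)) (at 1)" by (intro tendsto_intros)
    show "eventually (\<lambda>z. (\<Sum>i<q. z ^ i) = R z) (at 1)"
      using eq by (auto simp: eventually_at_filter)
  qed
  ultimately have "R 1 = (\<Sum>i<q. 1 ^ i)" by (rule tendsto_unique[rotated]) simp
  then show ?thesis by (simp add: R_def)
qed

text \<open>The last nonvanishing term, n = d - 1, alone equals d^2.\<close>

lemma J41_ge_denominator:
  assumes "d > 0" "coprime a (int d)" "y = of_int a / real d"
  shows "J41 y \<ge> real d"
proof -
  have int: "real d * y \<in> \<int>" using assms by simp
  have "wt y (d - 1) = (cmod (\<Prod>n=1..d-1. 1 - ee (real n * (a / d))))\<^sup>2"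
    unfolding wt_def prod_norm[symmetric] prod_power_distrib assms(3) by simp
  also have "\<dots> = (real d)\<^sup>2" unfolding prod_1_minus_primitive_roots[OF assms(1,2)] by simp
  finally have "(real d)\<^sup>2 \<le> (\<Sum>n<d. wt y n)"
    using assms(1) member_le_sum[of "d - 1" "{..<d}" "wt y"] by simp
  moreover have "real d \<le> (real d)\<^sup>2" using assms(1) by (simp add: power2_eq_square)
  ultimately show ?thesis unfolding J41_eq_sum[OF assms(1) int] by linarith
qed

text \<open>Near an irrational number only rationals with large denominators occur: for each of the
  finitely many d \<le> D, the set where d y is an integer is closed and misses \<beta>.\<close>

lemma J41_at_top:
  assumes "\<beta> \<notin> \<rat>"
  shows "filterlim J41 at_top (at \<beta> within \<rat>)"
  unfolding filterlim_at_top
proof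
  fix K :: real
  define D where "D = nat \<lceil>K\<rceil>"
  have "eventually (\<lambda>y. real d * y \<notin> \<int>) (at \<beta> within \<rat>)" if "d \<in> {1..D}" for d
  proof -
    have "real d * \<beta> \<notin> \<int>"
    proof
      assume "real d * \<beta> \<in> \<int>"
      then obtain n where "real d * \<beta> = of_int n" by (auto elim: Ints_cases)
      then have "\<beta> = of_int n / of_nat d" using that by (simp add: field_simps)
      then show False using assms by simp
    qed
    moreover have "open (- (\<int> :: real set))" by (simp add: open_Compl)
    moreover have "((\<lambda>y. real d * y) \<longlongrightarrow> real d * \<beta>) (at \<beta> within \<rat>)" by (intro tendsto_intros)
    ultimately show ?thesis using topological_tendstoD[of _ "real d * \<beta>" _ "- \<int>"] by auto
  qed
  then have "eventually (\<lambda>y. \<forall>d\<in>{1..D}. real d * y \<notin> \<int>) (at \<beta> within \<rat>)"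
    by (intro eventually_ball_finite) auto
  moreover have "eventually (\<lambda>y. y \<in> \<rat>) (at \<beta> within \<rat>)"
    by (simp add: eventually_at_filter)
  ultimately show "eventually (\<lambda>y. K \<le> J41 y) (at \<beta> within \<rat>)"
  proof eventually_elim
    case (elim y)
    obtain d a where d: "d > 0" "coprime a (int d)" "y = of_int a / real d" "real d * y \<in> \<int>"
      using rational_denominator[OF elim(2)] by metis
    then have "d \<notin> {1..D}" using elim(1) by blast
    then have "K \<le> real d" using d(1) unfolding D_def by auto linarith
    then show ?case using J41_ge_denominator[OF d(1-3)] by simp
  qed
qed

subsection \<open>The Gibbs expectation\<close>

definition gibbs :: "real \<Rightarrow> (complex \<Rightarrow> complex) \<Rightarrow> complex" where
  "gibbs y f = (\<Sum>n. of_real (wt y n) * f (ee (real n * y))) / of_real (J41 y)"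

lemma gibbs_eq_sum:
  assumes "d > 0" "real d * y \<in> \<int>"
  shows "gibbs y f = (\<Sum>n<d. of_real (wt y n) * f (ee (real n * y))) / of_real (J41 y)"
  unfolding gibbs_def by (simp only: suminf_wt[OF assms])

lemma gibbs_bound:
  assumes "y \<in> \<rat>" "\<And>z. cmod z = 1 \<Longrightarrow> cmod (f z) \<le> B"
  shows "cmod (gibbs y f) \<le> B"
proof -
  obtain d where d: "d > 0" "real d * y \<in> \<int>" using rational_denominator[OF assms(1)] by metis
  have J: "J41 y \<ge> 1" using J41_ge_1[OF assms(1)] .
  have "cmod (\<Sum>n<d. of_real (wt y n) * f (ee (real n * y))) \<le> (\<Sum>n<d. wt y n * B)"
    by (intro sum_norm_le) (auto simp: norm_mult intro!: mult_left_mono assms(2))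
  also have "\<dots> = J41 y * B" by (simp add: J41_eq_sum[OF d] sum_distrib_right)
  finally show ?thesis unfolding gibbs_eq_sum[OF d] using J by (simp add: norm_divide field_simps)
qed

lemma gibbs_add:
  assumes "y \<in> \<rat>"
  shows "gibbs y (\<lambda>z. f z + g z) = gibbs y f + gibbs y g"
proof -
  obtain d where d: "d > 0" "real d * y \<in> \<int>" using rational_denominator[OF assms(1)] by metis
  show ?thesis unfolding gibbs_eq_sum[OF d] by (simp add: distrib_left sum.distrib add_divide_distrib)
qed

lemma gibbs_cmult:
  assumes "y \<in> \<rat>"
  shows "gibbs y (\<lambda>z. c * f z) = c * gibbs y f"
proof -
  obtain d where d: "d > 0" "real d * y \<in> \<int>" using rational_denominator[OF assms(1)] by metis
  show ?thesis unfolding gibbs_eq_sum[OF d] by (simp add: sum_distrib_left mult_ac)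
qed

text \<open>The twist by \<open>ee (m y)\<close> makes the recurrence for the moments symmetric.\<close>

definition moment :: "nat \<Rightarrow> real \<Rightarrow> complex" where
  "moment m y = ee (real m * y) * gibbs y (\<lambda>z. z ^ m)"

lemma moment_0:
  assumes "y \<in> \<rat>"
  shows "moment 0 y = 1"
proof -
  obtain d where d: "d > 0" "real d * y \<in> \<int>" using rational_denominator[OF assms(1)] by metis
  show ?thesis using J41_ge_1[OF assms]
    unfolding moment_def gibbs_eq_sum[OF d] by (simp add: J41_eq_sum[OF d] flip: of_real_sum)
qed

lemma moment_bound:
  assumes "y \<in> \<rat>"
  shows "cmod (moment m y) \<le> 1"
  unfolding moment_def using gibbs_bound[OF assms, of "\<lambda>z. z ^ m" 1] by (simp add: norm_mult norm_power)

text \<open>Reindexing n to n + 1 loses the term n = 0, and the new term n = d vanishes. The lost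
  term is the source of the inhomogeneity 1/J in \<open>moment_rec\<close>.\<close>

lemma wt_shift_sum:
  fixes g :: "nat \<Rightarrow> complex"
  assumes "d > 0" "real d * y \<in> \<int>"
  shows "(\<Sum>n<d. of_real (wt y n) * ((2 - ee (real (Suc n) * y) - ee (- (real (Suc n) * y))) * g (Suc n)))
    = (\<Sum>n<d. of_real (wt y n) * g n) - g 0"
proof -
  have "(\<Sum>n<d. of_real (wt y n) * ((2 - ee (real (Suc n) * y) - ee (- (real (Suc n) * y))) * g (Suc n)))
    = (\<Sum>n<d. of_real (wt y (Suc n)) * g (Suc n))"
    by (intro sum.cong refl) (simp only: wt_Suc of_real_mult cmod_1_minus_ee_squared mult_ac)
  also have "\<dots> = (\<Sum>n<Suc d. of_real (wt y n) * g n) - g 0"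
    by (subst sum.lessThan_Suc_shift) simp
  also have "\<dots> = (\<Sum>n<d. of_real (wt y n) * g n) - g 0"
    using wt_eq_0[OF assms, of d] by simp
  finally show ?thesis .
qed

text \<open>The shift identity with the power m + 1 as test function; the factor 2 - z - 1/z couples
  it only to the neighbouring powers.\<close>

lemma moment_rec:
  assumes "y \<in> \<rat>"
  shows "moment (m + 2) y + moment m y
    = (2 - ee (- (real (m + 1) * y))) * moment (m + 1) y + 1 / of_real (J41 y)"
proof -
  obtain d where d: "d > 0" "real d * y \<in> \<int>" using rational_denominator[OF assms(1)] by metis
  define q where "q = ee y"
  have q0: "q \<noteq> 0" by (simp add: q_def)
  define t where "t n = ee (real n * y)" for n
  have t0: "t n \<noteq> 0" for n by (simp add: t_def)
  have tS: "ee (real (Suc n) * y) = q * t n" for n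
    by (simp add: q_def t_def distrib_right flip: ee_add)
  have tS': "ee (- (real (Suc n) * y)) = 1 / (q * t n)" for n
    unfolding ee_minus tS by (simp add: divide_inverse)
  define C where "C m = (\<Sum>n<d. of_real (wt y n) * t n ^ m)" for m
  have Cmom: "moment m y = q ^ m * C m / of_real (J41 y)" for m
    unfolding moment_def gibbs_eq_sum[OF d] C_def t_def q_def ee_power by simp
  have "C (m + 1) - 1 = (\<Sum>n<d. of_real (wt y n) * ((2 - q * t n - 1 / (q * t n)) * (q * t n) ^ (m + 1)))"
    using wt_shift_sum[OF d, of "\<lambda>n. t n ^ (m + 1)"] tS
    unfolding tS tS' C_def t_def[of "Suc _"] by (simp add: t_def[of 0])
  also have "\<dots> = (\<Sum>n<d. 2 * q ^ (m + 1) * (of_real (wt y n) * t n ^ (m + 1)) 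
      - q ^ (m + 2) * (of_real (wt y n) * t n ^ (m + 2)) - q ^ m * (of_real (wt y n) * t n ^ m))"
  proof (intro sum.cong refl)
    fix n
    have "(2 - q * t n - 1 / (q * t n)) * (q * t n) ^ (m + 1) 
        = 2 * (q * t n) ^ (m + 1) - (q * t n) ^ (m + 2) - (q * t n) ^ m"
      using q0 t0[of n] by (simp add: field_simps)
    then show "of_real (wt y n) * ((2 - q * t n - 1 / (q * t n)) * (q * t n) ^ (m + 1))
      = 2 * q ^ (m + 1) * (of_real (wt y n) * t n ^ (m + 1)) 
      - q ^ (m + 2) * (of_real (wt y n) * t n ^ (m + 2)) - q ^ m * (of_real (wt y n) * t n ^ m)"
      by (simp only: power_mult_distrib right_diff_distrib mult_ac)
  qed
  also have "\<dots> = 2 * q ^ (m + 1) * C (m + 1) - q ^ (m + 2) * C (m + 2) - q ^ m * C m"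
    unfolding C_def by (simp only: sum_subtractf sum_distrib_left)
  finally have *: "q ^ (m + 2) * C (m + 2) + q ^ m * C m = 2 * (q ^ (m + 1) * C (m + 1)) - C (m + 1) + 1"
    by (simp add: algebra_simps)
  \<comment> \<open>The side of the identity that is not shifted carries no twist, and this is where
    the variable coefficient e(-(m+1)y) comes from.\<close>
  have qm: "ee (- (real (m + 1) * y)) * (q ^ (m + 1) * C (m + 1)) = C (m + 1)"
    unfolding q_def ee_power mult.assoc[symmetric] ee_add[symmetric] by simp
  have "moment (m + 2) y + moment m y = (q ^ (m + 2) * C (m + 2) + q ^ m * C m) / of_real (J41 y)"
    unfolding Cmom by (simp add: add_divide_distrib)
  also have "\<dots> = ((2 - ee (- (real (m + 1) * y))) * (q ^ (m + 1) * C (m + 1)) + 1) / of_real (J41 y)"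
    unfolding * left_diff_distrib qm by simp
  finally show ?thesis unfolding Cmom by (simp add: add_divide_distrib)
qed

section \<open>Convergence of the first moment\<close>

lemma bounded_unique_cluster_imp_tendsto:
  fixes X :: "nat \<Rightarrow> complex"
  assumes bd: "bounded (range X)"
    and cl: "\<And>r l'. strict_mono r \<Longrightarrow> (X \<circ> r) \<longlonglongrightarrow> l' \<Longrightarrow> l' = l"
  shows "X \<longlonglongrightarrow> l"
proof (rule ccontr)
  assume "\<not> X \<longlonglongrightarrow> l"
  then obtain e where e: "e > 0" "\<And>N. \<exists>n\<ge>N. dist (X n) l \<ge> e"
    unfolding lim_sequentially by (auto simp: not_less)
  have "infinite {n. dist (X n) l \<ge> e}"
    unfolding infinite_nat_iff_unbounded_le using e(2) by auto
  then obtain r where r: "strict_mono (r :: nat \<Rightarrow> nat)" "\<And>n. r n \<in> {n. dist (X n) l \<ge> e}"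
    using infinite_enumerate by blast
  have "bounded (range (X \<circ> r))" using bd by (rule bounded_subset) auto
  then obtain l' s where s: "strict_mono s" "((X \<circ> r) \<circ> s) \<longlonglongrightarrow> l'"
    using bounded_imp_convergent_subsequence by blast
  have "l' = l" using cl[of "r \<circ> s" l'] r s by (simp add: strict_mono_o o_assoc)
  moreover have "dist l' l \<ge> e"
  proof (rule tendsto_lowerbound)
    show "((\<lambda>n. dist (((X \<circ> r) \<circ> s) n) l) \<longlongrightarrow> dist l' l) sequentially"
      using s(2) by (intro tendsto_intros)
    show "\<forall>\<^sub>F n in sequentially. e \<le> dist (((X \<circ> r) \<circ> s) n) l" using r(2) by simp
  qed simp
  ultimately show False using e(1) by simp
qed

lemma moment_1_converges:
  assumes irr: "\<beta> \<notin> \<rat>" and wa: "well_approx \<beta>"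
  shows "\<exists>l. (moment 1 \<longlongrightarrow> l) (at \<beta> within \<rat>)"
proof -
  \<comment> \<open>What a cluster value l of the first moment inherits: a bounded solution of the
    homogeneous limiting recurrence with initial values 1 and l. As all these solutions start with
    1, a vanishing Wronskian forces equal l.\<close>
  define P where "P l \<longleftrightarrow> (\<exists>s. s 0 = 1 \<and> s 1 = l \<and> (\<forall>m. cmod (s m) \<le> 1) \<and>
     (\<forall>m. s (m + 2) + s m = (2 - ee (- (real (m + 1) * \<beta>))) * s (m + 1)))" for l :: complex
  have P_unique: "l = l'" if "P l" "P l'" for l l'
  proof -
    obtain f where f: "f 0 = 1" "f 1 = l" "\<And>m. cmod (f m) \<le> 1"
       "\<And>m. f (m + 2) + f m = (2 - ee (- (real (m + 1) * \<beta>))) * f (m + 1)"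
      using \<open>P l\<close> unfolding P_def by blast
    obtain g where g: "g 0 = 1" "g 1 = l'" "\<And>m. cmod (g m) \<le> 1"
       "\<And>m. g (m + 2) + g m = (2 - ee (- (real (m + 1) * \<beta>))) * g (m + 1)"
      using \<open>P l'\<close> unfolding P_def by blast
    show ?thesis using bounded_solutions_dependent[OF irr wa f(4) g(4) f(3) g(3)] f g by simp
  qed
  have P_cluster: "P l" if Y: "\<And>n. Y n \<in> \<rat> - {\<beta>}" "Y \<longlonglongrightarrow> \<beta>" and l: "(\<lambda>n. moment 1 (Y n)) \<longlonglongrightarrow> l" for Y l
  proof -
    have Yf: "filterlim Y (at \<beta> within \<rat>) sequentially"
      using Y by (auto simp: filterlim_at intro!: always_eventually)
    have invJ: "(\<lambda>n. 1 / complex_of_real (J41 (Y n))) \<longlonglongrightarrow> 0"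
    proof -
      have "(\<lambda>n. inverse (J41 (Y n))) \<longlonglongrightarrow> 0"
        by (rule tendsto_inverse_0_at_top[OF filterlim_compose[OF J41_at_top[OF irr] Yf]])
      then have "(\<lambda>n. complex_of_real (inverse (J41 (Y n)))) \<longlonglongrightarrow> complex_of_real 0"
        by (rule tendsto_of_real)
      then show ?thesis by (simp add: divide_inverse)
    qed
    \<comment> \<open>The recurrence carries convergence along Y from the moments 0 and 1 to all
      others, so the same sequence serves every m.\<close>
    have "\<exists>a b. (\<lambda>n. moment m (Y n)) \<longlonglongrightarrow> a \<and> (\<lambda>n. moment (m + 1) (Y n)) \<longlonglongrightarrow> b" for m
    proof (induction m)
      case 0
      have "(\<lambda>n. moment 0 (Y n)) \<longlonglongrightarrow> 1" using Y(1) moment_0 by simp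
      then show ?case using l by auto
    next
      case (Suc m)
      then obtain a b where ab: "(\<lambda>n. moment m (Y n)) \<longlonglongrightarrow> a" "(\<lambda>n. moment (m + 1) (Y n)) \<longlonglongrightarrow> b" by blast
      have "(\<lambda>n. (2 - ee (- (real (m + 1) * Y n))) * moment (m + 1) (Y n) + 1 / of_real (J41 (Y n)) - moment m (Y n))
          \<longlonglongrightarrow> (2 - ee (- (real (m + 1) * \<beta>))) * b + 0 - a"
          by (intro tendsto_intros ab Y(2) invJ)
      moreover have "(2 - ee (- (real (m + 1) * Y n))) * moment (m + 1) (Y n) + 1 / of_real (J41 (Y n)) - moment m (Y n) = moment (m + 2) (Y n)" for n
        using moment_rec[of "Y n" m] Y(1)[of n] by (simp add: algebra_simps)
      ultimately show ?case using ab by auto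
    qed
    then have conv: "\<exists>a. (\<lambda>n. moment m (Y n)) \<longlonglongrightarrow> a" for m by blast
    define s where "s m = lim (\<lambda>n. moment m (Y n))" for m
    have s: "(\<lambda>n. moment m (Y n)) \<longlonglongrightarrow> s m" for m
      unfolding s_def using conv[of m] by (simp add: convergent_LIMSEQ_iff[symmetric] convergent_def)
    have "s 0 = 1" using LIMSEQ_unique[OF s[of 0]] moment_0 Y(1) by simp
    moreover have "s 1 = l" using LIMSEQ_unique[OF s[of 1] l] .
    moreover have "cmod (s m) \<le> 1" for m
    proof (rule LIMSEQ_le_const2)
      show "(\<lambda>n. cmod (moment m (Y n))) \<longlonglongrightarrow> cmod (s m)" by (intro tendsto_norm s)
      show "\<exists>N. \<forall>n\<ge>N. cmod (moment m (Y n)) \<le> 1" using moment_bound Y(1) by auto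
    qed
    moreover have "s (m + 2) + s m = (2 - ee (- (real (m + 1) * \<beta>))) * s (m + 1)" for m
    proof -
      have "(\<lambda>n. moment (m + 2) (Y n) + moment m (Y n)) \<longlonglongrightarrow> s (m + 2) + s m"
        by (intro tendsto_intros s)
      moreover have "(\<lambda>n. (2 - ee (- (real (m + 1) * Y n))) * moment (m + 1) (Y n) + 1 / of_real (J41 (Y n)))
          \<longlonglongrightarrow> (2 - ee (- (real (m + 1) * \<beta>))) * s (m + 1) + 0"
        by (intro tendsto_intros s Y(2) invJ)
      moreover have "moment (m + 2) (Y n) + moment m (Y n) = (2 - ee (- (real (m + 1) * Y n))) * moment (m + 1) (Y n) + 1 / of_real (J41 (Y n))" for n
        using moment_rec[of "Y n" m] Y(1)[of n] by simp
      ultimately show ?thesis using LIMSEQ_unique by auto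
    qed
    ultimately show "P l" unfolding P_def by blast
  qed
  have bdd: "bounded (range (\<lambda>n. moment 1 (Y n)))" if "\<And>n. Y n \<in> \<rat> - {\<beta>}" for Y :: "nat \<Rightarrow> real"
    unfolding bounded_iff using moment_bound that by (intro exI[of _ 1]) auto
  \<comment> \<open>One concrete sequence supplies a candidate l with \<open>P l\<close>; uniqueness
    then identifies every other cluster value with it.\<close>
  obtain Y0 where Y0: "\<And>n. Y0 n \<in> \<rat> - {\<beta>}" "Y0 \<longlonglongrightarrow> \<beta>"
  proof -
    have "\<exists>r\<in>\<rat>. \<beta> < r \<and> r < \<beta> + inverse (real (Suc n))" for n
      by (rule Rats_dense_in_real) simp
    then obtain Y where Y: "\<And>n. Y n \<in> \<rat>" "\<And>n. \<beta> < Y n" "\<And>n. Y n < \<beta> + inverse (real (Suc n))"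
      by metis
    have "Y \<longlonglongrightarrow> \<beta>"
    proof (rule tendsto_sandwich)
      show "(\<lambda>n. \<beta>) \<longlonglongrightarrow> \<beta>" by simp
      show "(\<lambda>n. \<beta> + inverse (real (Suc n))) \<longlonglongrightarrow> \<beta>" by (rule LIMSEQ_inverse_real_of_nat_add)
    qed (use Y in \<open>auto intro!: always_eventually less_imp_le simp del: of_nat_Suc\<close>)
    then show ?thesis using that[of Y] Y by (metis DiffI less_irrefl singletonD)
  qed
  obtain l r where r: "strict_mono r" "((\<lambda>n. moment 1 (Y0 n)) \<circ> r) \<longlonglongrightarrow> l"
    using bounded_imp_convergent_subsequence[OF bdd[of Y0, OF Y0(1)]] by blast
  have Pl: "P l"
  proof (rule P_cluster)
    show "(Y0 \<circ> r) n \<in> \<rat> - {\<beta>}" for n using Y0(1) by simp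
    show "(Y0 \<circ> r) \<longlonglongrightarrow> \<beta>" using Y0(2) r(1) by (rule LIMSEQ_subseq_LIMSEQ)
    show "(\<lambda>n. moment 1 ((Y0 \<circ> r) n)) \<longlonglongrightarrow> l" using r(2) by (simp add: o_def)
  qed
  have "(moment 1 \<longlongrightarrow> l) (at \<beta> within \<rat>)"
    unfolding tendsto_at_iff_sequentially
  proof (intro allI impI)
    fix X assume X: "\<forall>i. X i \<in> \<rat> - {\<beta>}" "X \<longlonglongrightarrow> \<beta>"
    show "(moment 1 \<circ> X) \<longlonglongrightarrow> l"
    proof (rule bounded_unique_cluster_imp_tendsto)
      show "bounded (range (moment 1 \<circ> X))" using bdd[of X] X by (simp add: o_def)
      fix r l' assume r: "strict_mono r" "((moment 1 \<circ> X) \<circ> r) \<longlonglongrightarrow> l'"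
      have "P l'"
      proof (rule P_cluster)
        show "(X \<circ> r) n \<in> \<rat> - {\<beta>}" for n using X(1) by simp
        show "(X \<circ> r) \<longlonglongrightarrow> \<beta>" using X(2) r(1) by (rule LIMSEQ_subseq_LIMSEQ)
        show "(\<lambda>n. moment 1 ((X \<circ> r) n)) \<longlonglongrightarrow> l'" using r(2) by (simp add: o_def)
      qed
      then show "l' = l" using P_unique Pl by blast
    qed
  qed
  then show ?thesis by blast
qed

subsection \<open>Weak convergence of the Gibbs measures\<close>

lemma gibbs_cong:
  assumes "\<And>z. cmod z = 1 \<Longrightarrow> f z = g z"
  shows "gibbs y f = gibbs y g"
  unfolding gibbs_def using assms by simp

text \<open>The limits of the approximants are known to exist but not to converge among themselves,
  hence the Cauchy criterion; two values of \<open>h\<close> then differ by less than 4e/5.\<close>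

lemma tendsto_approx:
  fixes h :: "'a \<Rightarrow> complex"
  assumes "\<And>e. e > 0 \<Longrightarrow> \<exists>g l. (g \<longlongrightarrow> l) F \<and> eventually (\<lambda>x. cmod (h x - g x) \<le> e) F"
  shows "\<exists>l. (h \<longlongrightarrow> l) F"
proof -
  have "cauchy_filter (filtermap h F)"
    unfolding cauchy_filter_metric_filtermap
  proof (intro allI impI)
    fix e :: real assume "e > 0"
    then obtain g l where gl: "(g \<longlongrightarrow> l) F" "eventually (\<lambda>x. cmod (h x - g x) \<le> e / 5) F"
      using assms[of "e / 5"] by auto
    define P where "P x \<longleftrightarrow> dist (g x) l < e / 5 \<and> cmod (h x - g x) \<le> e / 5" for x
    have "eventually P F"
      unfolding P_def using tendstoD[OF gl(1), of "e / 5"] gl(2) \<open>e > 0\<close> by (auto intro: eventually_conj)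
    moreover have "dist (h x) (h y) < e" if "P x" "P y" for x y
    proof -
      have "dist (h x) l \<le> dist (h x) (g x) + dist (g x) l" "dist (h y) l \<le> dist (h y) (g y) + dist (g y) l"
        by (rule dist_triangle)+
      moreover have "dist (h x) (h y) \<le> dist (h x) l + dist (h y) l" by (rule dist_triangle2)
      moreover have "dist (h x) (g x) \<le> e / 5" "dist (h y) (g y) \<le> e / 5"
        using that by (auto simp: P_def dist_norm)
      ultimately show ?thesis using that \<open>e > 0\<close> unfolding P_def by linarith
    qed
    ultimately show "\<exists>P. eventually P F \<and> (\<forall>x y. P x \<and> P y \<longrightarrow> dist (h x) (h y) < e)" by blast
  qed
  then obtain l where "filtermap h F \<le> nhds l"
    using convergent_filter_iff cauchy_filter_convergent by blast
  then show ?thesis unfolding filterlim_def by blast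
qed

lemma eventually_rat: "eventually (\<lambda>y. y \<in> \<rat>) (at \<beta> within \<rat>)"
  by (simp add: eventually_at_filter)

locale unique_gibbs =
  fixes \<beta> :: real
  assumes irr: "\<beta> \<notin> \<rat>" and wa: "well_approx \<beta>"
begin

definition conv :: "(complex \<Rightarrow> complex) \<Rightarrow> bool" where
  "conv f \<longleftrightarrow> (\<exists>l. ((\<lambda>y. gibbs y f) \<longlongrightarrow> l) (at \<beta> within \<rat>))"

lemma conv_cong:
  assumes "\<And>z. cmod z = 1 \<Longrightarrow> f z = g z" "conv f"
  shows "conv g"
  using assms gibbs_cong[of f g] unfolding conv_def by simp

lemma conv_add:
  assumes "conv f" "conv g"
  shows "conv (\<lambda>z. f z + g z)"
proof -
  obtain a b where "((\<lambda>y. gibbs y f) \<longlongrightarrow> a) (at \<beta> within \<rat>)" "((\<lambda>y. gibbs y g) \<longlongrightarrow> b) (at \<beta> within \<rat>)"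
    using assms unfolding conv_def by blast
  then have "((\<lambda>y. gibbs y f + gibbs y g) \<longlongrightarrow> a + b) (at \<beta> within \<rat>)" by (rule tendsto_add)
  then have "((\<lambda>y. gibbs y (\<lambda>z. f z + g z)) \<longlongrightarrow> a + b) (at \<beta> within \<rat>)"
    by (rule Lim_transform_eventually) (use eventually_rat in eventually_elim, simp add: gibbs_add)
  then show ?thesis unfolding conv_def by blast
qed

lemma conv_cmult:
  assumes "conv f"
  shows "conv (\<lambda>z. c * f z)"
proof -
  obtain a where "((\<lambda>y. gibbs y f) \<longlongrightarrow> a) (at \<beta> within \<rat>)"
    using assms unfolding conv_def by blast
  then have "((\<lambda>y. c * gibbs y f) \<longlongrightarrow> c * a) (at \<beta> within \<rat>)" by (intro tendsto_intros)
  then have "((\<lambda>y. gibbs y (\<lambda>z. c * f z)) \<longlongrightarrow> c * a) (at \<beta> within \<rat>)"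
    by (rule Lim_transform_eventually) (use eventually_rat in eventually_elim, simp add: gibbs_cmult)
  then show ?thesis unfolding conv_def by blast
qed

lemma inverse_J41_tendsto_0: "((\<lambda>y. 1 / J41 y) \<longlongrightarrow> 0) (at \<beta> within \<rat>)"
  using tendsto_inverse_0_at_top[OF J41_at_top[OF irr]] by (simp add: divide_inverse)

lemma moment_converges: "\<exists>l. (moment m \<longlongrightarrow> l) (at \<beta> within \<rat>)"
proof -
  have "\<exists>a b. (moment m \<longlongrightarrow> a) (at \<beta> within \<rat>) \<and> (moment (m + 1) \<longlongrightarrow> b) (at \<beta> within \<rat>)"
  proof (induction m)
    case 0
    have "(moment 0 \<longlongrightarrow> 1) (at \<beta> within \<rat>)"
      by (rule Lim_transform_eventually[OF tendsto_const])
         (use eventually_rat in eventually_elim, simp add: moment_0)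
    then show ?case using moment_1_converges[OF irr wa] by auto
  next
    case (Suc m)
    then obtain a b where ab: "(moment m \<longlongrightarrow> a) (at \<beta> within \<rat>)" "(moment (m + 1) \<longlongrightarrow> b) (at \<beta> within \<rat>)"
      by blast
    have J: "((\<lambda>y. complex_of_real (1 / J41 y)) \<longlongrightarrow> of_real 0) (at \<beta> within \<rat>)"
      by (rule tendsto_of_real[OF inverse_J41_tendsto_0])
    have "((\<lambda>y. (2 - ee (- (real (m + 1) * y))) * moment (m + 1) y + of_real (1 / J41 y) - moment m y)
        \<longlongrightarrow> (2 - ee (- (real (m + 1) * \<beta>))) * b + of_real 0 - a) (at \<beta> within \<rat>)"
      by (intro tendsto_intros ab J)
    then have "(moment (m + 2) \<longlongrightarrow> (2 - ee (- (real (m + 1) * \<beta>))) * b + of_real 0 - a) (at \<beta> within \<rat>)"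
    proof (rule Lim_transform_eventually)
      show "eventually (\<lambda>y. (2 - ee (- (real (m + 1) * y))) * moment (m + 1) y + of_real (1 / J41 y) - moment m y = moment (m + 2) y) (at \<beta> within \<rat>)"
        using eventually_rat
      proof eventually_elim
        case (elim y)
        then show ?case using moment_rec[of y m] by (simp add: algebra_simps)
      qed
    qed
    then show ?case using ab by auto
  qed
  then show ?thesis by blast
qed

lemma conv_power: "conv (\<lambda>z. z ^ m)"
proof -
  obtain l where l: "(moment m \<longlongrightarrow> l) (at \<beta> within \<rat>)" using moment_converges by blast
  then have "((\<lambda>y. ee (- (real m * y)) * moment m y) \<longlongrightarrow> ee (- (real m * \<beta>)) * l) (at \<beta> within \<rat>)"
    by (intro tendsto_intros)
  then show ?thesis unfolding conv_def moment_def by (auto simp: mult.assoc[symmetric] simp flip: ee_add)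
qed

lemma cnj_gibbs:
  assumes "y \<in> \<rat>"
  shows "cnj (gibbs y f) = gibbs y (\<lambda>z. cnj (f z))"
proof -
  obtain d where d: "d > 0" "real d * y \<in> \<int>" using rational_denominator[OF assms(1)] by metis
  show ?thesis unfolding gibbs_eq_sum[OF d] by simp
qed

lemma conv_cnj:
  assumes "conv f"
  shows "conv (\<lambda>z. cnj (f z))"
proof -
  obtain a where "((\<lambda>y. gibbs y f) \<longlongrightarrow> a) (at \<beta> within \<rat>)"
    using assms unfolding conv_def by blast
  then have "((\<lambda>y. cnj (gibbs y f)) \<longlongrightarrow> cnj a) (at \<beta> within \<rat>)" by (intro tendsto_intros)
  then have "((\<lambda>y. gibbs y (\<lambda>z. cnj (f z))) \<longlongrightarrow> cnj a) (at \<beta> within \<rat>)"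
    by (rule Lim_transform_eventually) (use eventually_rat in eventually_elim, simp add: cnj_gibbs)
  then show ?thesis unfolding conv_def by blast
qed

lemma conv_powi: "conv (\<lambda>z. z powi k)"
proof (cases "k \<ge> 0")
  case True
  then show ?thesis using conv_power[of "nat k"] by (simp add: power_int_def)
next
  case False
  show ?thesis
  proof (rule conv_cong[OF _ conv_cnj[OF conv_power[of "nat (- k)"]]])
    fix z :: complex assume "cmod z = 1"
    then have "cnj z = inverse z"
      by (metis complex_norm_square inverse_unique of_real_1 power_one mult.commute)
    then show "cnj (z ^ nat (- k)) = z powi k" using False by (simp add: power_int_def)
  qed
qed

text \<open>On the unit circle a real-linear function has the form a z + b/z, so real polynomials in
  the coordinates become Laurent polynomials. Keeping f and k arbitrary in the induction lets one
  factor of a product be absorbed into f.\<close>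

lemma conv_real_polynomial:
  assumes "real_polynomial_function p" "\<And>k. conv (\<lambda>z. f z * z powi k)"
  shows "conv (\<lambda>z. of_real (p z) * f z * z powi k)"
  using assms
proof (induction arbitrary: f k)
  case (linear p)
  \<comment> \<open>From Re z = (z + 1/z)/2 and Im z = (z - 1/z)/(2i).\<close>
  define a where "a = (of_real (p 1) - \<i> * of_real (p \<i>)) / 2"
  define b where "b = (of_real (p 1) + \<i> * of_real (p \<i>)) / 2"
  interpret bounded_linear p by fact
  show ?case
  proof (rule conv_cong[OF _ conv_add[OF conv_cmult[OF linear.prems[of "k + 1"], of a] conv_cmult[OF linear.prems[of "k - 1"], of b]]])
    fix z :: complex assume z: "cmod z = 1"
    then have z0: "z \<noteq> 0" by auto
    have iz: "inverse z = cnj z"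
      using z by (metis complex_norm_square inverse_unique of_real_1 power_one)
    have "z = Re z *\<^sub>R 1 + Im z *\<^sub>R \<i>" by (simp add: complex_eq_iff)
    then have "p z = Re z * p 1 + Im z * p \<i>" by (metis add scale real_scaleR_def)
    then have pz: "of_real (p z) = a * z + b * inverse z"
      unfolding iz by (simp add: a_def b_def complex_eq_iff field_simps)
    show "a * (f z * z powi (k + 1)) + b * (f z * z powi (k - 1)) = of_real (p z) * f z * z powi k"
      using z0 unfolding pz by (simp add: power_int_add power_int_diff field_simps)
  qed
next
  case (const c)
  then show ?case using conv_cmult[of "\<lambda>z. f z * z powi k" "of_real c"] by (simp add: mult.assoc)
next
  case (add p q)
  show ?case
    using conv_add[OF add.IH(1)[of f k] add.IH(2)[of f k]] add.prems by (simp add: distrib_right)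
next
  case (mult p q)
  show ?case
    using mult.IH(1)[of "\<lambda>z. of_real (q z) * f z" k, OF mult.IH(2)[OF mult.prems]]
    by (simp add: mult.assoc)
qed

text \<open>Stone-Weierstrass suffices because the Gibbs expectation is bounded by the sup norm,
  uniformly in y.\<close>

lemma conv_continuous:
  fixes f :: "complex \<Rightarrow> real"
  assumes "continuous_on (sphere 0 1) f"
  shows "conv (\<lambda>z. of_real (f z))"
  unfolding conv_def
proof (rule tendsto_approx)
  fix e :: real assume e: "e > 0"
  obtain p where p: "real_polynomial_function p" "\<And>z. z \<in> sphere 0 1 \<Longrightarrow> \<bar>f z - p z\<bar> < e"
    using Stone_Weierstrass_real_polynomial_function[OF compact_sphere assms e] by blast
  have "conv (\<lambda>z. of_real (p z) * 1 * z powi 0)"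
    using conv_powi by (intro conv_real_polynomial p(1)) simp
  then obtain l where l: "((\<lambda>y. gibbs y (\<lambda>z. of_real (p z))) \<longlongrightarrow> l) (at \<beta> within \<rat>)"
    unfolding conv_def by auto
  have "eventually (\<lambda>y. cmod (gibbs y (\<lambda>z. of_real (f z)) - gibbs y (\<lambda>z. of_real (p z))) \<le> e) (at \<beta> within \<rat>)"
    using eventually_rat
  proof eventually_elim
    case (elim y)
    have "gibbs y (\<lambda>z. of_real (f z)) - gibbs y (\<lambda>z. of_real (p z)) 
        = gibbs y (\<lambda>z. of_real (f z) + (-1) * of_real (p z))"
      by (simp only: gibbs_add[OF elim] gibbs_cmult[OF elim]) simp
    also have "cmod \<dots> \<le> e"
      using p(2) by (intro gibbs_bound elim) (force simp flip: of_real_diff intro: less_imp_le)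
    finally show ?case .
  qed
  with l show "\<exists>g l. (g \<longlongrightarrow> l) (at \<beta> within \<rat>) \<and> (\<forall>\<^sub>F y in at \<beta> within \<rat>. cmod (gibbs y (\<lambda>z. of_real (f z)) - g y) \<le> e)"
    by blast
qed

end

text \<open>This handles the jump at \<open>1\<close>: the last factor \<open>|1 - e(ny)|\<^sup>2\<close> of \<open>wt y n\<close> is small when \<open>e(ny)\<close> is close to \<open>1\<close>.\<close>

lemma wt_near_1_sum:
  assumes "d > 0" "real d * y \<in> \<int>" "\<epsilon> \<ge> 0"
  shows "(\<Sum>n<d. if cmod (1 - ee (real n * y)) \<le> \<epsilon> then wt y n else 0) \<le> 1 + \<epsilon>\<^sup>2 * J41 y"
proof -
  obtain d' where d': "d = Suc d'" using assms(1) by (cases d) auto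
  \<comment> \<open>The term n = 0 has no last factor and is split off; it is the 1 in the
    bound.\<close>
  have "(\<Sum>n<d. if cmod (1 - ee (real n * y)) \<le> \<epsilon> then wt y n else 0)
      = (if \<epsilon> \<ge> 0 then 1 else 0) + (\<Sum>n<d'. if cmod (1 - ee (real (Suc n) * y)) \<le> \<epsilon> then wt y (Suc n) else 0)"
    unfolding d' by (subst sum.lessThan_Suc_shift) simp
  also have "\<dots> \<le> 1 + (\<Sum>n<d'. \<epsilon>\<^sup>2 * wt y n)"
  proof (intro add_mono sum_mono)
    fix n
    show "(if cmod (1 - ee (real (Suc n) * y)) \<le> \<epsilon> then wt y (Suc n) else 0) \<le> \<epsilon>\<^sup>2 * wt y n"
      unfolding wt_Suc by (auto intro!: mult_right_mono power_mono)
  qed simp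
  also have "(\<Sum>n<d'. \<epsilon>\<^sup>2 * wt y n) \<le> (\<Sum>n<d. \<epsilon>\<^sup>2 * wt y n)"
    unfolding d' by simp
  also have "\<dots> = \<epsilon>\<^sup>2 * J41 y" by (simp add: J41_eq_sum[OF assms(1,2)] sum_distrib_left)
  finally show ?thesis by simp
qed

lemma Arg2pi_ee: "Arg2pi (ee t) = 2 * pi * frac t"
proof (rule Arg2pi_unique)
  show "of_real 1 * exp (\<i> * of_real (2 * pi * frac t)) = ee t"
    using ee_frac[of t] by (simp add: ee_def cis_conv_exp)
  show "2 * pi * frac t < 2 * pi" using frac_lt_1[of t] by simp
qed auto

context unique_gibbs
begin

text \<open>On the circle the function jumps at 1 when H 0 and H 1 differ. A cut-off vanishing at 1
  makes it continuous, and the error is at most sup |H| times the mass near 1.\<close>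

lemma conv_discontinuous_at_1:
  fixes H :: "real \<Rightarrow> real"
  assumes "continuous_on {0..1} H"
  shows "conv (\<lambda>z. of_real (H (Arg2pi z / (2 * pi))))"
  unfolding conv_def
proof (rule tendsto_approx)
  fix e :: real assume e: "e > 0"
  define \<theta> where "\<theta> z = Arg2pi z / (2 * pi)" for z
  have \<theta>: "\<theta> z \<in> {0..1}" for z
    using Arg2pi[of z] by (auto simp: \<theta>_def field_simps)
  obtain K where K: "\<And>t. t \<in> {0..1} \<Longrightarrow> \<bar>H t\<bar> \<le> K" "K > 0"
  proof -
    have "bounded (H ` {0..1})" using assms by (intro compact_imp_bounded compact_continuous_image) auto
    then obtain b where "b > 0" "\<forall>x\<in>{0..1}. \<bar>H x\<bar> \<le> b" unfolding bounded_pos by auto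
    then show ?thesis using that[of b] by blast
  qed
  \<comment> \<open>The mass where |1 - z| is at most \<epsilon> does not exceed
    \<open>\<epsilon>\<^sup>2\<close> + 1/J; multiplied by K, each summand is eventually at most
    e/2.\<close>
  define \<epsilon> where "\<epsilon> = sqrt (e / (2 * K))"
  have \<epsilon>: "\<epsilon> > 0" "\<epsilon>\<^sup>2 * K = e / 2" using e K by (auto simp: \<epsilon>_def)
  define cut where "cut z = min 1 (cmod (1 - z) / \<epsilon>)" for z
  have cut: "0 \<le> cut z" "cut z \<le> 1" for z using \<epsilon> by (auto simp: cut_def)
  have cont: "continuous_on (sphere 0 1) (\<lambda>z. cut z * H (\<theta> z))"
    unfolding continuous_on_eq_continuous_within
  proof
    fix z :: complex assume z: "z \<in> sphere 0 1"
    have cchi: "continuous (at z within sphere 0 1) cut"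
      unfolding cut_def using \<epsilon> by (intro continuous_intros) auto
    show "continuous (at z within sphere 0 1) (\<lambda>z. cut z * H (\<theta> z))"
    proof (cases "z = 1")
      case True
      have "((\<lambda>w. cut w * H (\<theta> w)) \<longlongrightarrow> 0) (at 1 within sphere 0 1)"
      proof (rule Lim_null_comparison)
        show "\<forall>\<^sub>F w in at 1 within sphere 0 1. norm (cut w * H (\<theta> w)) \<le> cut w * K"
          using cut K(1) \<theta> by (intro always_eventually) (auto simp: abs_mult intro!: mult_left_mono)
        have "((\<lambda>w. cut w * K) \<longlongrightarrow> cut 1 * K) (at 1 within sphere 0 1)"
          using cchi True by (intro tendsto_intros) (simp add: continuous_within)
        then show "((\<lambda>w. cut w * K) \<longlongrightarrow> 0) (at 1 within sphere 0 1)" by (simp add: cut_def)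
      qed
      then show ?thesis using True by (simp add: continuous_within cut_def)
    next
      case False
      have "z \<notin> \<real>\<^sub>\<ge>\<^sub>0"
      proof
        assume "z \<in> \<real>\<^sub>\<ge>\<^sub>0"
        then obtain r where "r \<ge> 0" "z = of_real r" by (auto elim: nonneg_Reals_cases)
        then show False using False z by simp
      qed
      then have "continuous (at z within sphere 0 1) \<theta>"
        unfolding \<theta>_def by (intro continuous_intros continuous_at_imp_continuous_at_within[OF continuous_at_Arg2pi]) auto
      then have "continuous (at z within sphere 0 1) (H \<circ> \<theta>)"
      proof (rule continuous_within_compose)
        have "continuous (at (\<theta> z) within {0..1}) H"
          using assms \<theta> by (simp add: continuous_on_eq_continuous_within)
        then show "continuous (at (\<theta> z) within \<theta> ` sphere 0 1) H"
          by (rule continuous_within_subset) (use \<theta> in auto)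
      qed
      then show ?thesis using cchi by (intro continuous_intros) (auto simp: o_def)
    qed
  qed
  obtain l where l: "((\<lambda>y. gibbs y (\<lambda>z. of_real (cut z * H (\<theta> z)))) \<longlongrightarrow> l) (at \<beta> within \<rat>)"
    using conv_continuous[OF cont] unfolding conv_def by blast
  have "eventually (\<lambda>y. 1 / J41 y < e / (2 * K)) (at \<beta> within \<rat>)"
    using inverse_J41_tendsto_0 e K by (intro order_tendstoD) auto
  with eventually_rat 
  have "eventually (\<lambda>y. cmod (gibbs y (\<lambda>z. of_real (H (\<theta> z))) - gibbs y (\<lambda>z. of_real (cut z * H (\<theta> z)))) \<le> e) (at \<beta> within \<rat>)"
  proof eventually_elim
    case (elim y)
    obtain d where d: "d > 0" "real d * y \<in> \<int>" using rational_denominator[OF elim(1)] by metis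
    have J: "J41 y \<ge> 1" using J41_ge_1[OF elim(1)] .
    have "gibbs y (\<lambda>z. of_real (H (\<theta> z))) - gibbs y (\<lambda>z. of_real (cut z * H (\<theta> z)))
        = (\<Sum>n<d. of_real (wt y n * ((1 - cut (ee (real n * y))) * H (\<theta> (ee (real n * y)))))) / of_real (J41 y)"
      unfolding gibbs_eq_sum[OF d] by (simp add: sum_subtractf algebra_simps flip: diff_divide_distrib)
    also have "cmod \<dots> = \<bar>\<Sum>n<d. wt y n * ((1 - cut (ee (real n * y))) * H (\<theta> (ee (real n * y))))\<bar> / J41 y"
      using J by (simp only: of_real_sum[symmetric] norm_divide norm_of_real)
    also have "\<dots> \<le> (K * (1 + \<epsilon>\<^sup>2 * J41 y)) / J41 y"
    proof (rule divide_right_mono)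
      have "\<bar>\<Sum>n<d. wt y n * ((1 - cut (ee (real n * y))) * H (\<theta> (ee (real n * y))))\<bar>
          \<le> (\<Sum>n<d. \<bar>wt y n * ((1 - cut (ee (real n * y))) * H (\<theta> (ee (real n * y))))\<bar>)" by (rule sum_abs)
      also have "\<dots> \<le> (\<Sum>n<d. K * (if cmod (1 - ee (real n * y)) \<le> \<epsilon> then wt y n else 0))"
      proof (rule sum_mono)
        fix n
        let ?z = "ee (real n * y)"
        have "\<bar>wt y n * ((1 - cut ?z) * H (\<theta> ?z))\<bar> = wt y n * ((1 - cut ?z) * \<bar>H (\<theta> ?z)\<bar>)"
          using cut[of ?z] by (simp add: abs_mult)
        also have "\<dots> \<le> wt y n * ((1 - cut ?z) * K)"
          using cut[of ?z] K(1)[OF \<theta>] by (intro mult_left_mono) auto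
        also have "\<dots> \<le> wt y n * ((if cmod (1 - ?z) \<le> \<epsilon> then 1 else 0) * K)"
          using cut[of ?z] K(2) \<epsilon>(1) by (intro mult_left_mono mult_right_mono) (auto simp: cut_def)
        finally show "\<bar>wt y n * ((1 - cut ?z) * H (\<theta> ?z))\<bar> \<le> K * (if cmod (1 - ?z) \<le> \<epsilon> then wt y n else 0)"
          by (simp add: mult.commute[of K] split: if_splits)
      qed
      also have "\<dots> \<le> K * (1 + \<epsilon>\<^sup>2 * J41 y)"
        using wt_near_1_sum[OF d, of \<epsilon>] \<epsilon>(1) K(2) by (simp add: sum_distrib_left[symmetric])
      finally show "\<bar>\<Sum>n<d. wt y n * ((1 - cut (ee (real n * y))) * H (\<theta> (ee (real n * y))))\<bar> \<le> K * (1 + \<epsilon>\<^sup>2 * J41 y)" .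
    qed (use J in simp)
    also have "\<dots> = K * (1 / J41 y) + \<epsilon>\<^sup>2 * K" using J by (simp add: field_simps)
    also have "\<dots> \<le> K * (e / (2 * K)) + e / 2"
      unfolding \<epsilon>(2) using elim(2) K(2) by (intro add_right_mono mult_left_mono) auto
    also have "\<dots> = e" using K(2) by simp
    finally show ?case .
  qed
  with l show "\<exists>g l. (g \<longlongrightarrow> l) (at \<beta> within \<rat>) \<and> 
      (\<forall>\<^sub>F y in at \<beta> within \<rat>. cmod (gibbs y (\<lambda>z. of_real (H (Arg2pi z / (2 * pi)))) - g y) \<le> e)"
    unfolding \<theta>_def by blast
qed

end

subsection \<open>The double sine function\<close>

text \<open>This is 2 artanh s without its linear term; what remains is of order s^3, which is
  summable over a two-dimensional lattice.\<close>

definition artanh_tail :: "real \<Rightarrow> real" where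
  "artanh_tail s = ln ((1 + s) / (1 - s)) - 2 * s"

text \<open>A mean value estimate: the derivative is 2 t^2 / (1 - t^2).\<close>

lemma artanh_tail_bound:
  assumes "\<bar>s\<bar> \<le> r" "r < 1"
  shows "\<bar>artanh_tail s\<bar> \<le> 2 / (1 - r\<^sup>2) * \<bar>s\<bar> ^ 3"
proof -
  have r: "0 \<le> r" using assms by linarith
  have r2: "r\<^sup>2 < 1" using assms(2) r by (simp add: power_less_one_iff)
  define S where "S = {-\<bar>s\<bar>..\<bar>s\<bar>}"
  have "norm (artanh_tail s - artanh_tail 0) \<le> 2 * s\<^sup>2 / (1 - r\<^sup>2) * norm (s - 0)"
  proof (rule field_differentiable_bound[where S = S and f' = "\<lambda>t. 2 * t\<^sup>2 / (1 - t\<^sup>2)"])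
    fix t assume "t \<in> S"
    then have t: "\<bar>t\<bar> \<le> \<bar>s\<bar>" by (auto simp: S_def)
    then have t1: "t < 1" "t > -1" using assms by linarith+
    have nz: "1 + t \<noteq> 0" "1 - t \<noteq> 0" "1 - t\<^sup>2 \<noteq> 0"
      using t1 by (auto simp: power2_eq_1_iff)
    have pos: "(1 + t) / (1 - t) > 0" using t1 by simp
    have "(artanh_tail has_field_derivative (1 / ((1 + t) / (1 - t)) * ((1 * (1 - t) - (1 + t) * (0 - 1)) / ((1 - t) * (1 - t))) - 2 * 1)) (at t)"
      unfolding artanh_tail_def using pos nz by (auto intro!: derivative_eq_intros)
    moreover have "1 / ((1 + t) / (1 - t)) * ((1 * (1 - t) - (1 + t) * (0 - 1)) / ((1 - t) * (1 - t))) - 2 * 1 = 2 * t\<^sup>2 / (1 - t\<^sup>2)"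
    proof -
      have d: "1 - t\<^sup>2 = (1 + t) * (1 - t)" by (simp add: power2_eq_square algebra_simps)
      have i: "1 * (1 - t) - (1 + t) * (0 - 1) = 2" by simp
      have "1 / (a / b) * (2 / (b * b)) = 2 / (a * b)" if "a \<noteq> 0" "b \<noteq> 0" for a b :: real
        using that by (simp add: field_simps)
      from this[OF nz(1,2)] have ii: "1 / ((1 + t) / (1 - t)) * (2 / ((1 - t) * (1 - t))) = 2 / (1 - t\<^sup>2)"
        unfolding d .
      have "2 * t\<^sup>2 / (1 - t\<^sup>2) = (2 - 2 * (1 - t\<^sup>2)) / (1 - t\<^sup>2)" by simp
      also have "\<dots> = 2 / (1 - t\<^sup>2) - 2 * (1 - t\<^sup>2) / (1 - t\<^sup>2)" by (rule diff_divide_distrib)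
      also have "2 * (1 - t\<^sup>2) / (1 - t\<^sup>2) = 2" using nz(3) by (rule nonzero_mult_div_cancel_right)
      finally show ?thesis unfolding i ii by simp
    qed
    ultimately show "(artanh_tail has_field_derivative 2 * t\<^sup>2 / (1 - t\<^sup>2)) (at t within S)"
      using has_field_derivative_at_within by metis
    have t2: "t\<^sup>2 \<le> s\<^sup>2" using t by (simp add: abs_le_square_iff)
    moreover have "s\<^sup>2 \<le> r\<^sup>2" using power_mono[OF assms(1) abs_ge_zero, of 2] by simp
    ultimately show "norm (2 * t\<^sup>2 / (1 - t\<^sup>2)) \<le> 2 * s\<^sup>2 / (1 - r\<^sup>2)"
      using r2 by (auto simp: abs_mult intro!: frac_le mult_nonneg_nonneg)
  qed (auto simp: S_def)
  then show ?thesis by (simp add: artanh_tail_def power2_eq_square power3_eq_cube abs_mult mult_ac)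
qed

text \<open>Up to a linear function of \<open>z\<close>, \<open>ds_sum x z\<close> is the logarithm of the double sine function with periods \<open>1\<close>
  and \<open>x\<close>: the product over the lattice points \<open>w = m + nx\<close> of \<open>(z + w) / (1 + x - z + w)\<close>. The linear part of
  each logarithm at the centre of symmetry \<open>z = (1 + x)/2\<close> is removed to make the double series converge absolutely.\<close>

definition ds_term :: "real \<Rightarrow> real \<Rightarrow> nat \<Rightarrow> nat \<Rightarrow> real" where
  "ds_term x z m n = artanh_tail ((z - (1 + x) / 2) / ((1 + x) / 2 + real m + real n * x))"

definition ds_sum :: "real \<Rightarrow> real \<Rightarrow> real" where
  "ds_sum x z = (\<Sum>\<^sub>\<infinity>(m, n)\<in>UNIV. ds_term x z m n)"

text \<open>A majorant of 1/(1 + m + n)^3 in product form, from (1 + m)(1 + n) \<le> (1 + m + n)^2,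
  so that summability reduces to a single series.\<close>

definition dom_weight :: "nat \<Rightarrow> nat \<Rightarrow> real" where
  "dom_weight m n = (1 + real m) powr (-3/2) * (1 + real n) powr (-3/2)"

lemma dom_weight_summable: "(\<lambda>(m, n). dom_weight m n) summable_on UNIV"
proof -
  have "summable (\<lambda>n. real n powr (-3/2))" by (subst summable_real_powr_iff) auto
  then have "summable (\<lambda>n. real (Suc n) powr (-3/2))" by (subst summable_Suc_iff)
  then have s: "(\<lambda>n. (1 + real n) powr (-3/2)) summable_on UNIV"
    by (intro summable_nonneg_imp_summable_on) (auto simp: add.commute)
  then have hs: "((\<lambda>n. (1 + real n) powr (-3/2)) has_sum (\<Sum>\<^sub>\<infinity>n. (1 + real n) powr (-3/2))) UNIV" by simp
  have "(\<lambda>(m, n). dom_weight m n) summable_on (SIGMA m:UNIV. UNIV)"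
  proof (rule summable_on_SigmaI)
    fix m
    show "((\<lambda>n. case (m, n) of (m, n) \<Rightarrow> dom_weight m n) has_sum (1 + real m) powr (-3/2) * (\<Sum>\<^sub>\<infinity>n. (1 + real n) powr (-3/2))) UNIV"
      unfolding dom_weight_def using has_sum_cmult_right[OF hs] by simp
  qed (use s in \<open>auto simp: dom_weight_def intro!: summable_on_cmult_left\<close>)
  then show ?thesis by simp
qed

lemma lattice_cube_le_dom_weight:
  "1 / (1 + real m + real n) ^ 3 \<le> dom_weight m n"
proof -
  have "((1 + real m) * (1 + real n)) powr (3/2) \<le> ((1 + real m + real n)\<^sup>2) powr (3/2)"
    by (intro powr_mono2) (auto simp: power2_eq_square algebra_simps)
  also have "((1 + real m + real n)\<^sup>2) powr (3/2) = (1 + real m + real n) powr 3"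
    by (simp add: powr_powr flip: powr_numeral)
  also have "\<dots> = (1 + real m + real n) ^ 3" by (subst powr_numeral) auto
  finally have "1 / (1 + real m + real n) ^ 3 \<le> 1 / ((1 + real m) * (1 + real n)) powr (3/2)"
    by (intro divide_left_mono) (auto intro!: mult_pos_pos)
  also have "\<dots> = dom_weight m n"
    by (simp add: dom_weight_def powr_mult powr_minus_divide)
  finally show ?thesis .
qed

text \<open>The argument of \<open>artanh_tail\<close> has modulus at most r, as its denominator is
  at least (1 + x)/2. The constant min (1/2) (a/2) bounds that denominator below by a multiple of 1
  + m + n, uniformly for x in [a, b].\<close>

lemma ds_term_bound:
  assumes "0 < a" "a \<le> x" "x \<le> b" and r: "r < 1" and z: "\<bar>z - (1 + x) / 2\<bar> \<le> r * ((1 + x) / 2)"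
  shows "\<bar>ds_term x z m n\<bar> \<le> 2 / (1 - r\<^sup>2) * (((1 + b) / 2) / min (1/2) (a/2)) ^ 3 * dom_weight m n"
proof -
  define c where "c = (1 + x) / 2"
  define \<kappa> where "\<kappa> = min (1/2) (a/2)"
  have \<kappa>: "\<kappa> > 0" "\<kappa> \<le> 1/2" "\<kappa> \<le> x / 2" using assms(1,2) by (auto simp: \<kappa>_def)
  define w where "w = c + real m + real n * x"
  have c: "c > 0" using assms by (auto simp: c_def)
  have r0: "0 \<le> r"
  proof (rule ccontr)
    assume "\<not> 0 \<le> r"
    then have "r * c < 0" using c by (simp add: mult_neg_pos)
    then show False using z abs_ge_zero[of "z - (1 + x) / 2"] unfolding c_def by linarith
  qed
  have r2: "r\<^sup>2 < 1" using r r0 by (simp add: power_less_one_iff)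
  have wc: "w \<ge> c" using assms by (simp add: w_def)
  have "\<kappa> * 1 \<le> c" using \<kappa> by (simp add: c_def)
  moreover have "\<kappa> * real m \<le> 1 * real m" using \<kappa> by (intro mult_right_mono) auto
  moreover have "\<kappa> * real n \<le> x * real n" using \<kappa> assms by (intro mult_right_mono) auto
  ultimately have w\<kappa>: "\<kappa> * (1 + real m + real n) \<le> w"
    by (simp add: w_def algebra_simps)
  have s: "\<bar>(z - c) / w\<bar> \<le> r"
  proof -
    have "\<bar>z - c\<bar> \<le> r * c" using z by (simp add: c_def)
    also have "\<dots> \<le> r * w" using wc r0 by (intro mult_left_mono)
    finally show ?thesis using wc c by (simp add: abs_divide field_simps)
  qed
  have "\<bar>z - c\<bar> \<le> 1 * c" using z mult_right_mono[of r 1 c] r c unfolding c_def[symmetric] by linarith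
  also have "\<dots> \<le> (1 + b) / 2" using assms by (simp add: c_def)
  finally have zb: "\<bar>z - c\<bar> \<le> (1 + b) / 2" .
  have "\<bar>(z - c) / w\<bar> \<le> ((1 + b) / 2) / (\<kappa> * (1 + real m + real n))"
    unfolding abs_divide using zb w\<kappa> \<kappa> wc c assms(1-3) by (intro frac_le) (auto intro!: mult_pos_pos)
  then have s3: "\<bar>(z - c) / w\<bar> ^ 3 \<le> (((1 + b) / 2) / (\<kappa> * (1 + real m + real n))) ^ 3"
    by (intro power_mono) auto
  have "\<bar>ds_term x z m n\<bar> \<le> 2 / (1 - r\<^sup>2) * \<bar>(z - c) / w\<bar> ^ 3"
    using artanh_tail_bound[OF s r] by (simp add: ds_term_def c_def w_def)
  also have "\<dots> \<le> 2 / (1 - r\<^sup>2) * (((1 + b) / 2) / (\<kappa> * (1 + real m + real n))) ^ 3"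
    using r2 by (intro mult_left_mono s3) auto
  also have "\<dots> = 2 / (1 - r\<^sup>2) * (((1 + b) / 2) / \<kappa>) ^ 3 * (1 / (1 + real m + real n) ^ 3)"
    by (simp add: power_divide power_mult_distrib)
  also have "\<dots> \<le> 2 / (1 - r\<^sup>2) * (((1 + b) / 2) / \<kappa>) ^ 3 * dom_weight m n"
    using r2 \<kappa> assms by (intro mult_left_mono lattice_cube_le_dom_weight) (auto intro!: mult_nonneg_nonneg divide_nonneg_nonneg)
  finally show ?thesis by (simp add: \<kappa>_def)
qed

lemma ds_strip:
  fixes z x :: real
  assumes "0 < x" "0 < z" "z < 1 + x"
  obtains r where "r < 1" "\<bar>z - (1 + x) / 2\<bar> \<le> r * ((1 + x) / 2)"
proof (rule that[of "\<bar>z - (1 + x) / 2\<bar> / ((1 + x) / 2)"])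
  have "\<bar>z - (1 + x) / 2\<bar> < (1 + x) / 2"
  proof -
    have "z - (1 + x) / 2 < (1 + x) / 2" "- (z - (1 + x) / 2) < (1 + x) / 2"
      using assms by (simp_all add: field_simps)
    then show ?thesis unfolding abs_less_iff by blast
  qed
  then show "\<bar>z - (1 + x) / 2\<bar> / ((1 + x) / 2) < 1" using assms by (subst pos_divide_less_eq) auto
qed (use assms in auto)

lemma ds_term_summable:
  assumes "0 < x" "0 < z" "z < 1 + x"
  shows "(\<lambda>(m, n). ds_term x z m n) summable_on UNIV"
proof -
  obtain r where r: "r < 1" "\<bar>z - (1 + x) / 2\<bar> \<le> r * ((1 + x) / 2)"
    using ds_strip[OF assms] by blast
  define C where "C = 2 / (1 - r\<^sup>2) * (((1 + x) / 2) / min (1/2) (x/2)) ^ 3"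
  have "(\<lambda>mn. C * (case mn of (m, n) \<Rightarrow> dom_weight m n)) summable_on UNIV"
    by (intro summable_on_cmult_right dom_weight_summable)
  then have "(\<lambda>mn. norm (case mn of (m, n) \<Rightarrow> ds_term x z m n)) summable_on UNIV"
    by (rule Infinite_Sum.abs_summable_on_comparison_test')
       (use ds_term_bound[OF assms(1) order_refl order_refl r] in \<open>auto simp: C_def\<close>)
  then show ?thesis by (rule abs_summable_summable)
qed

lemma ds_sum_continuous:
  assumes "0 < a" "r < 1"
  shows "continuous_on {(x, z). a \<le> x \<and> x \<le> b \<and> \<bar>z - (1 + x) / 2\<bar> \<le> r * ((1 + x) / 2)} (\<lambda>(x, z). ds_sum x z)"
    (is "continuous_on ?K _")
proof -
  define C where "C = 2 / (1 - r\<^sup>2) * (((1 + b) / 2) / min (1/2) (a/2)) ^ 3"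
  have "uniform_limit ?K (\<lambda>X y. \<Sum>mn\<in>X. (case mn of (m, n) \<Rightarrow> case y of (x, z) \<Rightarrow> ds_term x z m n))
     (\<lambda>y. \<Sum>\<^sub>\<infinity>mn\<in>UNIV. (case mn of (m, n) \<Rightarrow> case y of (x, z) \<Rightarrow> ds_term x z m n)) (finite_subsets_at_top UNIV)"
  proof (rule Weierstrass_m_test_general)
    show "(\<lambda>mn. C * (case mn of (m, n) \<Rightarrow> dom_weight m n)) summable_on UNIV"
      by (intro summable_on_cmult_right dom_weight_summable)
    fix mn :: "nat \<times> nat" and y assume "y \<in> ?K"
    then show "norm (case mn of (m, n) \<Rightarrow> case y of (x, z) \<Rightarrow> ds_term x z m n) \<le> C * (case mn of (m, n) \<Rightarrow> dom_weight m n)"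
      using ds_term_bound[OF assms(1) _ _ assms(2), of "fst y" b "snd y" "fst mn" "snd mn"]
      unfolding case_prod_unfold C_def by simp
  qed
  then have "continuous_on ?K (\<lambda>y. \<Sum>\<^sub>\<infinity>mn\<in>UNIV. (case mn of (m, n) \<Rightarrow> case y of (x, z) \<Rightarrow> ds_term x z m n))"
  proof (rule uniform_limit_theorem[rotated])
    have "continuous_on ?K (\<lambda>y. ds_term (fst y) (snd y) m n)" for m n
    proof -
      have *: "(1 + x) / 2 + real m + real n * x \<noteq> 0 \<and>
         \<bar>(z - (1 + x) / 2) / ((1 + x) / 2 + real m + real n * x)\<bar> < 1" if "(x, z) \<in> ?K" for x z
      proof -
        have c: "(1 + x) / 2 > 0" "real n * x \<ge> 0" using that assms by auto
        then have "r * ((1 + x) / 2) < 1 * ((1 + x) / 2)" using assms(2) by (intro mult_strict_right_mono)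
        moreover have "\<bar>z - (1 + x) / 2\<bar> \<le> r * ((1 + x) / 2)" using that by simp
        ultimately have "\<bar>z - (1 + x) / 2\<bar> < (1 + x) / 2 + real m + real n * x"
          using c of_nat_0_le_iff[of m] by linarith
        then show ?thesis using c by (auto simp: abs_divide)
      qed
      have **: "(1 + fst y) / 2 + real m + real n * fst y \<noteq> 0"
         "(snd y - (1 + fst y) / 2) / ((1 + fst y) / 2 + real m + real n * fst y) < 1"
         "(snd y - (1 + fst y) / 2) / ((1 + fst y) / 2 + real m + real n * fst y) > -1" if "y \<in> ?K" for y
      proof -
        have "(fst y, snd y) \<in> ?K" using that by simp
        note c = *[OF this, THEN conjunct1] *[OF this, THEN conjunct2]
        show "(1 + fst y) / 2 + real m + real n * fst y \<noteq> 0" by (rule c(1))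
        show "(snd y - (1 + fst y) / 2) / ((1 + fst y) / 2 + real m + real n * fst y) < 1"
         "(snd y - (1 + fst y) / 2) / ((1 + fst y) / 2 + real m + real n * fst y) > -1" using c(2) by linarith+
      qed
      have cl: "continuous_on {-1<..<1} artanh_tail"
        unfolding artanh_tail_def by (intro continuous_intros) auto
      show ?thesis unfolding ds_term_def
        by (rule continuous_on_compose2[OF cl]) (use ** in \<open>auto intro!: continuous_intros\<close>)
    qed
    then show "\<forall>\<^sub>F X in finite_subsets_at_top UNIV. continuous_on ?K (\<lambda>y. \<Sum>mn\<in>X. (case mn of (m, n) \<Rightarrow> case y of (x, z) \<Rightarrow> ds_term x z m n))"
      unfolding case_prod_unfold by (intro always_eventually allI continuous_on_sum)
  qed simp
  then show ?thesis unfolding ds_sum_def case_prod_unfold .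
qed

text \<open>Euler's product with the factors paired under the reflection of z to 1 - z, divided by
  its value at z = 1/2, where the sine is 1. The division cancels the diverging factors.\<close>

lemma sine_product_ratio:
  fixes z :: real
  assumes "0 < z" "z < 1"
  shows "(\<lambda>K. \<Prod>m<K. (real m + z) * (real m + 1 - z) / (real m + 1/2)\<^sup>2) \<longlonglongrightarrow> sin (pi * z)"
proof -
  have P: "(\<Prod>m<Suc K. (real m + z) * (real m + 1 - z)) = z * (real K + 1 - z) * (\<Prod>k=1..K. (real k)\<^sup>2 - z\<^sup>2)" for K z
  proof (induction K)
    case (Suc K)
    have "(\<Prod>m<Suc (Suc K). (real m + z) * (real m + 1 - z)) 
      = z * (real K + 1 - z) * (\<Prod>k=1..K. (real k)\<^sup>2 - z\<^sup>2) * ((real (Suc K) + z) * (real (Suc K) + 1 - z))"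
      by (subst prod.lessThan_Suc) (simp only: Suc)
    also have "\<dots> = z * (real (Suc K) + 1 - z) * ((\<Prod>k=1..K. (real k)\<^sup>2 - z\<^sup>2) * ((real (Suc K))\<^sup>2 - z\<^sup>2))"
      by (simp add: power2_eq_square algebra_simps)
    also have "\<dots> = z * (real (Suc K) + 1 - z) * (\<Prod>k=1..Suc K. (real k)\<^sup>2 - z\<^sup>2)" by simp
    finally show ?case .
  qed simp
  define Q where "Q z K = (\<Prod>k=1..K. 1 - z\<^sup>2 / (real k)\<^sup>2)" for z K
  have PQ: "(\<Prod>k=1..K. (real k)\<^sup>2 - z\<^sup>2) = (\<Prod>k=1..K. (real k)\<^sup>2) * Q z K" for z K
    unfolding Q_def prod.distrib[symmetric] by (intro prod.cong) (auto simp: field_simps)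
  have half: "(real m + 1/2)\<^sup>2 = (real m + 1/2) * (real m + 1 - 1/2)" for m by (simp add: power2_eq_square)
  have "(\<Prod>m<Suc K. (real m + z) * (real m + 1 - z) / (real m + 1/2)\<^sup>2)
     = (pi * z * Q z K) / (pi * (1/2) * Q (1/2) K) * ((real K + 1 - z) / (real K + 1 - 1/2))" for K
  proof -
    have R: "(\<Prod>k=1..K. (real k)\<^sup>2) \<noteq> 0" by simp
    have "(z * a * (R * u)) / ((1/2) * b * (R * w)) = (pi * z * u) / (pi * (1/2) * w) * (a / b)"
      if "R \<noteq> 0" for a b R u w :: real
    proof -
      have "(z * a * (R * u)) / ((1/2) * b * (R * w)) = (R * (z * a * u)) / (R * ((1/2) * b * w))"
        by (simp only: mult_ac)
      also have "\<dots> = (pi * (z * a * u)) / (pi * ((1/2) * b * w))"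
        using that by (simp only: mult_divide_mult_cancel_left pi_neq_zero not_False_eq_True)
      also have "\<dots> = (pi * z * u) / (pi * (1/2) * w) * (a / b)"
        by (simp only: times_divide_times_eq mult_ac)
      finally show ?thesis .
    qed
    from this[OF R] show ?thesis unfolding prod_dividef half P PQ .
  qed
  moreover have "(\<lambda>K. (pi * z * Q z K) / (pi * (1/2) * Q (1/2) K) * ((real K + 1 - z) / (real K + 1 - 1/2)))
     \<longlonglongrightarrow> sin (pi * z) / sin (pi * (1/2)) * 1"
  proof (intro tendsto_mult tendsto_divide)
    show "(\<lambda>K. pi * z * Q z K) \<longlonglongrightarrow> sin (pi * z)" unfolding Q_def by (rule sin_product_formula_real)
    show "(\<lambda>K. pi * (1/2) * Q (1/2) K) \<longlonglongrightarrow> sin (pi * (1/2))" unfolding Q_def by (rule sin_product_formula_real)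
    show "(\<lambda>K. (real K + 1 - z) / (real K + 1 - 1/2)) \<longlonglongrightarrow> 1" by real_asymp
  qed simp
  ultimately have "(\<lambda>K. \<Prod>m<Suc K. (real m + z) * (real m + 1 - z) / (real m + 1/2)\<^sup>2) \<longlonglongrightarrow> sin (pi * z)"
    by simp
  then show ?thesis by (rule LIMSEQ_imp_Suc)
qed

lemma has_sum_minus:
  fixes f g :: "'a \<Rightarrow> real"
  assumes "(f has_sum a) A" "(g has_sum b) A"
  shows "((\<lambda>x. f x - g x) has_sum (a - b)) A"
  using has_sum_add[OF assms(1), of "\<lambda>x. - g x" "- b"] assms(2) by (simp add: has_sum_uminus)

text \<open>The increment at z = 1/2, where the sine factor is 1. It collects the effect of the
  removed linear parts, and its value is never computed.\<close>

definition ds_const :: "real \<Rightarrow> real" where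
  "ds_const x = ds_sum x (1/2 + x) - ds_sum x (1/2)"

lemma sin_pi_pos: "0 < z \<Longrightarrow> z < 1 \<Longrightarrow> sin (pi * z) > 0" for z :: real
  by (intro sin_gt_zero) auto

text \<open>Comparing the increment at z with the one at 1/2 cancels the linear parts. The rest
  telescopes in n, so only the row n = 0 survives, and that row is the sine product.\<close>

lemma ds_sum_shift:
  assumes x: "0 < x" and z: "0 < z" "z < 1"
  shows "ds_sum x (z + x) - ds_sum x z = ds_const x - ln (sin (pi * z))"
proof -
  define T where "T m n = ds_term x (z + x) m n - ds_term x z m n - (ds_term x (1/2 + x) m n - ds_term x (1/2) m n)" for m n
  define D where "D = ds_sum x (z + x) - ds_sum x z - ds_const x"
  have hs: "((\<lambda>(m, n). ds_term x w m n) has_sum ds_sum x w) UNIV" if "0 < w" "w < 1 + x" for w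
    unfolding ds_sum_def using ds_term_summable[OF x that] by simp
  have hsT: "((\<lambda>(m, n). T m n) has_sum D) (SIGMA m:UNIV. UNIV)"
    unfolding T_def D_def ds_const_def case_prod_unfold UNIV_Times_UNIV
    using hs x z by (intro has_sum_minus) (auto simp: case_prod_unfold)
  define \<phi> where "\<phi> t = ln ((z + t) * (1 - z + t) / (1/2 + t)\<^sup>2)" for t
  have tele: "T m n = \<phi> (real m + real (Suc n) * x) - \<phi> (real m + real n * x)" for m n
  proof -
    define t where "t = real m + real n * x"
    have t: "t \<ge> 0" using x by (simp add: t_def)
    have quot: "(1 + (w - (1 + x) / 2) / ((1 + x) / 2 + t)) / (1 - (w - (1 + x) / 2) / ((1 + x) / 2 + t))
        = (w + t) / (1 + x - w + t)" for w
    proof -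
      have "(1 + x) / 2 + t > 0" using x t by (intro add_pos_nonneg) auto
      then have nz: "(1 + x) / 2 + t \<noteq> 0" by linarith
      have "1 + (w - (1 + x) / 2) / ((1 + x) / 2 + t) = (w + t) / ((1 + x) / 2 + t)"
        using nz by (simp add: field_simps)
      moreover have "1 - (w - (1 + x) / 2) / ((1 + x) / 2 + t) = (1 + x - w + t) / ((1 + x) / 2 + t)"
        using nz by (simp add: field_simps)
      ultimately show ?thesis using nz by simp
    qed
    define \<Lambda> where "\<Lambda> w = (w - (1 + x) / 2) / ((1 + x) / 2 + t)" for w
    have dt: "ds_term x w m n = ln ((w + t) / (1 + x - w + t)) - 2 * \<Lambda> w" for w
      unfolding ds_term_def artanh_tail_def quot[symmetric] by (simp add: t_def \<Lambda>_def add.assoc)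
    have lin: "\<Lambda> (z + x) - \<Lambda> z = \<Lambda> (1/2 + x) - \<Lambda> (1/2)"
    proof -
      have gen: "a / d - b / d = a' / d - b' / d" if "a - b = a' - b'" for a b a' b' d :: real
        using that by (metis diff_divide_distrib)
      show ?thesis unfolding \<Lambda>_def by (rule gen) simp
    qed
    have args: "1 + x - (z + x) + t = 1 - z + t" "1 + x - (1/2 + x) + t = 1/2 + t" "1 + x - 1/2 + t = 1/2 + x + t"
      by simp_all
    have pos: "z + x + t > 0" "1 - z + t > 0" "z + t > 0" "1 + x - z + t > 0" "1/2 + x + t > 0" "1/2 + t > 0"
      using x z t by linarith+
    have "T m n = ln ((z + x + t) / (1 - z + t)) - ln ((z + t) / (1 + x - z + t)) 
        - (ln ((1/2 + x + t) / (1/2 + t)) - ln ((1/2 + t) / (1/2 + x + t)))"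
      unfolding T_def dt args using lin by linarith
    also have "\<dots> = \<phi> (t + x) - \<phi> t"
    proof -
      have "\<phi> (t + x) = ln ((z + x + t) * (1 + x - z + t) / (1/2 + x + t)\<^sup>2)"
        by (simp add: \<phi>_def algebra_simps)
      then show ?thesis using pos unfolding \<phi>_def
        by (simp add: ln_div ln_mult ln_realpow)
    qed
    also have "t + x = real m + real (Suc n) * x" by (simp add: t_def algebra_simps)
    finally show ?thesis by (simp add: t_def)
  qed
  have inner: "((\<lambda>n. T m n) has_sum (- \<phi> (real m))) UNIV" for m
  proof -
    have "(\<lambda>(m, n). T m n) summable_on (SIGMA m:UNIV. UNIV)" using hsT by (auto simp: summable_on_def)
    then have su: "(\<lambda>n. T m n) summable_on UNIV" by (rule summable_on_SigmaD1) simp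
    have "(\<lambda>n. \<phi> (real m + real n * x)) \<longlonglongrightarrow> 0"
    proof -
      have "((\<lambda>t. (z + t) * (1 - z + t) / (1/2 + t)\<^sup>2) \<longlongrightarrow> 1) at_top" by real_asymp
      then have "((\<lambda>t. ln ((z + t) * (1 - z + t) / (1/2 + t)\<^sup>2)) \<longlongrightarrow> ln 1) at_top"
        by (rule tendsto_ln) simp
      moreover have "filterlim (\<lambda>n. real m + real n * x) at_top sequentially"
        using x by real_asymp
      ultimately show ?thesis unfolding \<phi>_def by (auto intro: filterlim_compose)
    qed
    from telescope_sums[OF this] have "(\<lambda>n. T m n) sums (0 - \<phi> (real m))"
      unfolding tele by simp
    moreover have "(\<lambda>n. T m n) sums (infsum (\<lambda>n. T m n) UNIV)"
      using has_sum_imp_sums[OF has_sum_infsum[OF su]] .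
    ultimately have "infsum (\<lambda>n. T m n) UNIV = - \<phi> (real m)" by (simp add: sums_unique2)
    then show ?thesis using has_sum_infsum[OF su] by simp
  qed
  have "((\<lambda>m. - \<phi> (real m)) has_sum D) UNIV"
    by (rule has_sum_SigmaD[OF hsT]) (simp add: inner)
  then have "(\<lambda>m. - \<phi> (real m)) sums D" by (rule has_sum_imp_sums)
  then have lim1: "(\<lambda>K. \<Sum>m<K. - \<phi> (real m)) \<longlonglongrightarrow> D" by (simp add: sums_def)
  have sumprod: "(\<Sum>m<K. - \<phi> (real m)) = - ln (\<Prod>m<K. (real m + z) * (real m + 1 - z) / (real m + 1/2)\<^sup>2)" for K
  proof -
    have "ln (\<Prod>m<K. (real m + z) * (real m + 1 - z) / (real m + 1/2)\<^sup>2) = (\<Sum>m<K. \<phi> (real m))"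
    proof -
      have pos: "(real m + z) * (real m + 1 - z) / (real m + 1/2)\<^sup>2 > 0" for m
        using z by (intro divide_pos_pos mult_pos_pos) (auto intro: add_nonneg_pos)
      have "ln (\<Prod>m<K. (real m + z) * (real m + 1 - z) / (real m + 1/2)\<^sup>2)
          = (\<Sum>m<K. ln ((real m + z) * (real m + 1 - z) / (real m + 1/2)\<^sup>2))"
        by (rule ln_prod) (use pos in \<open>metis finite_lessThan less_irrefl\<close>)+
      moreover have "ln ((real m + z) * (real m + 1 - z) / (real m + 1/2)\<^sup>2) = \<phi> (real m)" for m
      proof -
        have e: "real m + z = z + real m" "real m + 1 - z = 1 - z + real m" "real m + 1/2 = 1/2 + real m"
          by simp_all
        show ?thesis unfolding \<phi>_def e ..
      qed
      ultimately show ?thesis by simp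
    qed
    then show ?thesis by (simp add: sum_negf)
  qed
  have "(\<lambda>K. \<Sum>m<K. - \<phi> (real m)) \<longlonglongrightarrow> - ln (sin (pi * z))"
    unfolding sumprod using sin_pi_pos[OF z] by (intro tendsto_intros sine_product_ratio z) auto
  with lim1 have "D = - ln (sin (pi * z))" by (rule LIMSEQ_unique)
  then show ?thesis by (simp add: D_def)
qed

text \<open>Homogeneity: dividing z and the periods (1, x) by x gives the periods (1/x, 1), which
  exchanges the roles of m and n.\<close>

lemma ds_sum_inverse:
  assumes "x > 0"
  shows "ds_sum x z = ds_sum (1 / x) (z / x)"
proof -
  have "ds_term (1 / x) (z / x) n m = ds_term x z m n" for m n
  proof -
    have "(z / x - (1 + 1 / x) / 2) / ((1 + 1 / x) / 2 + real n + real m * (1 / x))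
      = (x * (z / x - (1 + 1 / x) / 2)) / (x * ((1 + 1 / x) / 2 + real n + real m * (1 / x)))"
      using assms by simp
    also have "x * (z / x - (1 + 1 / x) / 2) = z - (1 + x) / 2" using assms by (simp add: field_simps)
    also have "x * ((1 + 1 / x) / 2 + real n + real m * (1 / x)) = (1 + x) / 2 + real m + real n * x"
      using assms by (simp add: field_simps)
    finally show ?thesis unfolding ds_term_def by simp
  qed
  then have "ds_sum x z = (\<Sum>\<^sub>\<infinity>mn\<in>UNIV. (case prod.swap mn of (m, n) \<Rightarrow> ds_term (1 / x) (z / x) m n))"
    unfolding ds_sum_def by (intro infsum_cong) auto
  also have "\<dots> = ds_sum (1 / x) (z / x)"
    unfolding ds_sum_def by (rule infsum_reindex_bij_betw) (rule bij_swap)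
  finally show ?thesis .
qed

lemma ds_sum_shift_1:
  assumes x: "0 < x" and z: "0 < z" "z < x"
  shows "ds_sum x (z + 1) - ds_sum x z = ds_const (1 / x) - ln (sin (pi * z / x))"
  using ds_sum_shift[of "1 / x" "z / x"] assms
  unfolding ds_sum_inverse[OF x] by (simp add: add_divide_distrib)

text \<open>With z = e(1/(2q)) the factors 1 - z e(k/q) have modulus 2 sin(pi (k + 1/2)/q), and 1 -
  z^q = 2.\<close>

lemma sum_ln_sin:
  assumes "q > 0"
  shows "(\<Sum>k<q. ln (sin (pi * ((real k + 1/2) / real q)))) = ln 2 - real q * ln 2"
proof -
  have pos: "sin (pi * ((real k + 1/2) / real q)) > 0" if "k < q" for k
    using that by (intro sin_pi_pos) (auto simp: field_simps)
  have "(\<Prod>k<q. 2 * sin (pi * ((real k + 1/2) / real q))) = (\<Prod>k<q. cmod (1 - ee (1 / (2 * real q)) * ee (real k * (of_int 1 / real q))))"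
  proof (intro prod.cong refl)
    fix k assume "k \<in> {..<q}"
    then have "2 * sin (pi * ((real k + 1/2) / real q)) = cmod (1 - ee ((real k + 1/2) / real q))"
      unfolding cmod_1_minus_ee using pos[of k] by (simp only: lessThan_iff abs_of_pos)
    moreover have "(real k + 1/2) / real q = 1 / (2 * real q) + real k * (of_int 1 / real q)"
      using assms by (simp add: field_simps)
    ultimately show "2 * sin (pi * ((real k + 1/2) / real q)) = cmod (1 - ee (1 / (2 * real q)) * ee (real k * (of_int 1 / real q)))"
      by (metis ee_add)
  qed
  also have "\<dots> = cmod (1 - ee (1 / (2 * real q)) ^ q)"
    unfolding prod_norm by (subst prod_1_minus_roots_of_unity) (use assms in auto)
  also have "\<dots> = 2" using assms by (simp add: ee_power cmod_1_minus_ee)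
  finally have "ln (\<Prod>k<q. 2 * sin (pi * ((real k + 1/2) / real q))) = ln 2" by simp
  moreover have "ln (\<Prod>k<q. 2 * sin (pi * ((real k + 1/2) / real q))) = (\<Sum>k<q. ln (2 * sin (pi * ((real k + 1/2) / real q))))"
    by (rule ln_prod) (use pos in force)+
  ultimately have "(\<Sum>k<q. ln (2 * sin (pi * ((real k + 1/2) / real q)))) = ln 2" by simp
  moreover have "(\<Sum>k<q. ln (2 * sin (pi * ((real k + 1/2) / real q)))) = (\<Sum>k<q. ln 2 + ln (sin (pi * ((real k + 1/2) / real q))))"
    by (intro sum.cong refl ln_mult_pos) (use pos in auto)
  ultimately show ?thesis by (simp add: sum.distrib)
qed

text \<open>Both sides come from one telescoping sum of \<open>ds_sum x\<close> over the grid \<open>(k + 1/2) / q\<close>, as the periods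
  \<open>x = p/q\<close> and \<open>1\<close> are \<open>p\<close> and \<open>q\<close> grid steps.\<close>

lemma ds_const_reciprocity:
  assumes "p > 0" "q > 0" "x = real p / real q"
  shows "ds_const x + ln 2 = x * (ds_const (1 / x) + ln 2)"
proof -
  have x: "x > 0" using assms by simp
  define \<beta> where "\<beta> k = ds_sum x ((real k + 1/2) / real q)" for k :: nat
  have shift: "(\<Sum>k<a. \<beta> (k + b)) = (\<Sum>k<a+b. \<beta> k) - (\<Sum>k<b. \<beta> k)" for a b
    by (induction a) (auto simp: add.commute)
  \<comment> \<open>Both sides are the sum over k < p + q minus the sums over k < p and over k <
    q.\<close>
  have "(\<Sum>k<q. \<beta> (k + p) - \<beta> k) = (\<Sum>k<p. \<beta> (k + q) - \<beta> k)"
    unfolding sum_subtractf shift by (simp add: add.commute)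
  moreover have "(\<Sum>k<q. \<beta> (k + p) - \<beta> k) = real q * (ds_const x + ln 2) - ln 2"
  proof -
    have "(\<Sum>k<q. \<beta> (k + p) - \<beta> k) = (\<Sum>k<q. ds_const x - ln (sin (pi * ((real k + 1/2) / real q))))"
    proof (intro sum.cong refl)
      fix k assume k: "k \<in> {..<q}"
      have "(real (k + p) + 1/2) / real q = (real k + 1/2) / real q + x"
        by (simp add: assms(3) add_divide_distrib)
      then show "\<beta> (k + p) - \<beta> k = ds_const x - ln (sin (pi * ((real k + 1/2) / real q)))"
        unfolding \<beta>_def using ds_sum_shift[OF x, of "(real k + 1/2) / real q"] k assms(2) by simp
    qed
    then show ?thesis by (simp only: sum_subtractf sum_ln_sin[OF assms(2)]) (simp add: algebra_simps)
  qed
  moreover have "(\<Sum>k<p. \<beta> (k + q) - \<beta> k) = real p * (ds_const (1 / x) + ln 2) - ln 2"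
  proof -
    have "(\<Sum>k<p. \<beta> (k + q) - \<beta> k) = (\<Sum>k<p. ds_const (1 / x) - ln (sin (pi * ((real k + 1/2) / real p))))"
    proof (intro sum.cong refl)
      fix k assume k: "k \<in> {..<p}"
      have 1: "(real (k + q) + 1/2) / real q = (real k + 1/2) / real q + 1"
        using assms(2) by (simp add: field_simps)
      have 2: "pi * ((real k + 1/2) / real q) / x = pi * ((real k + 1/2) / real p)"
        using assms by (simp add: field_simps)
      have 3: "(real k + 1/2) / real q < x" using k assms by (simp add: divide_strict_right_mono)
      show "\<beta> (k + q) - \<beta> k = ds_const (1 / x) - ln (sin (pi * ((real k + 1/2) / real p)))"
        unfolding \<beta>_def 1 using ds_sum_shift_1[OF x _ 3] assms(2) unfolding 2 by simp
    qed
    then show ?thesis by (simp only: sum_subtractf sum_ln_sin[OF assms(1)]) (simp add: algebra_simps)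
  qed
  ultimately have "real q * (ds_const x + ln 2) = real p * (ds_const (1 / x) + ln 2)" by simp
  moreover have "X = x * Y" if "real q * X = real p * Y" for X Y
  proof -
    have "X * real q = (x * Y) * real q" using that assms by (simp add: mult_ac)
    then show ?thesis using assms(2) by simp
  qed
  ultimately show ?thesis by blast
qed

text \<open>The slope is forced by the shift by x, which is to contribute exactly -ln (2 sin (pi
  z)). By \<open>ds_const_reciprocity\<close> the same slope also normalises the shift by 1 when x
  is rational.\<close>

definition log_double_sine :: "real \<Rightarrow> real \<Rightarrow> real" where
  "log_double_sine x z = ds_sum x z - (ln 2 + ds_const x) / x * z"

lemma log_double_sine_shift:
  assumes "0 < x" "0 < z" "z < 1"
  shows "log_double_sine x (z + x) = log_double_sine x z - ln (2 * sin (pi * z))"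
proof -
  have "ln (2 * sin (pi * z)) = ln 2 + ln (sin (pi * z))"
    using sin_pi_pos[OF assms(2,3)] by (intro ln_mult_pos) auto
  moreover have "(ln 2 + ds_const x) / x * (z + x) = (ln 2 + ds_const x) / x * z + (ln 2 + ds_const x)"
    using assms(1) by (simp add: distrib_left)
  ultimately show ?thesis
    using ds_sum_shift[OF assms] unfolding log_double_sine_def by linarith
qed

lemma log_double_sine_shift_1:
  assumes "x \<in> \<rat>" "0 < x" "0 < z" "z < x"
  shows "log_double_sine x (z + 1) = log_double_sine x z - ln (2 * sin (pi * z / x))"
proof -
  obtain p q :: nat where pq: "p > 0" "q > 0" "x = real p / real q"
  proof -
    obtain m n :: nat where "n \<noteq> 0" "\<bar>x\<bar> = real m / real n"
      using Rats_abs_nat_div_natE[OF assms(1)] by metis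
    then show ?thesis using that[of m n] assms(2) by (cases "m = 0") auto
  qed
  have "sin (pi * (z / x)) > 0" using assms by (intro sin_pi_pos) auto
  then have "ln (2 * sin (pi * z / x)) = ln 2 + ln (sin (pi * z / x))"
    by (intro ln_mult_pos) auto
  moreover have "(ln 2 + ds_const x) / x = ds_const (1 / x) + ln 2"
    using ds_const_reciprocity[OF pq] assms(2) by (simp add: field_simps)
  ultimately show ?thesis
    using ds_sum_shift_1[OF assms(2-4)] by (simp add: log_double_sine_def distrib_left)
qed

lemma log_double_sine_continuous:
  assumes "0 < a" "r < 1"
  shows "continuous_on {(x, z). a \<le> x \<and> x \<le> b \<and> \<bar>z - (1 + x) / 2\<bar> \<le> r * ((1 + x) / 2)} (\<lambda>(x, z). log_double_sine x z)"
    (is "continuous_on ?K _")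
proof (cases "b \<ge> a")
  case True
  \<comment> \<open>The points 1/2 and 1/2 + x occurring in \<open>ds_const\<close> have distance
    x/2 from the centre (1 + x)/2, which is the fraction x/(1 + x) \<le> b/(1 + b) of the
    half-width.\<close>
  define s where "s = b / (1 + b)"
  have s: "s < 1" using assms True by (simp add: s_def)
  have strip: "\<bar>w - (1 + x) / 2\<bar> \<le> s * ((1 + x) / 2)" if "a \<le> x" "x \<le> b" "w = 1/2 \<or> w = 1/2 + x" for x w
  proof -
    have "x / (1 + x) \<le> s" unfolding s_def using that assms by (simp add: field_simps)
    then have "x / (1 + x) * ((1 + x) / 2) \<le> s * ((1 + x) / 2)"
      using that assms by (intro mult_right_mono) auto
    moreover have "x / (1 + x) * ((1 + x) / 2) = x / 2" using that assms by (simp add: field_simps)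
    moreover have "\<bar>w - (1 + x) / 2\<bar> = x / 2" using that assms by (auto simp: abs_if field_simps)
    ultimately show ?thesis by simp
  qed
  have fst: "fst y \<in> {a..b}" "fst y \<noteq> 0" if "y \<in> ?K" for y using that assms by auto
  have "continuous_on ?K (\<lambda>y. ds_sum (fst y) (1/2 + fst y))"
    using continuous_on_compose2[OF ds_sum_continuous[OF assms(1) s, of b], of ?K "\<lambda>y. (fst y, 1/2 + fst y)"] strip
    by (force intro!: continuous_intros)
  moreover have "continuous_on ?K (\<lambda>y. ds_sum (fst y) (1/2))"
    using continuous_on_compose2[OF ds_sum_continuous[OF assms(1) s, of b], of ?K "\<lambda>y. (fst y, 1/2)"] strip
    by (force intro!: continuous_intros)
  moreover have "continuous_on ?K (\<lambda>y. ds_sum (fst y) (snd y))"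
    using ds_sum_continuous[OF assms, of b] by (simp add: case_prod_unfold)
  ultimately show ?thesis unfolding log_double_sine_def ds_const_def case_prod_unfold
    by (intro continuous_intros) (use assms in auto)
next
  case False
  then have "?K = {}" by auto
  then show ?thesis by (simp only: continuous_on_empty)
qed

subsection \<open>Reciprocity\<close>

lemma cmod_1_minus_ee_cong:
  assumes "s - t \<in> \<int> \<or> s + t \<in> \<int>"
  shows "cmod (1 - ee s) = cmod (1 - ee t)"
  using assms
proof
  assume "s - t \<in> \<int>"
  then have "ee (s - t) = 1" by (simp add: ee_eq_1_iff)
  then show ?thesis by (simp add: ee_diff)
next
  assume "s + t \<in> \<int>"
  then have "ee (s + t) = 1" by (simp add: ee_eq_1_iff)
  then have "ee t * ee s = 1" by (simp add: ee_add mult.commute)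
  then have "ee s = ee (- t)" unfolding ee_minus by (rule inverse_unique[symmetric])
  then show ?thesis by (simp add: cmod_1_minus_ee)
qed

lemma cmod_1_minus_ee_squared_exp:
  assumes "0 < t" "t < 1"
  shows "(cmod (1 - ee t))\<^sup>2 = exp (2 * ln (2 * sin (pi * t)))"
proof -
  have s: "sin (pi * t) > 0" using assms by (rule sin_pi_pos)
  have "exp (2 * ln (2 * sin (pi * t))) = (exp (ln (2 * sin (pi * t))))\<^sup>2"
    by (simp add: exp_double)
  also have "exp (ln (2 * sin (pi * t))) = 2 * sin (pi * t)" using s by (intro exp_ln) auto
  finally show ?thesis using s by (simp add: cmod_1_minus_ee)
qed

text \<open>M and v are the integer and fractional parts of N x. A step in N brings a factor 4
  sin^2(pi v), matched by the shift by x. When the step crosses an integer, M grows by 1, and the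
  new factor of \<open>wt (1 / x)\<close> is matched by the shift by 1.\<close>

lemma wt_reciprocity_aux:
  assumes x: "x \<in> \<rat>" "0 < x" "x < 1"
  shows "(\<And>n. 1 \<le> n \<Longrightarrow> n \<le> N \<Longrightarrow> real n * x \<notin> \<int>) \<Longrightarrow> real N * x = real M + v \<Longrightarrow> 0 \<le> v \<Longrightarrow> v < 1 \<Longrightarrow>
    wt x N = wt (1 / x) M * exp (2 * (log_double_sine x x - log_double_sine x (v + x)))"
proof (induction N arbitrary: M v)
  case 0
  then have "M = 0" "v = 0" by auto
  then show ?case by simp
next
  case (Suc N)
  have nint: "real n * x \<notin> \<int>" if "1 \<le> n" "n \<le> N" for n using Suc.prems(1) that by simp
  have v0: "v > 0"
  proof (rule ccontr)
    assume "\<not> v > 0"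
    then have "real (Suc N) * x = of_nat M" using Suc.prems by simp
    then have "real (Suc N) * x \<in> \<int>" by (metis Ints_of_nat)
    then show False using Suc.prems(1)[of "Suc N"] by simp
  qed
  have Nx: "real N * x = real M + v - x" using Suc.prems(2) by (simp add: distrib_right)
  have "cmod (1 - ee (real (Suc N) * x)) = cmod (1 - ee v)"
    unfolding Suc.prems(2) by (rule cmod_1_minus_ee_cong) simp
  then have fx: "(cmod (1 - ee (real (Suc N) * x)))\<^sup>2 = exp (2 * ln (2 * sin (pi * v)))"
    using cmod_1_minus_ee_squared_exp[OF v0 Suc.prems(4)] by simp
  have D1: "log_double_sine x (v + x) = log_double_sine x v - ln (2 * sin (pi * v))"
    using log_double_sine_shift[OF x(2) v0 Suc.prems(4)] .
  show ?case
  proof (cases "v \<ge> x")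
    case True
    have "wt x N = wt (1 / x) M * exp (2 * (log_double_sine x x - log_double_sine x ((v - x) + x)))"
    proof (rule Suc.IH)
      show "real N * x = real M + (v - x)" using Nx by simp
      show "0 \<le> v - x" "v - x < 1" using True Suc.prems(4) x(2) by linarith+
    qed (use nint in auto)
    then have "wt x (Suc N) = wt (1 / x) M * (exp (2 * ln (2 * sin (pi * v))) * exp (2 * (log_double_sine x x - log_double_sine x v)))"
      unfolding wt_Suc fx by simp
    also have "\<dots> = wt (1 / x) M * exp (2 * (log_double_sine x x - log_double_sine x (v + x)))"
      unfolding D1 exp_add[symmetric] by (simp add: algebra_simps)
    finally show ?thesis .
  next
    case False
    have "real N * x \<ge> 0" using x by simp
    then have "real M > 0" using Nx False by linarith
    then obtain M' where M': "M = Suc M'" by (cases M) auto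
    have IH: "wt x N = wt (1 / x) M' * exp (2 * (log_double_sine x x - log_double_sine x ((v + 1 - x) + x)))"
    proof (rule Suc.IH)
      show "real N * x = real M' + (v + 1 - x)" using Nx M' by simp
      show "0 \<le> v + 1 - x" "v + 1 - x < 1" using False v0 x(3) by linarith+
    qed (use nint in auto)
    have D2: "log_double_sine x (v + 1) = log_double_sine x v - ln (2 * sin (pi * v / x))"
      using False by (intro log_double_sine_shift_1 x v0) auto
    have vx: "0 < v / x" "v / x < 1" using v0 False x by auto
    \<comment> \<open>The phases M/x and v/x add up to the integer N + 1, so the new factor depends
      on v/x only.\<close>
    have "real (Suc M') * (1 / x) + v / x = real (Suc N)"
      using Suc.prems(2) M' x by (simp add: field_simps)
    then have "cmod (1 - ee (real (Suc M') * (1 / x))) = cmod (1 - ee (v / x))"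
      by (intro cmod_1_minus_ee_cong disjI2) (metis Ints_of_nat)
    then have fM: "(cmod (1 - ee (real (Suc M') * (1 / x))))\<^sup>2 = exp (2 * ln (2 * sin (pi * v / x)))"
      using cmod_1_minus_ee_squared_exp[OF vx] by simp
    have "wt x (Suc N) = wt (1 / x) M' * (exp (2 * ln (2 * sin (pi * v))) * exp (2 * (log_double_sine x x - log_double_sine x (v + 1))))"
      unfolding wt_Suc fx IH by simp
    also have "exp (2 * ln (2 * sin (pi * v))) * exp (2 * (log_double_sine x x - log_double_sine x (v + 1)))
        = exp (2 * ln (2 * sin (pi * v / x))) * exp (2 * (log_double_sine x x - log_double_sine x (v + x)))"
      unfolding D1 D2 exp_add[symmetric] by (simp add: algebra_simps)
    finally show ?thesis unfolding M' wt_Suc fM by simp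
  qed
qed

text \<open>Both formulas agree on \<open>0 < v < 1\<close>; the second one is continuous up to \<open>v = 1\<close>, where it vanishes.\<close>

definition transfer_wt :: "real \<Rightarrow> real \<Rightarrow> real" where
  "transfer_wt x v = (if v \<le> 1/2 then exp (2 * (log_double_sine x x - log_double_sine x (v + x)))
     else if v \<le> 1 then 4 * (sin (pi * v))\<^sup>2 * exp (2 * (log_double_sine x x - log_double_sine x v)) else 0)"

lemma transfer_wt_eq:
  assumes "0 < x" "v < 1"
  shows "transfer_wt x v = exp (2 * (log_double_sine x x - log_double_sine x (v + x)))"
proof (cases "v \<le> 1/2")
  case False
  then have v: "0 < v" "v < 1" using assms by auto
  have s: "sin (pi * v) > 0" using v by (rule sin_pi_pos)
  have "exp (2 * (log_double_sine x x - log_double_sine x (v + x))) = exp (2 * ln (2 * sin (pi * v))) * exp (2 * (log_double_sine x x - log_double_sine x v))"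
    unfolding log_double_sine_shift[OF assms(1) v] exp_add[symmetric] by (simp add: algebra_simps)
  also have "exp (2 * ln (2 * sin (pi * v))) = 4 * (sin (pi * v))\<^sup>2"
    using cmod_1_minus_ee_squared_exp[OF v] by (simp add: cmod_1_minus_ee power_mult_distrib)
  finally show ?thesis using False v by (simp add: transfer_wt_def)
qed (simp add: transfer_wt_def)

lemma transfer_wt_ge_1: "v \<ge> 1 \<Longrightarrow> transfer_wt x v = 0"
  by (auto simp: transfer_wt_def)

lemma transfer_wt_continuous:
  assumes "0 < a" "b < 1"
  shows "continuous_on ({a..b} \<times> {0..}) (\<lambda>(x, v). transfer_wt x v)"
proof (cases "a \<le> b")
  case True
  \<comment> \<open>All arguments used lie within max x (1 - x) / 2 of the centre (1 + x)/2.
    Relative to the half-width, (1 - x)/(1 + x) is largest at x = a and x/(1 + x) at x = b.\<close>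
  define r where "r = max ((1 - a) / (1 + a)) (b / (1 + b))"
  have r: "r < 1" using assms True by (auto simp: r_def)
  let ?K = "{(x, z). a \<le> x \<and> x \<le> b \<and> \<bar>z - (1 + x) / 2\<bar> \<le> r * ((1 + x) / 2)}"
  have K: "(x, z) \<in> ?K" if "x \<in> {a..b}" "x \<le> z" "z \<le> 1/2 + x \<or> z \<le> 1" "1/2 \<le> z \<or> z \<le> 1/2 + x" for x z 
  proof -
    have x: "0 < x" "a \<le> x" "x \<le> b" using that assms by auto
    have "(1 - x) / (1 + x) \<le> (1 - a) / (1 + a)" using x assms by (intro frac_le) auto
    then have 1: "(1 - x) / (1 + x) \<le> r" by (simp add: r_def)
    have "x / (1 + x) \<le> b / (1 + b)" using x assms by (simp add: field_simps)
    then have 2: "x / (1 + x) \<le> r" by (simp add: r_def)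
    have 1: "(1 - x) / 2 \<le> r * ((1 + x) / 2)" using 1 x by (simp add: field_simps)
    have 2: "x / 2 \<le> r * ((1 + x) / 2)" using 2 x by (simp add: field_simps)
    have "z - (1 + x) / 2 \<le> x / 2 \<or> z - (1 + x) / 2 \<le> (1 - x) / 2" using that by (auto simp: field_simps)
    then have "z - (1 + x) / 2 \<le> max (x / 2) ((1 - x) / 2)" by (simp add: le_max_iff_disj)
    moreover have "- (z - (1 + x) / 2) \<le> (1 - x) / 2" using that by (auto simp: field_simps)
    moreover have "max (x / 2) ((1 - x) / 2) \<le> r * ((1 + x) / 2)" using 1 2 by (rule_tac max.boundedI)
    ultimately have "\<bar>z - (1 + x) / 2\<bar> \<le> r * ((1 + x) / 2)" using 1 by (intro abs_leI) linarith+
    then show ?thesis using x by simp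
  qed
  have K2: "(x, z) \<in> ?K" if "x \<in> {a..b}" "1/2 \<le> z" "z \<le> 1" for x z
  proof (cases "x \<le> z")
    case True
    then show ?thesis using K that by blast
  next
    case False
    then have "(x, z) \<in> ?K \<longleftrightarrow> \<bar>z - (1 + x) / 2\<bar> \<le> r * ((1 + x) / 2)" using that by auto
    moreover have "\<bar>z - (1 + x) / 2\<bar> \<le> x / 2" using that False assms by (auto simp: abs_le_iff field_simps)
    moreover have "x / 2 \<le> r * ((1 + x) / 2)"
    proof -
      have "x / (1 + x) \<le> b / (1 + b)" using that assms by (simp add: field_simps)
      then have "x / (1 + x) \<le> r" by (simp add: r_def)
      then show ?thesis using that assms by (simp add: field_simps)
    qed
    ultimately show ?thesis by simp
  qed
  have lc: "continuous_on ?K (\<lambda>(x, z). log_double_sine x z)" by (rule log_double_sine_continuous[OF assms(1) r])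
  have lcc: "continuous_on S (\<lambda>y. log_double_sine (f y) (g y))"
    if "continuous_on S f" "continuous_on S g" "\<And>y. y \<in> S \<Longrightarrow> (f y, g y) \<in> ?K" for S :: "(real \<times> real) set" and f g
  proof -
    have A: "continuous_on S (\<lambda>y. (f y, g y))" by (intro continuous_on_Pair that)
    have B: "(\<lambda>y. (f y, g y)) ` S \<subseteq> ?K" using that(3) by blast
    show ?thesis using continuous_on_compose2[OF lc A B] by simp
  qed
  have c0: "continuous_on S (\<lambda>y. log_double_sine (fst y) (fst y))" if "S \<subseteq> {a..b} \<times> UNIV" for S :: "(real \<times> real) set"
  proof (rule lcc)
    fix y assume "y \<in> S"
    then have "fst y \<in> {a..b}" using that by auto
    then show "(fst y, fst y) \<in> ?K" using assms(1) by (intro K) auto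
  qed (intro continuous_intros)+
  have c1: "continuous_on {y \<in> {a..b} \<times> {0..}. snd y \<le> 1/2} (\<lambda>y. log_double_sine (fst y) (snd y + fst y))" (is "continuous_on ?S1 _")
    by (rule lcc, (intro continuous_intros)+, rule K) auto
  have c2: "continuous_on {y \<in> {y \<in> {a..b} \<times> {0..}. 1/2 \<le> snd y}. snd y \<le> 1} (\<lambda>y. log_double_sine (fst y) (snd y))" (is "continuous_on ?S2 _")
    by (rule lcc, (intro continuous_intros)+, rule K2) auto
  have s2: "continuous_on {y \<in> {a..b} \<times> {0..}. 1/2 \<le> snd y} 
     (\<lambda>y. if snd y \<le> 1 then 4 * (sin (pi * snd y))\<^sup>2 * exp (2 * (log_double_sine (fst y) (fst y) - log_double_sine (fst y) (snd y))) else 0)"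
  proof (rule continuous_on_cases_le)
    show "continuous_on ?S2 (\<lambda>y. 4 * (sin (pi * snd y))\<^sup>2 * exp (2 * (log_double_sine (fst y) (fst y) - log_double_sine (fst y) (snd y))))"
      by (intro continuous_intros c2 c0) auto
  qed (auto intro!: continuous_intros)
  have "continuous_on ({a..b} \<times> {0..}) (\<lambda>y. if snd y \<le> 1/2 then exp (2 * (log_double_sine (fst y) (fst y) - log_double_sine (fst y) (snd y + fst y)))
     else if snd y \<le> 1 then 4 * (sin (pi * snd y))\<^sup>2 * exp (2 * (log_double_sine (fst y) (fst y) - log_double_sine (fst y) (snd y))) else 0)"
  proof (rule continuous_on_cases_le)
    show "continuous_on ?S1 (\<lambda>y. exp (2 * (log_double_sine (fst y) (fst y) - log_double_sine (fst y) (snd y + fst y))))"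
      by (intro continuous_intros c1 c0) auto
    show "continuous_on {y \<in> {a..b} \<times> {0..}. 1/2 \<le> snd y} 
      (\<lambda>y. if snd y \<le> 1 then 4 * (sin (pi * snd y))\<^sup>2 * exp (2 * (log_double_sine (fst y) (fst y) - log_double_sine (fst y) (snd y))) else 0)"
      by (rule s2)
    \<comment> \<open>The two formulas meet at v = 1/2, where 2 sin(pi v) = 2 accounts for the
      factor 4.\<close>
    fix y :: "real \<times> real" assume y: "y \<in> {a..b} \<times> {0..}" "snd y = 1/2"
    have "log_double_sine (fst y) (1/2 + fst y) = log_double_sine (fst y) (1/2) - ln (2 * sin (pi * (1/2)))"
      using y assms by (intro log_double_sine_shift) auto
    then show "exp (2 * (log_double_sine (fst y) (fst y) - log_double_sine (fst y) (snd y + fst y))) = 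
      (if snd y \<le> 1 then 4 * (sin (pi * snd y))\<^sup>2 * exp (2 * (log_double_sine (fst y) (fst y) - log_double_sine (fst y) (snd y))) else 0)"
      unfolding y(2) by (simp add: right_diff_distrib exp_diff exp_double exp_add)
  qed (auto intro!: continuous_intros)
  then show ?thesis by (simp add: transfer_wt_def case_prod_unfold)
qed simp

text \<open>The terms with \<open>(i - t) x \<ge> 1\<close> vanish, so \<open>I\<close> is immaterial once it is large; a fixed \<open>I\<close> serves all \<open>x\<close> near \<open>\<alpha>\<close>.\<close>

definition transfer_sum :: "nat \<Rightarrow> real \<Rightarrow> real \<Rightarrow> real" where
  "transfer_sum I x t = (\<Sum>i=1..I. transfer_wt x ((real i - t) * x))"

lemma transfer_sum_continuous:
  assumes "0 < a" "b < 1"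
  shows "continuous_on ({a..b} \<times> {0..1}) (\<lambda>(x, t). transfer_sum I x t)"
proof -
  have "continuous_on ({a..b} \<times> {0..1}) (\<lambda>y. transfer_wt (fst y) ((real i - snd y) * fst y))" if "i \<in> {1..I}" for i
  proof -
    have A: "continuous_on ({a..b} \<times> {0..1}) (\<lambda>y::real\<times>real. (fst y, (real i - snd y) * fst y))"
      by (intro continuous_intros)
    have B: "(\<lambda>y. (fst y, (real i - snd y) * fst y)) ` ({a..b} \<times> {0..1}) \<subseteq> {a..b} \<times> {0..}"
      using that assms by (auto intro!: mult_nonneg_nonneg)
    show ?thesis using continuous_on_compose2[OF transfer_wt_continuous[OF assms] A B] by simp
  qed
  then show ?thesis unfolding transfer_sum_def case_prod_unfold by (intro continuous_on_sum)
qed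

text \<open>The summand \<open>1\<close> is the term \<open>i = 0\<close>, which occurs for \<open>M = 0\<close> only.\<close>

lemma J41_reciprocity:
  assumes x: "x \<in> \<rat>" "0 < x" "x < 1" and I: "real I \<ge> 1 / x + 1"
  obtains p where "p > 0" "real p * (1 / x) \<in> \<int>"
    "J41 x = (\<Sum>M<p. wt (1 / x) M * transfer_sum I x (frac (real M / x))) + 1"
proof -
  obtain q a where qa: "q > 0" "coprime a (int q)" "x = of_int a / real q" "real q * x \<in> \<int>"
    using rational_denominator[OF x(1)] by metis
  have "a > 0" using qa x by (simp add: zero_less_divide_iff)
  define p where "p = nat a"
  have p: "p > 0" "coprime p q" "x = real p / real q"
    using \<open>a > 0\<close> qa by (auto simp: p_def simp flip: coprime_int_iff)
  have pq: "p < q" using x(3) p qa(1) by simp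
  have ix: "1 / x = real q / real p" using p by simp
  have nint: "real n * x \<notin> \<int>" if "1 \<le> n" "n < q" for n
  proof
    assume "real n * x \<in> \<int>"
    then obtain k where "real n * x = of_int k" by (auto elim: Ints_cases)
    then have "real n * real p = of_int k * real q" using p qa(1) by (simp add: field_simps)
    then have "of_int (int (n * p)) = (of_int (k * int q) :: real)" by simp
    then have "int q dvd int (n * p)" by (metis of_int_eq_iff dvd_triv_right)
    then have "q dvd n * p" by (simp only: int_dvd_int_iff)
    then have "q dvd n" using p(2) by (metis coprime_commute coprime_dvd_mult_left_iff)
    then show False using that by (auto dest: dvd_imp_le)
  qed
  define fl where "fl N = nat \<lfloor>real N * x\<rfloor>" for N :: nat
  have fl: "real (fl N) \<le> real N * x" "real N * x < real (fl N) + 1" for N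
  proof -
    have "real N * x \<ge> 0" using x by simp
    then have "real (fl N) = of_int \<lfloor>real N * x\<rfloor>" by (simp add: fl_def)
    then show "real (fl N) \<le> real N * x" "real N * x < real (fl N) + 1" by linarith+
  qed
  have fl_unique: "fl N = M" if "real M \<le> real N * x" "real N * x < real M + 1" for N M
    using that fl[of N] by linarith
  have fl_less: "fl N < p" if "N < q" for N
  proof -
    have "real N * x < real q * x" using that x by (intro mult_strict_right_mono) auto
    also have "\<dots> = real p" using p qa(1) by simp
    finally show ?thesis using fl(1)[of N] by linarith
  qed
  have "J41 x = (\<Sum>N<q. wt x N)" by (rule J41_eq_sum) (use qa in auto)
  also have "\<dots> = (\<Sum>N<q. wt (1 / x) (fl N) * transfer_wt x (real N * x - real (fl N)))"
  proof (intro sum.cong refl)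
    fix N assume N: "N \<in> {..<q}"
    have "wt x N = wt (1 / x) (fl N) * exp (2 * (log_double_sine x x - log_double_sine x ((real N * x - real (fl N)) + x)))"
      by (rule wt_reciprocity_aux[OF x]) (use nint N fl[of N] in auto)
    also have "exp (2 * (log_double_sine x x - log_double_sine x ((real N * x - real (fl N)) + x))) = transfer_wt x (real N * x - real (fl N))"
      using fl(2)[of N] by (subst transfer_wt_eq) (use x in auto)
    finally show "wt x N = wt (1 / x) (fl N) * transfer_wt x (real N * x - real (fl N))" .
  qed
  also have "\<dots> = (\<Sum>M<p. \<Sum>N | N \<in> {..<q} \<and> fl N = M. wt (1 / x) (fl N) * transfer_wt x (real N * x - real (fl N)))"
    using fl_less by (intro sum.group[symmetric]) auto
  also have "\<dots> = (\<Sum>M<p. wt (1 / x) M * transfer_sum I x (frac (real M / x)) + (if M = 0 then 1 else 0))"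
  proof (intro sum.cong refl)
    fix M assume "M \<in> {..<p}"
    then have M: "M < p" by simp
    define S where "S = {N. real M \<le> real N * x \<and> real N * x < real M + 1}"
    have S_eq: "{N. N \<in> {..<q} \<and> fl N = M} = S"
    proof (intro set_eqI iffI)
      fix N assume "N \<in> S"
      then have N: "real M \<le> real N * x" "real N * x < real M + 1" by (auto simp: S_def)
      have "real N * x < real q * x" using N M p qa(1) by simp
      then have "N < q" using x by simp
      then show "N \<in> {N. N \<in> {..<q} \<and> fl N = M}" using fl_unique[OF N] by simp
    qed (use fl in \<open>auto simp: S_def\<close>)
    then have finS: "finite S" by (metis (no_types, lifting) finite_lessThan finite_subset mem_Collect_eq subsetI)
    \<comment> \<open>k is the last N with N x \<le> M, so the members of S other than k are of the
      form k + i with i \<ge> 1. For them N x - M = (i - frac (M/x)) x, a function of the point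
      e(M/x) of the Gibbs measure.\<close>
    define k where "k = nat \<lfloor>real M / x\<rfloor>"
    have "real M / x \<ge> 0" using x by simp
    then have k: "real k = of_int \<lfloor>real M / x\<rfloor>" by (simp add: k_def)
    then have kf: "frac (real M / x) = real M / x - real k" by (simp add: frac_def)
    have shift: "(real i - frac (real M / x)) * x = real (k + i) * x - real M" for i
      unfolding kf using x by (simp add: algebra_simps)
    have kx: "real k * x \<le> real M"
    proof -
      have "real k \<le> real M / x" using k by linarith
      then show ?thesis using x by (simp add: field_simps)
    qed
    \<comment> \<open>For M > 0, membership would give k x = M with 0 < k < q, against
      \<open>nint\<close>.\<close>
    have kS: "k \<in> S \<longleftrightarrow> M = 0"
    proof
      assume "k \<in> S"
      then have "real k * x = real M" using kx by (simp add: S_def)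
      then have "real k * x \<in> \<int>" by simp
      moreover have "k < q" using \<open>k \<in> S\<close> S_eq by auto
      ultimately have "k = 0" using nint[of k] by (cases k) auto
      then show "M = 0" using \<open>real k * x = real M\<close> by simp
    qed (simp add: S_def k_def)
    have Sk: "N \<ge> k" if "N \<in> S" for N
    proof -
      have "real k * x \<le> real N * x" using kx that by (simp add: S_def)
      then show ?thesis using x by simp
    qed
    have "transfer_sum I x (frac (real M / x)) = (\<Sum>i=1..I. transfer_wt x (real (k + i) * x - real M))"
      unfolding transfer_sum_def shift ..
    also have "\<dots> = (\<Sum>i | i \<in> {1..I} \<and> real (k + i) * x - real M < 1. transfer_wt x (real (k + i) * x - real M))"
      by (intro sum.mono_neutral_right) (auto intro!: transfer_wt_ge_1)
    also have "\<dots> = (\<Sum>N\<in>S - {k}. transfer_wt x (real N * x - real M))"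
    proof (rule sum.reindex_bij_witness[where i = "\<lambda>N. N - k" and j = "\<lambda>i. k + i"])
      fix i assume i: "i \<in> {i \<in> {1..I}. real (k + i) * x - real M < 1}"
      have "(1 - frac (real M / x)) * x \<le> (real i - frac (real M / x)) * x"
        using i x by (intro mult_right_mono) auto
      moreover have "0 \<le> (1 - frac (real M / x)) * x"
        using x frac_lt_1[of "real M / x"] by (intro mult_nonneg_nonneg) auto
      ultimately have "0 \<le> real (k + i) * x - real M" unfolding shift by simp
      then show "k + i \<in> S - {k}" using i by (auto simp: S_def)
    next
      fix N assume N: "N \<in> S - {k}"
      then have "k < N" using Sk[of N] by auto
      \<comment> \<open>N < M/x + 1/x < k + 1 + 1/x; this is the origin of the lower bound on
        I.\<close>
      moreover have "real N - real k \<le> real I"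
      proof -
        have "real N * x < real M + 1" using N by (simp add: S_def)
        then have "real N < real M / x + 1 / x" using x by (simp add: field_simps)
        moreover have "real M / x < real k + 1" using k by linarith
        ultimately show ?thesis using I by linarith
      qed
      ultimately show "N - k \<in> {i \<in> {1..I}. real (k + i) * x - real M < 1}" "k + (N - k) = N"
        using N by (auto simp: S_def)
    qed auto
    finally have ts: "transfer_sum I x (frac (real M / x)) = (\<Sum>N\<in>S - {k}. transfer_wt x (real N * x - real M))" .
    have "(\<Sum>N\<in>S. transfer_wt x (real N * x - real M)) = transfer_sum I x (frac (real M / x)) + (if M = 0 then 1 else 0)"
    proof (cases "M = 0")
      case True
      then have "k = 0" by (simp add: k_def)
      have "(\<Sum>N\<in>S. transfer_wt x (real N * x - real M)) = transfer_wt x (real k * x - real M) + (\<Sum>N\<in>S - {k}. transfer_wt x (real N * x - real M))"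
        using finS kS True by (intro sum.remove) auto
      then show ?thesis using True \<open>k = 0\<close> unfolding ts by (simp add: transfer_wt_def)
    next
      case False
      then show ?thesis using kS unfolding ts by simp
    qed
    moreover have "(\<Sum>N | N \<in> {..<q} \<and> fl N = M. wt (1 / x) (fl N) * transfer_wt x (real N * x - real (fl N)))
       = wt (1 / x) M * (\<Sum>N\<in>S. transfer_wt x (real N * x - real M))"
      unfolding sum_distrib_left S_eq[symmetric] by (intro sum.cong) auto
    ultimately show "(\<Sum>N | N \<in> {..<q} \<and> fl N = M. wt (1 / x) (fl N) * transfer_wt x (real N * x - real (fl N)))
       = wt (1 / x) M * transfer_sum I x (frac (real M / x)) + (if M = 0 then 1 else 0)"
      by (simp add: distrib_left)
  qed
  also have "\<dots> = (\<Sum>M<p. wt (1 / x) M * transfer_sum I x (frac (real M / x))) + 1"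
    using p(1) by (simp add: sum.distrib)
  finally show ?thesis using that[of p] p(1) unfolding ix by simp
qed

subsection \<open>The limit for well approximable numbers\<close>

lemma gibbs_lower_bound:
  assumes "y \<in> \<rat>" "\<And>z. cmod z = 1 \<Longrightarrow> f z \<ge> m"
  shows "Re (gibbs y (\<lambda>z. of_real (f z))) \<ge> m"
proof -
  obtain d where d: "d > 0" "real d * y \<in> \<int>" using rational_denominator[OF assms(1)] by metis
  have J: "J41 y \<ge> 1" using J41_ge_1[OF assms(1)] .
  have "gibbs y (\<lambda>z. of_real (f z)) = of_real ((\<Sum>n<d. wt y n * f (ee (real n * y))) / J41 y)"
    unfolding gibbs_eq_sum[OF d] by simp
  moreover have "m * J41 y \<le> (\<Sum>n<d. wt y n * f (ee (real n * y)))"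
    unfolding J41_eq_sum[OF d] sum_distrib_left
    by (intro sum_mono) (auto simp: mult.commute[of m] intro!: mult_left_mono assms(2))
  ultimately show ?thesis using J by (simp add: pos_le_divide_eq)
qed

text \<open>The transfer function is frozen at x = \<alpha>, so that convergence of Gibbs
  expectations of a fixed function applies. Positivity of the limit makes its logarithm
  finite.\<close>

lemma J41_quotient_tendsto:
  assumes \<alpha>: "\<alpha> \<notin> \<rat>" "0 < \<alpha>" "\<alpha> < 1" and wa: "well_approx (1 / \<alpha>)"
  shows "\<exists>l>0. ((\<lambda>x. J41 x / J41 (1 / x)) \<longlongrightarrow> l) (at \<alpha> within \<rat> - {0})"
proof -
  define \<beta> where "\<beta> = 1 / \<alpha>"
  have irr: "\<beta> \<notin> \<rat>"
  proof
    assume "\<beta> \<in> \<rat>"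
    then have "1 / \<beta> \<in> \<rat>" by (intro Rats_divide) auto
    then show False using \<alpha> by (simp add: \<beta>_def)
  qed
  interpret unique_gibbs \<beta> by unfold_locales (use irr wa in \<open>auto simp: \<beta>_def\<close>)
  let ?F = "at \<alpha> within \<rat> - {0}"
  have nontriv: "?F \<noteq> bot"
  proof -
    have "\<alpha> islimpt (\<rat> - {0})" unfolding islimpt_approachable
    proof (intro allI impI)
      fix e :: real assume "e > 0"
      then obtain r where r: "r \<in> \<rat>" "\<alpha> < r" "r < \<alpha> + e" using Rats_dense_in_real[of \<alpha> "\<alpha> + e"] by auto
      then show "\<exists>x'\<in>\<rat> - {0}. x' \<noteq> \<alpha> \<and> dist x' \<alpha> < e" using \<alpha> by (intro bexI[of _ r]) (auto simp: dist_real_def)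
    qed
    then show ?thesis by (simp add: trivial_limit_within)
  qed
  \<comment> \<open>[a, b] is a compact neighbourhood of \<alpha> inside (0, 1), on which one number
    I of terms suffices.\<close>
  define a where "a = \<alpha> / 2"
  define b where "b = (1 + \<alpha>) / 2"
  have ab: "0 < a" "b < 1" "a < \<alpha>" "\<alpha> < b" using \<alpha> by (auto simp: a_def b_def)
  define I where "I = nat \<lceil>1 / a + 1\<rceil>"
  have I: "real I \<ge> 1 / a + 1" unfolding I_def by (rule of_nat_ceiling)
  define H where "H = transfer_sum I"
  define K where "K = {a..b} \<times> {0..1::real}"
  have contH: "continuous_on K (\<lambda>(x, t). H x t)"
    unfolding H_def K_def by (rule transfer_sum_continuous[OF ab(1,2)])
  have contH\<alpha>: "continuous_on {0..1} (H \<alpha>)"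
    using continuous_on_compose2[OF contH, of "{0..1}" "\<lambda>t. (\<alpha>, t)"] ab by (force simp: K_def intro!: continuous_intros)
  define G where "G y = gibbs y (\<lambda>z. of_real (H \<alpha> (Arg2pi z / (2 * pi))))" for y
  obtain l where "(G \<longlongrightarrow> l) (at \<beta> within \<rat>)"
    using conv_discontinuous_at_1[OF contH\<alpha>] unfolding conv_def G_def by blast
  moreover have inv: "filterlim (\<lambda>x. 1 / x) (at \<beta> within \<rat>) ?F"
    unfolding filterlim_at
  proof
    show "((\<lambda>x. 1 / x) \<longlongrightarrow> \<beta>) ?F" unfolding \<beta>_def using \<alpha> by (intro tendsto_intros) auto
    have "1 / x \<noteq> \<beta>" if "x \<noteq> \<alpha>" "x \<noteq> 0" for x using that \<alpha> by (simp add: \<beta>_def field_simps)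
    then show "eventually (\<lambda>x. 1 / x \<in> \<rat> \<and> 1 / x \<noteq> \<beta>) ?F"
      unfolding eventually_at_filter by (intro always_eventually) auto
  qed
  ultimately have Gl: "((\<lambda>x. G (1 / x)) \<longlongrightarrow> l) ?F" by (rule filterlim_compose)
  have invJ: "((\<lambda>x. 1 / J41 (1 / x)) \<longlongrightarrow> 0) ?F"
    using inverse_J41_tendsto_0 inv by (rule filterlim_compose)
  have evx: "eventually (\<lambda>x. x \<in> \<rat> \<and> a < x \<and> x < b) ?F"
  proof -
    have "eventually (\<lambda>x. a < x) ?F" by (rule order_tendstoD(1)[OF tendsto_ident_at ab(3)])
    moreover have "eventually (\<lambda>x. x < b) ?F" by (rule order_tendstoD(2)[OF tendsto_ident_at ab(4)])
    moreover have "eventually (\<lambda>x. x \<in> \<rat>) ?F" by (simp add: eventually_at_filter)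
    ultimately show ?thesis by eventually_elim auto
  qed
  \<comment> \<open>Two errors: uniform continuity of H on K controls the change from x to \<alpha>,
    and the isolated summand 1 contributes 1/J.\<close>
  have diff: "((\<lambda>x. complex_of_real (J41 x / J41 (1 / x)) - G (1 / x)) \<longlongrightarrow> 0) ?F"
    unfolding tendsto_iff
  proof (intro allI impI)
    fix e :: real assume e: "e > 0"
    have "uniformly_continuous_on K (\<lambda>(x, t). H x t)"
      using contH by (rule compact_uniformly_continuous) (simp add: K_def compact_Times)
    then obtain \<delta> where \<delta>: "\<delta> > 0" "\<And>y y'. y \<in> K \<Longrightarrow> y' \<in> K \<Longrightarrow> dist y' y < \<delta> \<Longrightarrow> dist ((\<lambda>(x, t). H x t) y') ((\<lambda>(x, t). H x t) y) < e / 2"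
      unfolding uniformly_continuous_on_def using e half_gt_zero by metis
    have "eventually (\<lambda>x. dist x \<alpha> < \<delta>) ?F" using \<delta>(1) by (intro tendstoD tendsto_ident_at)
    moreover have "eventually (\<lambda>x. 1 / J41 (1 / x) < e / 2) ?F"
      using e by (intro order_tendstoD(2)[OF invJ]) auto
    ultimately show "eventually (\<lambda>x. dist (complex_of_real (J41 x / J41 (1 / x)) - G (1 / x)) 0 < e) ?F"
      using evx
    proof eventually_elim
      case (elim x)
      have x: "x \<in> \<rat>" "0 < x" "x < 1" "a < x" "x < b" using elim ab by auto
      have "1 / x \<le> 1 / a" using x ab by (intro divide_left_mono) auto
      then have "real I \<ge> 1 / x + 1" using I by linarith
      then obtain p where p: "p > 0" "real p * (1 / x) \<in> \<int>"
        "J41 x = (\<Sum>M<p. wt (1 / x) M * H x (frac (real M / x))) + 1"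
        using J41_reciprocity[OF x(1-3)] unfolding H_def by metis
      have ixr: "1 / x \<in> \<rat>" using x by (intro Rats_divide) auto
      have J: "J41 (1 / x) \<ge> 1" using J41_ge_1[OF ixr] .
      have Geq: "G (1 / x) = of_real ((\<Sum>M<p. wt (1 / x) M * H \<alpha> (frac (real M / x))) / J41 (1 / x))"
        unfolding G_def gibbs_eq_sum[OF p(1,2)] Arg2pi_ee by simp
      have "J41 x / J41 (1 / x) - (\<Sum>M<p. wt (1 / x) M * H \<alpha> (frac (real M / x))) / J41 (1 / x)
          = (\<Sum>M<p. wt (1 / x) M * (H x (frac (real M / x)) - H \<alpha> (frac (real M / x)))) / J41 (1 / x) + 1 / J41 (1 / x)"
        unfolding p(3) by (simp add: right_diff_distrib sum_subtractf add_divide_distrib diff_divide_distrib)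
      moreover have "\<bar>(\<Sum>M<p. wt (1 / x) M * (H x (frac (real M / x)) - H \<alpha> (frac (real M / x)))) / J41 (1 / x)\<bar> \<le> e / 2"
      proof -
        have "\<bar>\<Sum>M<p. wt (1 / x) M * (H x (frac (real M / x)) - H \<alpha> (frac (real M / x)))\<bar> \<le> (\<Sum>M<p. wt (1 / x) M * (e / 2))"
        proof (rule order_trans[OF sum_abs], rule sum_mono)
          fix M
          have "dist (x, frac (real M / x)) (\<alpha>, frac (real M / x)) < \<delta>"
            using elim(1) by (simp add: dist_Pair_Pair)
          then have "\<bar>H x (frac (real M / x)) - H \<alpha> (frac (real M / x))\<bar> \<le> e / 2"
            using \<delta>(2)[of "(\<alpha>, frac (real M / x))" "(x, frac (real M / x))"] x ab frac_lt_1[of "real M / x"]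
            by (auto simp: K_def dist_real_def less_imp_le)
          then show "\<bar>wt (1 / x) M * (H x (frac (real M / x)) - H \<alpha> (frac (real M / x)))\<bar> \<le> wt (1 / x) M * (e / 2)"
            unfolding abs_mult abs_of_nonneg[OF wt_nonneg] by (rule mult_left_mono) simp
        qed
        also have "\<dots> = J41 (1 / x) * (e / 2)" unfolding J41_eq_sum[OF p(1,2)] sum_distrib_right ..
        finally show ?thesis using J by (simp add: abs_divide pos_divide_le_eq mult.commute)
      qed
      moreover have "1 / J41 (1 / x) > 0" using J by simp
      ultimately have "\<bar>J41 x / J41 (1 / x) - (\<Sum>M<p. wt (1 / x) M * H \<alpha> (frac (real M / x))) / J41 (1 / x)\<bar> < e"
        using elim(2) by linarith
      then show ?case unfolding Geq dist_norm diff_0_right of_real_diff[symmetric] norm_of_real .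
    qed
  qed
  from tendsto_add[OF diff Gl] have lim: "((\<lambda>x. complex_of_real (J41 x / J41 (1 / x))) \<longlongrightarrow> l) ?F" by simp
  then have limRe: "((\<lambda>x. J41 x / J41 (1 / x)) \<longlongrightarrow> Re l) ?F"
    using tendsto_Re by fastforce
  have "Re l > 0"
  proof -
    \<comment> \<open>The term i = 1 suffices: its argument (1 - t) \<alpha> stays below 1, where
      \<open>transfer_wt\<close> is an exponential. Compactness then bounds all the expectations
      below by one positive number.\<close>
    have Hpos: "H \<alpha> t > 0" if "t \<in> {0..1}" for t
    proof -
      have "transfer_wt \<alpha> ((real 1 - t) * \<alpha>) > 0"
      proof -
        have "(1 - t) * \<alpha> \<le> 1 * \<alpha>" using that \<alpha> by (intro mult_right_mono) auto
        then have "(1 - t) * \<alpha> < 1" using \<alpha>(3) by linarith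
        then show ?thesis using \<alpha>(2) by (subst transfer_wt_eq) auto
      qed
      also have "transfer_wt \<alpha> ((real 1 - t) * \<alpha>) \<le> H \<alpha> t"
        unfolding H_def transfer_sum_def
      proof (rule member_le_sum)
        have "real I \<ge> 1" using I ab by (smt (verit) divide_nonneg_pos)
        then show "1 \<in> {1..I}" by simp
      qed (auto simp: transfer_wt_def)
      finally show ?thesis .
    qed
    obtain t0 where t0: "t0 \<in> {0..1}" "\<And>t. t \<in> {0..1} \<Longrightarrow> H \<alpha> t0 \<le> H \<alpha> t"
      using continuous_attains_inf[of "{0..1}" "H \<alpha>"] contH\<alpha> by auto
    have "Arg2pi z / (2 * pi) \<in> {0..1}" for z using Arg2pi[of z] by (auto simp: field_simps)
    then have "Re (G y) \<ge> H \<alpha> t0" if "y \<in> \<rat>" for y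
      unfolding G_def using t0(2) that by (intro gibbs_lower_bound) auto
    then have ev: "eventually (\<lambda>x. H \<alpha> t0 \<le> Re (G (1 / x))) ?F"
      unfolding eventually_at_filter by (intro always_eventually) auto
    have "H \<alpha> t0 \<le> Re l"
      by (rule tendsto_lowerbound[OF tendsto_Re[OF Gl] ev nontriv])
    then show ?thesis using Hpos[OF t0(1)] by linarith
  qed
  with limRe show ?thesis by blast
qed

lemma h_tendsto_unit_interval:
  assumes "\<alpha> \<notin> \<rat>" "0 < \<alpha>" "\<alpha> < 1" "well_approx (1 / \<alpha>)"
  shows "\<exists>L. (h \<longlongrightarrow> L) (at \<alpha> within \<rat> - {0})"
proof -
  obtain l where l: "l > 0" "((\<lambda>x. J41 x / J41 (1 / x)) \<longlongrightarrow> l) (at \<alpha> within \<rat> - {0})"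
    using J41_quotient_tendsto[OF assms] by blast
  then have "((\<lambda>x. ln (J41 x / J41 (1 / x))) \<longlongrightarrow> ln l) (at \<alpha> within \<rat> - {0})"
    by (intro tendsto_ln) auto
  then show ?thesis unfolding h_def by blast
qed

section \<open>Symmetries of \<open>h\<close> and reduction to the unit interval\<close>

lemma h_minus: "h (- x) = h x"
  by (simp add: h_def J41_minus)

lemma h_inverse: 
  assumes "x \<in> \<rat>"
  shows "h x = - h (1 / x)"
proof -
  have "1 / x \<in> \<rat>" using assms by (intro Rats_divide) auto
  then have "J41 x \<ge> 1" "J41 (1 / x) \<ge> 1" using J41_ge_1 assms by auto
  then show ?thesis by (simp add: h_def ln_div)
qed

lemma irrational_inverse: "\<alpha> \<notin> \<rat> \<Longrightarrow> 1 / \<alpha> \<notin> (\<rat> :: real set)"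
  using Rats_divide[of 1 "1 / \<alpha>"] by auto

text \<open>The scaled error p^2 |1/\<beta> - q/p| is q^2 |\<beta> - p/q| times p/(\<beta> q), and
  the last quotient is at most 3/2 once p/q is close to \<beta>.\<close>

lemma well_approx_inverse:
  assumes "\<beta> > 0" "well_approx \<beta>"
  shows "well_approx (1 / \<beta>)"
  unfolding well_approx_def
proof (intro allI impI)
  fix a :: real assume a: "a > 0"
  \<comment> \<open>2/\<beta> puts p/q within \<beta>/2 of \<beta>, hence p > 0 and p \<le> (3/2)
    \<beta> q; 2a covers the factor 3/2.\<close>
  define a0 where "a0 = max (2 / \<beta>) (2 * a)"
  have a0: "a0 > 0" "a0 \<ge> 2 / \<beta>" "a0 \<ge> 2 * a" using assms a by (auto simp: a0_def)
  obtain p :: int and q :: nat where q: "q > 0" and app: "\<bar>\<beta> - p / q\<bar> \<le> 1 / (a0 * (real q)\<^sup>2)"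
    using assms(2) a0(1) unfolding well_approx_def by blast
  have "1 / (a0 * (real q)\<^sup>2) \<le> 1 / a0"
  proof -
    have "1 \<le> (real q)\<^sup>2" using q by (simp add: one_le_power)
    then have "a0 * 1 \<le> a0 * (real q)\<^sup>2" using a0 by (intro mult_left_mono) auto
    then show ?thesis using a0 q by (intro divide_left_mono) auto
  qed
  also have "1 / a0 \<le> \<beta> / 2" using a0 assms(1) by (simp add: field_simps)
  finally have bd: "\<bar>\<beta> - p / q\<bar> \<le> \<beta> / 2" using app by linarith
  then have pq: "\<beta> / 2 \<le> p / q" "p / q \<le> 3 / 2 * \<beta>" by linarith+
  have "real_of_int p / real q > 0" using pq(1) assms(1) by linarith
  then have p: "p > 0" using q by (simp add: zero_less_divide_iff)
  define P where "P = real_of_int p"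
  define Q where "Q = real q"
  have PQ: "P > 0" "Q > 0" using p q by (simp_all add: P_def Q_def)
  have P2: "P \<le> 3 / 2 * \<beta> * Q" using pq(2) PQ unfolding P_def[symmetric] Q_def[symmetric] by (simp add: field_simps)
  have "1 / \<beta> - Q / P = (P / Q - \<beta>) * (Q / (\<beta> * P))"
    using PQ assms(1) by (simp add: field_simps)
  then have "\<bar>1 / \<beta> - Q / P\<bar> = \<bar>\<beta> - P / Q\<bar> * (Q / (\<beta> * P))"
    using PQ assms(1) by (simp add: abs_mult abs_minus_commute)
  also have "\<dots> \<le> 1 / (a0 * Q\<^sup>2) * (Q / (\<beta> * P))"
    using app PQ assms(1) by (intro mult_right_mono) (auto simp: P_def Q_def)
  also have "\<dots> = 1 / (a0 * \<beta> * Q * P)" using PQ by (simp add: power2_eq_square)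
  also have "\<dots> \<le> 1 / (a * P\<^sup>2)"
  proof (intro divide_left_mono)
    have "a * P \<le> a * (3 / 2 * \<beta> * Q)" using P2 a by (intro mult_left_mono) auto
    also have "\<dots> \<le> (2 * a) * (\<beta> * Q)" using a assms(1) PQ by simp
    also have "\<dots> \<le> a0 * (\<beta> * Q)" using a0 assms(1) PQ by (intro mult_right_mono) auto
    finally have "a * P * P \<le> a0 * (\<beta> * Q) * P" using PQ by (intro mult_right_mono) auto
    then show "a * P\<^sup>2 \<le> a0 * \<beta> * Q * P" by (simp add: power2_eq_square mult_ac)
  qed (use a a0 PQ assms(1) in \<open>auto intro!: mult_pos_pos\<close>)
  finally have "\<bar>1 / \<beta> - of_int (int q) / real (nat p)\<bar> \<le> 1 / (a * (real (nat p))\<^sup>2)"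
    using p by (simp add: P_def Q_def)
  then show "\<exists>(p::int) (q::nat). q > 0 \<and> \<bar>1 / \<beta> - p / q\<bar> \<le> 1 / (a * (real q)\<^sup>2)"
    using p by (intro exI[of _ "int q"] exI[of _ "nat p"]) auto
qed

lemma well_approx_minus:
  assumes "well_approx \<beta>"
  shows "well_approx (- \<beta>)"
  unfolding well_approx_def
proof (intro allI impI)
  fix a :: real assume a: "a > 0"
  obtain p :: int and q :: nat where q: "q > 0" and app: "\<bar>\<beta> - p / q\<bar> \<le> 1 / (a * (real q)\<^sup>2)"
    using assms a unfolding well_approx_def by blast
  then show "\<exists>(p::int) (q::nat). q > 0 \<and> \<bar>- \<beta> - p / q\<bar> \<le> 1 / (a * (real q)\<^sup>2)"
    by (intro exI[of _ "- p"] exI[of _ q]) (auto simp: abs_minus_commute)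
qed

text \<open>For \<alpha> > 1 the antisymmetry h x = - h (1/x) moves the limit point to 1/\<alpha>,
  which lies in the unit interval.\<close>

lemma h_tendsto_pos:
  assumes "\<alpha> \<notin> \<rat>" "0 < \<alpha>" "well_approx \<alpha>"
  shows "\<exists>L. (h \<longlongrightarrow> L) (at \<alpha> within \<rat> - {0})"
proof (cases "\<alpha> < 1")
  case True
  then show ?thesis using h_tendsto_unit_interval[OF assms(1,2)] well_approx_inverse assms by blast
next
  case False
  have "\<alpha> \<noteq> 1" using assms(1) by auto
  then have \<alpha>: "\<alpha> > 1" using False by simp
  obtain L where L: "(h \<longlongrightarrow> L) (at (1 / \<alpha>) within \<rat> - {0})"
    using h_tendsto_unit_interval[of "1 / \<alpha>"] irrational_inverse[OF assms(1)] \<alpha> assms(3) by auto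
  have "filterlim (\<lambda>x. 1 / x) (at (1 / \<alpha>) within \<rat> - {0}) (at \<alpha> within \<rat> - {0})"
    unfolding filterlim_at
  proof
    show "((\<lambda>x. 1 / x) \<longlongrightarrow> 1 / \<alpha>) (at \<alpha> within \<rat> - {0})" using \<alpha> by (intro tendsto_intros) auto
    have "1 / x \<noteq> 1 / \<alpha>" if "x \<noteq> \<alpha>" "x \<noteq> 0" for x using that \<alpha> by (simp add: field_simps)
    then show "eventually (\<lambda>x. 1 / x \<in> \<rat> - {0} \<and> 1 / x \<noteq> 1 / \<alpha>) (at \<alpha> within \<rat> - {0})"
      unfolding eventually_at_filter by (intro always_eventually) auto
  qed
  from tendsto_minus[OF filterlim_compose[OF L this]]
  have "((\<lambda>x. - h (1 / x)) \<longlongrightarrow> - L) (at \<alpha> within \<rat> - {0})" .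
  then have "(h \<longlongrightarrow> - L) (at \<alpha> within \<rat> - {0})"
  proof (rule Lim_transform_eventually)
    show "eventually (\<lambda>x. - h (1 / x) = h x) (at \<alpha> within \<rat> - {0})"
      unfolding eventually_at_filter
      by (intro always_eventually allI impI) (simp add: h_inverse[symmetric])
  qed
  then show ?thesis by blast
qed

lemma h_tendsto:
  assumes "\<alpha> \<notin> \<rat>" "well_approx \<alpha>"
  shows "\<exists>L. (h \<longlongrightarrow> L) (at \<alpha> within \<rat> - {0})"
proof (cases "\<alpha> > 0")
  case True
  then show ?thesis using h_tendsto_pos assms by blast
next
  case False
  have "\<alpha> \<noteq> 0" using assms(1) by auto
  then have \<alpha>: "- \<alpha> > 0" using False by simp
  have "- \<alpha> \<notin> \<rat>" using assms(1) by simp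
  then obtain L where L: "(h \<longlongrightarrow> L) (at (- \<alpha>) within \<rat> - {0})"
    using h_tendsto_pos[of "- \<alpha>"] \<alpha> well_approx_minus[OF assms(2)] by auto
  have "filterlim (\<lambda>x. - x) (at (- \<alpha>) within \<rat> - {0}) (at \<alpha> within \<rat> - {0})"
    unfolding filterlim_at
  proof
    show "((\<lambda>x. - x) \<longlongrightarrow> - \<alpha>) (at \<alpha> within \<rat> - {0})" by (intro tendsto_intros)
    show "eventually (\<lambda>x. - x \<in> \<rat> - {0} \<and> - x \<noteq> - \<alpha>) (at \<alpha> within \<rat> - {0})"
      unfolding eventually_at_filter by (intro always_eventually) auto
  qed
  from filterlim_compose[OF L this] show ?thesis by (auto simp: h_minus)
qed

subsection \<open>Continued fractions\<close>

lemma cf_complete_irrational: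
  assumes "\<alpha> \<notin> \<rat>"
  shows "cf_complete \<alpha> n \<notin> \<rat>"
proof (induction n)
  case (Suc n)
  have "frac (cf_complete \<alpha> n) \<notin> \<rat>"
  proof
    assume "frac (cf_complete \<alpha> n) \<in> \<rat>"
    then have "frac (cf_complete \<alpha> n) + of_int \<lfloor>cf_complete \<alpha> n\<rfloor> \<in> \<rat>" by (intro Rats_add) auto
    then show False using Suc by (simp add: frac_def)
  qed
  then show ?case using irrational_inverse by simp
qed (use assms in simp)

lemma cf_complete_Suc:
  assumes "\<alpha> \<notin> \<rat>"
  shows "cf_complete \<alpha> (Suc n) > 1"
    "cf_complete \<alpha> n = of_int (cf_partial \<alpha> n) + 1 / cf_complete \<alpha> (Suc n)"
proof -
  have "cf_complete \<alpha> n \<notin> \<int>" using cf_complete_irrational[OF assms] Ints_subset_Rats by blast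
  then have "frac (cf_complete \<alpha> n) > 0" by (simp add: frac_gt_0_iff)
  moreover have "frac (cf_complete \<alpha> n) < 1" by (rule frac_lt_1)
  ultimately show "cf_complete \<alpha> (Suc n) > 1" by simp
  show "cf_complete \<alpha> n = of_int (cf_partial \<alpha> n) + 1 / cf_complete \<alpha> (Suc n)"
    by (simp add: cf_partial_def frac_def)
qed

text \<open>The classical \<alpha> = (p \<xi> + p')/(q \<xi> + q') with consecutive convergents and
  complete quotient \<xi>, stated through its invariants instead of a recursion for p and q. The
  inductive step substitutes \<xi> = c + 1/\<eta> and clears \<eta>. At n = 0 the second denominator
  is 0.\<close>

lemma cf_convergents:
  assumes "\<alpha> \<notin> \<rat>"
  shows "\<exists>(p::int) (q::int) (p'::int) (q'::int). \<bar>p * q' - p' * q\<bar> = (1::int) \<and> q \<ge> (1::int) \<and> q' \<ge> (0::int) \<and>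
    \<alpha> * (of_int q * cf_complete \<alpha> (Suc n) + of_int q') = of_int p * cf_complete \<alpha> (Suc n) + of_int p'"
proof (induction n)
  case 0
  define \<xi> where "\<xi> = cf_complete \<alpha> (Suc 0)"
  have "\<alpha> = of_int (cf_partial \<alpha> 0) + 1 / \<xi>" "\<xi> > 1"
    using cf_complete_Suc[OF assms, of 0] by (simp_all add: \<xi>_def)
  then have "\<alpha> * \<xi> = of_int (cf_partial \<alpha> 0) * \<xi> + 1"
    by (metis distrib_right divide_self_if not_one_less_zero times_divide_eq_left mult_1)
  then show ?case unfolding \<xi>_def[symmetric]
    by (intro exI[of _ "cf_partial \<alpha> 0"] exI[of _ 1] exI[of _ 0]) auto
next
  case (Suc n)
  define \<xi> where "\<xi> = cf_complete \<alpha> (Suc n)"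
  define \<eta> where "\<eta> = cf_complete \<alpha> (Suc (Suc n))"
  define c where "c = cf_partial \<alpha> (Suc n)"
  obtain p q p' q' :: int where IH: "\<bar>p * q' - p' * q\<bar> = 1" "q \<ge> 1" "q' \<ge> 0" "\<alpha> * (q * \<xi> + q') = p * \<xi> + p'"
    using Suc unfolding \<xi>_def by blast
  have \<xi>: "\<xi> = c + 1 / \<eta>" "\<eta> > 1" "\<xi> > 1"
    using cf_complete_Suc[OF assms, of "Suc n"] cf_complete_Suc(1)[OF assms, of n] by (simp_all only: \<xi>_def \<eta>_def c_def)
  have c: "c \<ge> 1" using \<xi>(3) unfolding c_def cf_partial_def \<xi>_def by (simp add: le_floor_iff)
  have \<xi>\<eta>: "\<xi> * \<eta> = c * \<eta> + 1" using \<xi> by (simp add: distrib_right)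
  have "\<alpha> * (q * (\<xi> * \<eta>) + q' * \<eta>) = p * (\<xi> * \<eta>) + p' * \<eta>"
    using arg_cong[OF IH(4), of "\<lambda>t. t * \<eta>"] by (simp add: algebra_simps)
  then have eq: "\<alpha> * ((q * c + q') * \<eta> + q) = (p * c + p') * \<eta> + p"
    unfolding \<xi>\<eta> by (simp add: algebra_simps)
  have "q * c \<ge> 1" using mult_mono[of 1 q 1 c] IH(2) c by simp
  moreover have "\<bar>(p * c + p') * q - p * (q * c + q')\<bar> = 1" using IH(1) by (simp add: algebra_simps)
  ultimately show ?case unfolding \<eta>_def[symmetric] using IH(2,3) eq
    by (intro exI[of _ "p * c + p'"] exI[of _ "q * c + q'"] exI[of _ p] exI[of _ q]) auto
qed

text \<open>A determinant of modulus 1 gives |\<alpha> - p/q| = 1/(q (q \<xi> + q')) \<le> 1/(\<xi>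
  q^2), and \<xi> is at least its integer part, the chosen large partial quotient.\<close>

lemma well_approx_of_unbounded_partial_quotients:
  assumes irr: "\<alpha> \<notin> \<rat>" and "\<not> bdd_above (cf_partial \<alpha> ` {1..})"
  shows "well_approx \<alpha>"
  unfolding well_approx_def
proof (intro allI impI)
  fix a :: real assume a: "a > 0"
  have "\<exists>c\<in>cf_partial \<alpha> ` {1..}. \<not> c \<le> \<lceil>a\<rceil>"
    using assms(2) unfolding bdd_above_def by blast
  then obtain k where k: "k \<ge> 1" "cf_partial \<alpha> k > \<lceil>a\<rceil>"
    by (auto simp: not_le)
  then obtain n where n: "k = Suc n" by (cases k) auto
  define \<xi> where "\<xi> = cf_complete \<alpha> (Suc n)"
  have "of_int (cf_partial \<alpha> k) \<le> \<xi>" unfolding cf_partial_def n \<xi>_def by simp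
  then have \<xi>: "\<xi> \<ge> a" using k(2) by linarith
  obtain p q p' q' :: int where pq: "\<bar>p * q' - p' * q\<bar> = 1" "q \<ge> 1" "q' \<ge> 0" "\<alpha> * (q * \<xi> + q') = p * \<xi> + p'"
    using cf_convergents[OF irr, of n] unfolding \<xi>_def by blast
  define D where "D = q * \<xi> + q'"
  have "real_of_int q * \<xi> > 0" using \<xi> a pq(2) by (intro mult_pos_pos) auto
  then have D: "D > 0" "D \<ge> q * \<xi>" using pq(3) by (auto simp: D_def)
  have "(\<alpha> - p / q) * (q * D) = q * (\<alpha> * D) - p * D" using pq(2) by (simp add: field_simps)
  also have "\<dots> = - of_int (p * q' - p' * q)" unfolding D_def pq(4) by (simp add: algebra_simps)
  finally have e: "(\<alpha> - p / q) * (q * D) = - of_int (p * q' - p' * q)" .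
  have "\<bar>\<alpha> - p / q\<bar> * (q * D) = \<bar>(\<alpha> - p / q) * (q * D)\<bar>"
    using pq(2) D(1) by (simp add: abs_mult)
  also have "\<dots> = of_int \<bar>p * q' - p' * q\<bar>" unfolding e by (simp only: abs_minus_cancel of_int_abs)
  finally have "\<bar>\<alpha> - p / q\<bar> * (q * D) = 1" unfolding pq(1) by simp
  then have "\<bar>\<alpha> - p / q\<bar> = 1 / (q * D)" using pq(2) D by (simp add: eq_divide_eq)
  also have "\<dots> \<le> 1 / (a * (real_of_int q)\<^sup>2)"
  proof (intro divide_left_mono)
    have "a * q \<le> q * \<xi>" using \<xi> pq(2) by (simp add: mult.commute)
    also have "\<dots> \<le> D" by (rule D(2))
    finally have "q * (a * q) \<le> q * D" using pq(2) by (intro mult_left_mono) auto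
    then show "a * (real_of_int q)\<^sup>2 \<le> q * D" by (simp add: power2_eq_square mult_ac)
  qed (use pq(2) a D in auto)
  finally show "\<exists>(p::int) (q::nat). q > 0 \<and> \<bar>\<alpha> - p / q\<bar> \<le> 1 / (a * (real q)\<^sup>2)"
    using pq(2) by (intro exI[of _ p] exI[of _ "nat q"]) auto
qed

theorem theorem1:
  fixes \<alpha> :: real
  assumes "\<alpha> \<notin> \<rat>"
    and "\<not> bdd_above (cf_partial \<alpha> ` {1..})"
  shows "\<exists>L::real. (h \<longlongrightarrow> L) (at \<alpha> within (\<rat> - {0}))"
  using h_tendsto[OF assms(1) well_approx_of_unbounded_partial_quotients[OF assms]] .

end
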